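(* Let $K$ be a field of characteristic zero. Let $2\leq d:=d_1=d_2<d_3$ be integers such that $2d>d_3+1$. Let $f_1,f_2,f_3\in S=K[x_1,x_2,x_3]$ be a regular sequence of homogeneous polynomials of degrees $d_1,d_2,d_3$, let $I=(f_1,f_2,f_3)$ and let $J=\operatorname{Gin}(I)$ be the generic initial ideal with respect to the reverse lexicographic order. Suppose $S/I$ has the strong Lefschetz property. If $d_3$ is even, then $J$ is the ideal generated by - $x_1^d$; $x_1^{d-1}x_2$; $x_1^{d-j-1}x_2^{2j+1}$ for $1\leq j\leq d_3-d-1$; - $x_1^{2d-d_3-2j+1}x_2^{2d_3-2d+3j-2}$ and $x_1^{2d-d_3-2j}x_2^{2d_3-2d+3j-1}$ for $1\leq j\leq\frac{2d-d_3}{2}$; - $x_3^{2j}x_1^{2j-1}x_2^{\frac{2d+d_3}{2}-3j},\ldots,x_3^{2j}x_2^{\frac{2d+d_3-2}{2}-j}$ for $1\leq j\leq\frac{2d-d_3-2}{2}$; - $x_3^{2d-d_3-2+2j}x_2^{2d_3-2d+2-2j}\{x_1,x_2\}^{2d-d_3+j-2}$ for $1\leq j\leq d_3-d$; - $x_3^{d_3-2+2j}\{x_1,x_2\}^{d-j}$ for $1\leq j\leq d$. If $d_3$ is odd, then $J$ is the ideal generated by - $x_1^d$; $x_1^{d-1}x_2$; $x_1^{d-j-1}x_2^{2j+1}$ for $1\leq j\leq d_3-d-1$; - $x_1^{2d-d_3-2j+1}x_2^{2d_3-2d+3j-2}$ and $x_1^{2d-d_3-2j}x_2^{2d_3-2d+3j-1}$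 for $1\leq j\leq\frac{2d-d_3-1}{2}$; - $x_2^{\frac{2d+d_3-1}{2}}$; $x_3x_2^{\frac{2d+d_3-3}{2}}$; $x_3^{2j+1}x_1^{2j}x_2^{\frac{2d+d_3-3}{2}-3j},\ldots,x_3^{2j+1}x_2^{\frac{2d+d_3-3}{2}-j}$ for $1\leq j\leq\frac{2d-d_3-3}{2}$; - $x_3^{2d-d_3-2+2j}x_2^{2d_3-2d+2-2j}\{x_1,x_2\}^{2d-d_3+j-2}$ for $1\leq j\leq d_3-d$; - $x_3^{d_3-2+2j}\{x_1,x_2\}^{d-j}$ for $1\leq j\leq d$.
   Context: $\{x_1,x_2\}^j$ denotes the set of all monomials of degree $j$ in $x_1,x_2$ (with $\{x_1,x_2\}^0=\{1\}$), and $m\{x_1,x_2\}^j$ is the set of products of the monomial $m$ with elements of it. A list $x_3^{c}x_1^{a}x_2^{b},\ldots,x_3^{c}x_2^{a+b}$ means all monomials $x_3^{c}x_1^{a-i}x_2^{b+i}$ with $0\leq i\leq a$. $S/I$ has the strong Lefschetz property (SLP) if there is a linear form $\ell\in S$ such that for all integers $b\geq 1$ and $t\geq 0$ the multiplication map $\ell^b:(S/I)_t\to(S/I)_{t+b}$ is injective or surjective. $\operatorname{Gin}(I)$ is the common initial ideal, with respect to the graded reverse lexicographic order with $x_1>x_2>x_3$, of $\alpha I$ for all $\alpha$ in a nonempty Zariski open subset of $GL_3(K)$ acting by linear changes of coordinates. *)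

theory Defs
  imports "HOL-Analysis.Analysis" "HOL-Library.Poly_Mapping"
begin

text \<open>
  Polynomials are finitely supported functions from monomials (finitely supported exponent
  vectors) to coefficients, with the convolution product of Poly_Mapping.
  The ring \<open>K[x\<^sub>1, x\<^sub>2, x\<^sub>3]\<close> is \<open>(3, 'a) mpoly\<close>; its variables are indexed by the elements
  1, 2, 3 of the numeral type 3.  Note that \<open>3 = 0\<close> in that type, so its built-in linear order
  is not the order of the indices and is not used below.
\<close>

type_synonym 'v mon = "'v \<Rightarrow>\<^sub>0 nat"
type_synonym ('v, 'a) mpoly = "('v \<Rightarrow>\<^sub>0 nat) \<Rightarrow>\<^sub>0 'a"

abbreviation monom_poly :: "'v mon \<Rightarrow> ('v, 'a::comm_ring_1) mpoly" where
  "monom_poly m \<equiv> Poly_Mapping.single m 1"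

abbreviation X :: "'v \<Rightarrow> ('v, 'a::comm_ring_1) mpoly" where
  "X i \<equiv> monom_poly (Poly_Mapping.single i 1)"

text \<open>Evaluation at the point \<open>g\<close> of a commutative ring, coefficients being mapped by \<open>c\<close>.\<close>

definition eval_mpoly ::
    "('a::zero \<Rightarrow> 'b::comm_ring_1) \<Rightarrow> ('v::finite \<Rightarrow> 'b) \<Rightarrow> ('v, 'a) mpoly \<Rightarrow> 'b" where
  "eval_mpoly c g p =
    (\<Sum>m\<in>Poly_Mapping.keys p. c (Poly_Mapping.lookup p m) * (\<Prod>i\<in>UNIV. g i ^ Poly_Mapping.lookup m i))"

definition mon_degree :: "'v::finite mon \<Rightarrow> nat" where
  "mon_degree m = (\<Sum>i\<in>UNIV. Poly_Mapping.lookup m i)"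

text \<open>The graded piece of degree \<open>t\<close> of the polynomial ring (it contains 0).\<close>

definition homog :: "nat \<Rightarrow> ('v::finite, 'a::zero) mpoly set" where
  "homog t = {f. \<forall>m\<in>Poly_Mapping.keys f. mon_degree m = t}"

text \<open>A commutative ring is a module over itself, and its submodules are its ideals.\<close>

definition ideal :: "'r::comm_ring_1 set \<Rightarrow> 'r set" where
  "ideal B = module.span (*) B"

lemma module_times: "module ((*) :: 'r::comm_ring_1 \<Rightarrow> 'r \<Rightarrow> 'r)"
  by unfold_locales (auto simp: algebra_simps)

definition regular_sequence :: "'r::comm_ring_1 list \<Rightarrow> bool" where
  "regular_sequence fs \<longleftrightarrow>
    (\<forall>i<length fs. \<forall>g. fs ! i * g \<in> ideal (set (take i fs)) \<longrightarrow> g \<in> ideal (set (take i fs)))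
    \<and> ideal (set fs) \<noteq> UNIV"

definition ideal_cong :: "'r::comm_ring_1 set \<Rightarrow> ('r \<times> 'r) set" where
  "ideal_cong I = {(f, g). f - g \<in> I}"

text \<open>The degree \<open>t\<close> part of \<open>S/I\<close> for a homogeneous ideal \<open>I\<close>: the residue classes of the
  homogeneous polynomials of degree \<open>t\<close>.\<close>

definition quot_piece ::
    "('v::finite, 'a::comm_ring_1) mpoly set \<Rightarrow> nat \<Rightarrow> ('v, 'a) mpoly set set" where
  "quot_piece I t = homog t // ideal_cong I"

text \<open>Multiplication by the class of \<open>h\<close>; the union is over representatives of the class \<open>C\<close>,
  all of which contribute the same class when \<open>I\<close> is an ideal.\<close>

definition quot_mult :: "'r::comm_ring_1 set \<Rightarrow> 'r \<Rightarrow> 'r set \<Rightarrow> 'r set" where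
  "quot_mult I h C = (\<Union>f\<in>C. ideal_cong I `` {h * f})"

lemma quot_mult_class:
  "quot_mult (ideal B) h (ideal_cong (ideal B) `` {f}) = ideal_cong (ideal B) `` {h * f}"
  for h :: "'r::comm_ring_1"
proof -
  interpret m: module "(*) :: 'r \<Rightarrow> 'r \<Rightarrow> 'r" by (rule module_times)
  have trans: "x - z \<in> ideal B" if "x - y \<in> ideal B" "y - z \<in> ideal B" for x y z :: 'r
    using m.span_add[of "x - y" B "y - z"] that by (simp add: ideal_def)
  have scale: "h * f - h * g \<in> ideal B" if "f - g \<in> ideal B" for g
    using m.span_scale[of "f - g" B h] that by (simp add: ideal_def right_diff_distrib)
  have "f - f \<in> ideal B"
    using m.span_zero[of B] by (simp add: ideal_def)
  then show ?thesis
    unfolding quot_mult_def ideal_cong_def using trans scale by blast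
qed

definition strong_Lefschetz :: "('v::finite, 'a::comm_ring_1) mpoly set \<Rightarrow> bool" where
  "strong_Lefschetz I \<longleftrightarrow>
    (\<exists>l\<in>homog 1. \<forall>b\<ge>1. \<forall>t.
      inj_on (quot_mult I (l ^ b)) (quot_piece I t)
      \<or> quot_mult I (l ^ b) ` quot_piece I t = quot_piece I (t + b))"

text \<open>Graded reverse lexicographic order with \<open>x\<^sub>1 > x\<^sub>2 > x\<^sub>3\<close>.  In equal degrees the exponents
  of \<open>x\<^sub>2\<close> and \<open>x\<^sub>3\<close> determine that of \<open>x\<^sub>1\<close>, so it is not compared.\<close>

definition grevlex_less :: "3 mon \<Rightarrow> 3 mon \<Rightarrow> bool" where
  "grevlex_less u v \<longleftrightarrow>
    mon_degree u < mon_degree v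
    \<or> mon_degree u = mon_degree v \<and>
      (Poly_Mapping.lookup u 3 > Poly_Mapping.lookup v 3
       \<or> Poly_Mapping.lookup u 3 = Poly_Mapping.lookup v 3 \<and>
         Poly_Mapping.lookup u 2 > Poly_Mapping.lookup v 2)"

definition is_lead_mon :: "3 mon \<Rightarrow> (3, 'a::zero) mpoly \<Rightarrow> bool" where
  "is_lead_mon m f \<longleftrightarrow>
    m \<in> Poly_Mapping.keys f \<and> (\<forall>m'\<in>Poly_Mapping.keys f. m' \<noteq> m \<longrightarrow> grevlex_less m' m)"

definition initial_ideal :: "(3, 'a::comm_ring_1) mpoly set \<Rightarrow> (3, 'a) mpoly set" where
  "initial_ideal I = ideal {monom_poly m | m. \<exists>f\<in>I. is_lead_mon m f}"

text \<open>The linear change of coordinates \<open>x\<^sub>j \<mapsto> \<Sum>\<^sub>i A\<^sub>i\<^sub>j x\<^sub>i\<close>.\<close>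

definition lin_change :: "'a::comm_ring_1 ^ 3 ^ 3 \<Rightarrow> (3, 'a) mpoly \<Rightarrow> (3, 'a) mpoly" where
  "lin_change A f =
    eval_mpoly (Poly_Mapping.single 0) (\<lambda>j. \<Sum>i\<in>UNIV. Poly_Mapping.single 0 (A $ i $ j) * X i) f"

text \<open>The Zariski open subsets of \<open>GL\<^sub>3(K)\<close> are the complements in it of the zero sets of families
  of polynomials in the nine matrix entries.\<close>

definition zariski_open_GL3 :: "('a::field ^ 3 ^ 3) set \<Rightarrow> bool" where
  "zariski_open_GL3 U \<longleftrightarrow>
    (\<exists>P :: (3 \<times> 3, 'a) mpoly set.
      U = {A. invertible A \<and> (\<exists>p\<in>P. eval_mpoly (\<lambda>c. c) (\<lambda>(i, j). A $ i $ j) p \<noteq> 0)})"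

definition Gin :: "(3, 'a::field) mpoly set \<Rightarrow> (3, 'a) mpoly set" where
  "Gin I = (THE J. \<exists>U. zariski_open_GL3 U \<and> U \<noteq> {} \<and>
    (\<forall>A\<in>U. initial_ideal (lin_change A ` I) = J))"

text \<open>The set \<open>{x\<^sub>1, x\<^sub>2}\<^sup>j\<close> of all monomials of degree \<open>j\<close> in \<open>x\<^sub>1, x\<^sub>2\<close>.\<close>

definition mons12 :: "nat \<Rightarrow> (3, 'a::comm_ring_1) mpoly set" where
  "mons12 j = {X 1 ^ a * X 2 ^ b | a b. a + b = j}"

text \<open>
  The generators of the revlex generic initial ideal.  Under the standing assumptions
  \<open>d < e\<close> and \<open>e + 1 < 2 * d\<close> all natural number subtractions are exact in the indicated
  ranges; every division by 2 is exact for the relevant parity of \<open>e\<close>.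
\<close>

definition gens_even :: "nat \<Rightarrow> nat \<Rightarrow> (3, 'a::comm_ring_1) mpoly set" where
  "gens_even d e =
    {X 1 ^ d, X 1 ^ (d - 1) * X 2}
    \<union> {X 1 ^ (d - j - 1) * X 2 ^ (2 * j + 1) | j. 1 \<le> j \<and> j \<le> e - d - 1}
    \<union> (\<Union>j\<in>{1..(2 * d - e) div 2}.
         {X 1 ^ (2 * d - e - 2 * j + 1) * X 2 ^ (2 * e - 2 * d + 3 * j - 2),
          X 1 ^ (2 * d - e - 2 * j) * X 2 ^ (2 * e - 2 * d + 3 * j - 1)})
    \<union> {X 3 ^ (2 * j) * X 1 ^ (2 * j - 1 - i) * X 2 ^ ((2 * d + e) div 2 - 3 * j + i) | i j.
         1 \<le> j \<and> j \<le> (2 * d - e - 2) div 2 \<and> i \<le> 2 * j - 1}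
    \<union> (\<Union>j\<in>{1..e - d}.
         (*) (X 3 ^ (2 * d - e - 2 + 2 * j) * X 2 ^ (2 * e - 2 * d + 2 - 2 * j))
           ` mons12 (2 * d - e + j - 2))
    \<union> (\<Union>j\<in>{1..d}. (*) (X 3 ^ (e - 2 + 2 * j)) ` mons12 (d - j))"

definition gens_odd :: "nat \<Rightarrow> nat \<Rightarrow> (3, 'a::comm_ring_1) mpoly set" where
  "gens_odd d e =
    {X 1 ^ d, X 1 ^ (d - 1) * X 2}
    \<union> {X 1 ^ (d - j - 1) * X 2 ^ (2 * j + 1) | j. 1 \<le> j \<and> j \<le> e - d - 1}
    \<union> (\<Union>j\<in>{1..(2 * d - e - 1) div 2}.
         {X 1 ^ (2 * d - e - 2 * j + 1) * X 2 ^ (2 * e - 2 * d + 3 * j - 2),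
          X 1 ^ (2 * d - e - 2 * j) * X 2 ^ (2 * e - 2 * d + 3 * j - 1)})
    \<union> {X 2 ^ ((2 * d + e - 1) div 2), X 3 * X 2 ^ ((2 * d + e - 3) div 2)}
    \<union> {X 3 ^ (2 * j + 1) * X 1 ^ (2 * j - i) * X 2 ^ ((2 * d + e - 3) div 2 - 3 * j + i) | i j.
         1 \<le> j \<and> j \<le> (2 * d - e - 3) div 2 \<and> i \<le> 2 * j}
    \<union> (\<Union>j\<in>{1..e - d}.
         (*) (X 3 ^ (2 * d - e - 2 + 2 * j) * X 2 ^ (2 * e - 2 * d + 2 - 2 * j))
           ` mons12 (2 * d - e + j - 2))
    \<union> (\<Union>j\<in>{1..d}. (*) (X 3 ^ (e - 2 + 2 * j)) ` mons12 (d - j))"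

end

theory Submission
  imports Defs "HOL-Computational_Algebra.Polynomial"
begin

text \<open>
  Write \<open>e\<close> for the third degree, \<open>S\<^sub>n\<close> for the forms of degree \<open>n\<close>, \<open>H\<close> for the Hilbert
  function of \<open>S/I\<close> and \<open>N = 2 d + e - 3\<close> for its top degree.  Regularity determines \<open>H\<close>
  (\<open>complete_intersection_3\<close>): it is symmetric about \<open>N/2\<close>, increases up to there, and for
  \<open>2 t \<le> N\<close> the difference \<open>H t - H (t - 1)\<close> equals \<open>t + 1 - \<gamma> t\<close> with
  \<open>\<gamma> t = 2 max 0 (t + 1 - d) + max 0 (t + 1 - e)\<close>.  The claim is that the monomials
  \<open>x\<^sub>1\<^sup>a x\<^sub>2\<^sup>b x\<^sub>3\<^sup>c\<close> outside the generic initial ideal, called standard here, are those with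
  \<open>2 (a + b) + c \<le> N\<close> and \<open>\<gamma> (a + b) \<le> b\<close>.

  Existence of good coordinates (\<open>standard_independent\<close>).  Let \<open>x\<^sub>3\<close> be a strong Lefschetz
  element.  Then multiplication by \<open>x\<^sub>3\<^sup>c\<close> is injective on \<open>(S/I)\<^sub>t\<close> whenever \<open>2 t + c \<le> N\<close>.
  A combination of standard monomials of one degree that lies in \<open>I\<close> can therefore be divided
  by the highest power of \<open>x\<^sub>3\<close> that divides it, without leaving \<open>I\<close>.  Setting \<open>x\<^sub>3 = 0\<close> and
  \<open>x\<^sub>1 = 1\<close> gives a polynomial in one variable which lies in a space of dimension at most
  \<open>\<gamma> t\<close> and, after the coordinate change \<open>x\<^sub>2 \<mapsto> x\<^sub>2 + z x\<^sub>1\<close>, vanishes to order at least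
  \<open>\<gamma> t\<close> at \<open>z\<close>.  In characteristic zero this is impossible for almost all \<open>z\<close> unless the
  polynomial is zero (\<open>finite_high_order_vanishing\<close>).  So the standard monomials are linearly
  independent modulo the transformed ideal.

  Independence is an open condition (\<open>independent_mod_ideal_open\<close>), hence holds on a nonempty
  Zariski open set of coordinates.  In such coordinates the initial ideal is forced
  (\<open>nonstandard_reduces\<close>, \<open>lead_monomials\<close>).  The space \<open>x\<^sub>3\<^sup>c S\<^sub>t\<close> modulo the ideal has dimension
  at most \<open>min (H t) (H (t + c))\<close>, and at least as many standard monomials of degree \<open>t + c\<close> are
  divisible by \<open>x\<^sub>3\<^sup>c\<close>; thus they span it.  Every nonstandard monomial becomes congruent to a
  combination of standard ones, which are all smaller in the reverse lexicographic order.

  Finally the nonstandard monomials form the monomial ideal with the listed generators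
  (\<open>gin_ideal_even\<close>, \<open>gin_ideal_odd\<close>).
\<close>

section \<open>Dimensions of subspaces\<close>

text \<open>
  A vector space of arbitrary dimension.  The locale has a name of its own so that the notions
  added to it are not inherited by the real vector spaces.
\<close>

locale lin_space = vector_space
begin

text \<open>Finite-dimensional subspaces.\<close>

definition fin_dim :: "'b set \<Rightarrow> bool" where
  "fin_dim V \<longleftrightarrow> subspace V \<and> (\<exists>B. finite B \<and> V \<subseteq> span B)"

lemma fin_dim_subspace: "fin_dim V \<Longrightarrow> subspace V"
  by (simp add: fin_dim_def)

lemma fin_dim_subset:
  assumes "fin_dim V" and "subspace U" and "U \<subseteq> V"
  shows "fin_dim U"
  using assms unfolding fin_dim_def by (blast dest: subset_trans)

lemma fin_dim_span: "finite B \<Longrightarrow> fin_dim (span B)"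
  unfolding fin_dim_def by (blast intro: subspace_span)

lemma fin_dim_extend_basis:
  assumes "fin_dim V" and "D \<subseteq> V" and "independent D"
  obtains B where "D \<subseteq> B" "finite B" "independent B" "B \<subseteq> V" "span B = V" "card B = dim V"
proof -
  obtain B where B: "D \<subseteq> B" "B \<subseteq> V" "independent B" "V \<subseteq> span B"
    using maximal_independent_subset_extend[OF assms(2,3)] by blast
  obtain C where C: "finite C" "V \<subseteq> span C"
    using assms(1) unfolding fin_dim_def by blast
  have "finite B"
    using independent_span_bound[OF C(1) B(3) subset_trans[OF B(2) C(2)]] by simp
  moreover have "span B = V"
    using B fin_dim_subspace[OF assms(1)] by (simp add: span_subspace)
  ultimately show ?thesis
    using that[OF B(1) _ B(3,2) _ basis_card_eq_dim[OF B(2,4,3)]] by simp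
qed

lemma fin_dim_basis:
  assumes "fin_dim V"
  obtains B where "finite B" "independent B" "B \<subseteq> V" "span B = V" "card B = dim V"
  by (rule fin_dim_extend_basis[OF assms, of "{}"]) (auto intro: that simp: local.dependent_def)

lemma fin_dim_dim_mono:
  assumes "fin_dim V" and "subspace U" and "U \<subseteq> V"
  shows "dim U \<le> dim V"
proof -
  obtain B where B: "finite B" "independent B" "B \<subseteq> U" "span B = U" "card B = dim U"
    using fin_dim_basis[OF fin_dim_subset[OF assms(1-3)]] .
  obtain C where C: "B \<subseteq> C" "finite C" "card C = dim V"
    using fin_dim_extend_basis[OF assms(1) subset_trans[OF B(3) assms(3)] B(2)] by metis
  show ?thesis
    using card_mono[OF C(2,1)] B C by simp
qed

lemma fin_dim_dim_equal:
  assumes "fin_dim V" and "subspace U" and "U \<subseteq> V" and "dim V \<le> dim U"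
  shows "U = V"
proof -
  obtain B where B: "finite B" "independent B" "B \<subseteq> U" "span B = U" "card B = dim U"
    using fin_dim_basis[OF fin_dim_subset[OF assms(1-3)]] .
  obtain C where C: "B \<subseteq> C" "finite C" "card C = dim V" "span C = V"
    using fin_dim_extend_basis[OF assms(1) subset_trans[OF B(3) assms(3)] B(2)] by metis
  have "B = C"
    using card_seteq[OF C(2,1)] B C assms(4) by simp
  then show ?thesis using B C by simp
qed

end

locale lin_space_pair = vs1: lin_space s1 + vs2: lin_space s2
  for s1 :: "'a::field \<Rightarrow> 'b::ab_group_add \<Rightarrow> 'b" and s2 :: "'a \<Rightarrow> 'c::ab_group_add \<Rightarrow> 'c"
begin

text \<open>
  The dimension formula behind every dimension count below.  With \<open>U = 0\<close> it is the
  rank-nullity theorem, and with \<open>L\<close> the identity it is the formula for \<open>U + V\<close>.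
\<close>

lemma dim_sum_image:
  assumes L: "Vector_Spaces.linear s1 s2 L" and U: "vs2.fin_dim U" and V: "vs1.fin_dim V"
  shows "vs2.fin_dim {u + L v | u v. u \<in> U \<and> v \<in> V}"
    and "vs2.dim {u + L v | u v. u \<in> U \<and> v \<in> V} + vs1.dim {v \<in> V. L v \<in> U}
      = vs2.dim U + vs1.dim V"
proof -
  interpret L: Vector_Spaces.linear s1 s2 L by fact
  define K where "K = {v \<in> V. L v \<in> U}"
  let ?S = "{u + L v | u v. u \<in> U \<and> v \<in> V}"
  have sV: "vs1.subspace V" and sU: "vs2.subspace U"
    using U V by (auto simp: vs1.fin_dim_subspace vs2.fin_dim_subspace)
  have K: "vs1.subspace K"
    unfolding K_def
    by (rule vs1.subspaceI)
       (auto simp: L.zero L.add L.scale sV sU vs1.subspace_0 vs2.subspace_0 vs1.subspace_add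
         vs2.subspace_add vs1.subspace_scale vs2.subspace_scale)
  have KV: "K \<subseteq> V" by (auto simp: K_def)
  obtain D where D: "finite D" "vs1.independent D" "D \<subseteq> K" "vs1.span D = K" "card D = vs1.dim K"
    using vs1.fin_dim_basis[OF vs1.fin_dim_subset[OF V K KV]] .
  obtain B where B: "D \<subseteq> B" "finite B" "vs1.independent B" "B \<subseteq> V" "vs1.span B = V"
      "card B = vs1.dim V"
    using vs1.fin_dim_extend_basis[OF V subset_trans[OF D(3) KV] D(2)] by metis
  obtain E where E: "finite E" "vs2.independent E" "E \<subseteq> U" "vs2.span E = U" "card E = vs2.dim U"
    using vs2.fin_dim_basis[OF U] .
  define C where "C = B - D"
  have finC: "finite C" and CV: "C \<subseteq> V" using B by (auto simp: C_def)
  have notin: "c \<notin> vs1.span (B - {c})" if "c \<in> C" for c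
    using B(3) that unfolding vs1.dependent_def C_def by blast
  have span_D: "vs1.span D \<subseteq> vs1.span (B - {c})" if "c \<in> C" for c
    using that B(1) by (intro vs1.span_mono) (auto simp: C_def)
  have inj: "inj_on L C"
  proof (rule inj_onI, rule ccontr)
    fix c c' assume c: "c \<in> C" "c' \<in> C" "L c = L c'" "c \<noteq> c'"
    have "L (c - c') = 0" using c by (simp add: L.diff)
    moreover have "c - c' \<in> V"
      using c(1,2) CV by (intro vs1.subspace_diff[OF sV]) auto
    ultimately have "c - c' \<in> K"
      using vs2.subspace_0[OF sU] by (simp add: K_def)
    then have "c - c' \<in> vs1.span (B - {c})" using D(4) span_D[OF c(1)] by blast
    moreover have "c' \<in> vs1.span (B - {c})"
      using c by (intro vs1.span_base) (auto simp: C_def)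
    ultimately have "(c - c') + c' \<in> vs1.span (B - {c})" by (rule vs1.span_add)
    then show False using notin[OF c(1)] by simp
  qed
  have disj: "L ` C \<inter> E = {}"
  proof -
    have False if "c \<in> C" "L c \<in> E" for c
      using that CV E(3) D(4) span_D[OF that(1)] notin[OF that(1)] by (auto simp: K_def)
    then show ?thesis by auto
  qed
  have indep: "vs2.independent (L ` C \<union> E)"
  proof (rule vs2.independent_if_scalars_zero)
    show "finite (L ` C \<union> E)" using finC E by simp
  next
    fix f x assume sum0: "(\<Sum>x\<in>L ` C \<union> E. s2 (f x) x) = 0" and x: "x \<in> L ` C \<union> E"
    have sE: "(\<Sum>x\<in>E. s2 (f x) x) \<in> U"
      using E(3) sU by (intro vs2.subspace_sum) (auto intro: vs2.subspace_scale)
    have *: "L (\<Sum>c\<in>C. s1 (f (L c)) c) + (\<Sum>x\<in>E. s2 (f x) x) = 0"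
      using sum0 finC E(1) disj inj
      by (simp add: sum.union_disjoint sum.reindex L.sum L.scale)
    then have "L (\<Sum>c\<in>C. s1 (f (L c)) c) = - (\<Sum>x\<in>E. s2 (f x) x)"
      by (simp add: eq_neg_iff_add_eq_0)
    then have "L (\<Sum>c\<in>C. s1 (f (L c)) c) \<in> U"
      using sE sU by (simp add: vs2.subspace_neg)
    moreover have "(\<Sum>c\<in>C. s1 (f (L c)) c) \<in> V"
      using CV sV by (intro vs1.subspace_sum) (auto intro: vs1.subspace_scale)
    ultimately have "(\<Sum>c\<in>C. s1 (f (L c)) c) \<in> vs1.span D"
      using D(4) by (simp add: K_def)
    then obtain u where u: "(\<Sum>c\<in>C. s1 (f (L c)) c) = (\<Sum>v\<in>D. s1 (u v) v)"
      unfolding vs1.span_finite[OF D(1)] by auto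
    define k where "k v = (if v \<in> C then f (L v) else - u v)" for v
    have BCD: "B = C \<union> D" "C \<inter> D = {}" using B(1) by (auto simp: C_def)
    have "(\<Sum>v\<in>B. s1 (k v) v) = (\<Sum>c\<in>C. s1 (f (L c)) c) + (\<Sum>v\<in>D. s1 (- u v) v)"
      unfolding BCD(1) sum.union_disjoint[OF finC D(1) BCD(2)]
      using BCD(2) by (intro arg_cong2[where f = "(+)"] sum.cong) (auto simp: k_def)
    also have "\<dots> = 0" using u by (simp add: sum_negf)
    finally have "\<forall>v\<in>B. k v = 0"
      using vs1.independentD[OF B(3,2)] by blast
    then have fC: "\<forall>c\<in>C. f (L c) = 0"
      using BCD(1) by (auto simp: k_def split: if_splits)
    then have "(\<Sum>x\<in>E. s2 (f x) x) = 0"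
      using * by (simp add: L.zero)
    then have "\<forall>x\<in>E. f x = 0"
      using vs2.independentD[OF E(2,1)] by blast
    then show "f x = 0" using x fC by blast
  qed
  have span: "vs2.span (L ` C \<union> E) = ?S"
  proof -
    have "?S = {x + y | x y. x \<in> vs2.span (L ` C) \<and> y \<in> vs2.span E}" (is "_ = ?R")
    proof (intro equalityI subsetI)
      fix w assume "w \<in> ?S"
      then obtain u v where w: "w = u + L v" "u \<in> U" "v \<in> V" by blast
      have "v \<in> vs1.span (C \<union> D)" using w(3) B(1,5) by (simp add: C_def Un_absorb2)
      then obtain x y where v: "v = x + y" "x \<in> vs1.span C" "y \<in> K"
        unfolding vs1.span_Un D(4) by blast
      have "L x \<in> vs2.span (L ` C)" using v(2) by (simp add: L.span_image)
      moreover have "u + L y \<in> vs2.span E"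
        using w(2) v(3) sU E(4) by (auto simp: K_def vs2.subspace_add)
      moreover have "w = L x + (u + L y)"
        by (simp add: w(1) v(1) L.add ac_simps)
      ultimately show "w \<in> ?R" by blast
    next
      fix w assume "w \<in> ?R"
      then obtain x y where w: "w = L x + y" "x \<in> vs1.span C" "y \<in> U"
        unfolding L.span_image E(4) by blast
      have "x \<in> V" using w(2) vs1.span_minimal[OF CV sV] by blast
      then show "w \<in> ?S" using w by (auto simp: add.commute)
    qed
    then show ?thesis unfolding vs2.span_Un by simp
  qed
  show "vs2.fin_dim ?S"
    unfolding span[symmetric] using finC E(1) by (intro vs2.fin_dim_span) simp
  have "vs2.dim ?S = card (L ` C \<union> E)"
    unfolding span[symmetric] by (rule vs2.dim_span_eq_card_independent[OF indep])
  also have "\<dots> = card C + card E"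
    using finC E(1) disj inj by (simp add: card_Un_disjoint card_image)
  also have "card C = card B - card D"
    unfolding C_def using B(1) D(1) by (simp add: card_Diff_subset)
  finally show "vs2.dim ?S + vs1.dim {v \<in> V. L v \<in> U} = vs2.dim U + vs1.dim V"
    using B(6) D(5) E(5) card_mono[OF B(2,1)] unfolding K_def by simp
qed

lemma dim_image:
  assumes L: "Vector_Spaces.linear s1 s2 L" and V: "vs1.fin_dim V"
  shows "vs2.fin_dim (L ` V)" and "vs2.dim (L ` V) + vs1.dim {v \<in> V. L v = 0} = vs1.dim V"
proof -
  have zero: "vs2.fin_dim {0}"
    using vs2.fin_dim_span[of "{}"] by simp
  have "vs2.dim {0} = 0"
    using vs2.dim_span_eq_card_independent[of "{}"] by (simp add: vs2.dependent_def)
  moreover have "{u + L v | u v. u \<in> {0} \<and> v \<in> V} = L ` V" by auto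
  ultimately show "vs2.fin_dim (L ` V)" "vs2.dim (L ` V) + vs1.dim {v \<in> V. L v = 0} = vs1.dim V"
    using dim_sum_image[OF L zero V] by simp_all
qed

lemma dim_image_inj:
  assumes L: "Vector_Spaces.linear s1 s2 L" and V: "vs1.fin_dim V"
    and inj: "\<And>v. v \<in> V \<Longrightarrow> L v = 0 \<Longrightarrow> v = 0"
  shows "vs2.dim (L ` V) = vs1.dim V"
proof -
  interpret L: Vector_Spaces.linear s1 s2 L by fact
  have "{v \<in> V. L v = 0} = {0}"
    using inj vs1.subspace_0[OF vs1.fin_dim_subspace[OF V]] by (auto simp: L.zero)
  moreover have "vs1.dim {0} = 0"
    using vs1.dim_span_eq_card_independent[of "{}"] by (simp add: vs1.dependent_def)
  ultimately show ?thesis using dim_image(2)[OF L V] by simp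
qed

end

section \<open>Order of vanishing in spaces of univariate polynomials\<close>

global_interpretation upoly: lin_space "smult :: 'a::field \<Rightarrow> 'a poly \<Rightarrow> 'a poly"
  by unfold_locales (auto simp: smult_add_right smult_add_left)

text \<open>
  A space of polynomials of dimension \<open>w\<close> over a field of characteristic zero contains, for
  almost all \<open>z\<close>, no nonzero polynomial vanishing to order \<open>w\<close> at \<open>z\<close>; this is the
  nonvanishing of a Wronskian.  The induction replaces a space containing \<open>g \<noteq> 0\<close> by the space
  of all \<open>f' g - f g'\<close>, whose dimension is smaller by one.
\<close>

lemma finite_high_order_vanishing:
  fixes B :: "'a::field_char_0 poly set"
  assumes "finite B" and "card B \<le> w"
  shows "finite {z. \<exists>f\<in>upoly.span B. f \<noteq> 0 \<and> [:-z, 1:] ^ w dvd f}"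
  using assms
proof (induction w arbitrary: B)
  case 0
  then show ?case by simp
next
  case (Suc w)
  show ?case
  proof (cases "\<exists>g\<in>B. g \<noteq> 0")
    case False
    then have "upoly.span B \<subseteq> upoly.span {0}"
      by (intro upoly.span_mono) auto
    then have "f = 0" if "f \<in> upoly.span B" for f
      using that by auto
    then show ?thesis by (auto intro: finite_subset[of _ "{}"])
  next
    case True
    then obtain g where g: "g \<in> B" "g \<noteq> 0" by blast
    define W where "W f = pderiv f * g - f * pderiv g" for f
    have W_lin: "Vector_Spaces.linear smult smult W"
      by unfold_locales
         (auto simp: W_def pderiv_add pderiv_smult algebra_simps smult_diff_right)
    interpret W: Vector_Spaces.linear smult smult W by fact
    define D where "D = W ` (B - {g})"
    have "finite D" "card D \<le> w"
      using Suc.prems g card_image_le[of "B - {g}" W] by (auto simp: D_def)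
    note fin = Suc.IH[OF this]
    have W_span: "W f \<in> upoly.span D" if "f \<in> upoly.span B" for f
    proof -
      have "W ` upoly.span B = upoly.span (W ` B)" by (simp add: W.span_image)
      also have "W ` B = insert 0 D" using g by (force simp: D_def W_def)
      finally show ?thesis using that by auto
    qed
    have "{z. \<exists>f\<in>upoly.span B. f \<noteq> 0 \<and> [:-z, 1:] ^ Suc w dvd f} \<subseteq>
      {z. \<exists>f\<in>upoly.span D. f \<noteq> 0 \<and> [:-z, 1:] ^ w dvd f} \<union> {z. poly g z = 0}"
    proof (rule subsetI, rule ccontr)
      fix z assume z: "z \<in> {z. \<exists>f\<in>upoly.span B. f \<noteq> 0 \<and> [:-z, 1:] ^ Suc w dvd f}"
        and nz: "z \<notin> {z. \<exists>f\<in>upoly.span D. f \<noteq> 0 \<and> [:-z, 1:] ^ w dvd f} \<union> {z. poly g z = 0}"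
      from z obtain f where f: "f \<in> upoly.span B" "f \<noteq> 0" "[:-z, 1:] ^ Suc w dvd f" by blast
      have ord: "Suc w \<le> order z f" using f(2,3) order_divides[of z "Suc w" f] by blast
      have f': "pderiv f \<noteq> 0"
      proof
        assume "pderiv f = 0"
        then have "degree f = 0" by (simp add: pderiv_eq_0_iff)
        then show False using ord order_degree[OF f(2), of z] by simp
      qed
      have ord': "order z f = Suc (order z (pderiv f))"
        using order_pderiv[OF f(2)] ord f(2) order_root[of f z] by simp
      have ord_g: "order z g = 0" using nz by (intro order_0I) simp
      have "[:-z, 1:] ^ w dvd pderiv f"
        using ord ord' by (simp add: order_divides)
      moreover have "[:-z, 1:] ^ w dvd f"
        using f(3) by (rule power_le_dvd) simp
      ultimately have "[:-z, 1:] ^ w dvd W f"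
        unfolding W_def by (intro dvd_diff dvd_mult2) auto
      then have "W f = 0" using W_span[OF f(1)] nz by blast
      then have eq: "pderiv f * g = f * pderiv g" by (simp add: W_def)
      then have "f * pderiv g \<noteq> 0" using f' g(2) by (metis mult_eq_0_iff)
      then have "order z f \<le> order z (f * pderiv g)" by (simp add: order_mult)
      also have "\<dots> = order z (pderiv f)"
        unfolding eq[symmetric] using f' g(2) ord_g by (simp add: order_mult)
      finally show False using ord' by simp
    qed
    moreover have "finite {z. poly g z = 0}" using g(2) by (rule poly_roots_finite)
    ultimately show ?thesis using fin by (meson finite_Un finite_subset)
  qed
qed

section \<open>Evaluation of polynomials\<close>

(* The variable X i is a monomial with exponent 1, which is not to be rewritten to Suc 0. *)
declare One_nat_def [simp del]

lemma poly_mapping_sum_single: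
  fixes p :: "'v \<Rightarrow>\<^sub>0 'a::comm_monoid_add"
  shows "p = (\<Sum>m\<in>Poly_Mapping.keys p. Poly_Mapping.single m (Poly_Mapping.lookup p m))"
  by (rule poly_mapping_eqI) (auto simp: lookup_sum lookup_single when_def in_keys_iff)

lemma mpoly_induct [case_names zero add]:
  fixes p :: "('v, 'a::comm_monoid_add) mpoly"
  assumes "P 0" and "\<And>m a p. P p \<Longrightarrow> P (Poly_Mapping.single m a + p)"
  shows "P p"
proof -
  have "P (\<Sum>m\<in>A. Poly_Mapping.single m (Poly_Mapping.lookup p m))" if "finite A" for A
    using that by (induction A rule: finite_induct) (simp_all add: assms)
  then show ?thesis
    by (subst poly_mapping_sum_single[of p]) simp
qed

text \<open>A ring homomorphism on the coefficients makes evaluation a ring homomorphism.\<close>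

locale coeff_hom =
  fixes c :: "'a::comm_ring_1 \<Rightarrow> 'b::comm_ring_1"
  assumes add: "c (a + b) = c a + c b" and mult: "c (a * b) = c a * c b" and one: "c 1 = 1"
begin

lemma zero: "c 0 = 0"
  using add[of 0 0] by simp

lemma eval_single:
  "eval_mpoly c g (Poly_Mapping.single m a) = c a * (\<Prod>i\<in>UNIV. g i ^ Poly_Mapping.lookup m i)"
  by (simp add: eval_mpoly_def zero)

lemma eval_zero: "eval_mpoly c g 0 = 0"
  by (simp add: eval_mpoly_def)

lemma eval_add: "eval_mpoly c g (p + q) = eval_mpoly c g p + eval_mpoly c g q"
  unfolding eval_mpoly_def
  by (rule setsum_keys_plus_distrib) (simp_all add: zero add distrib_right)

lemma eval_one: "eval_mpoly c g 1 = 1"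
  using eval_single[of g 0 1] by (simp add: one)

lemma eval_single_mult:
  "eval_mpoly c g (Poly_Mapping.single m a * q) =
    eval_mpoly c g (Poly_Mapping.single m a) * eval_mpoly c g q"
  by (induction q rule: mpoly_induct)
     (simp_all add: eval_zero eval_add eval_single mult_single lookup_add power_add prod.distrib
       mult distrib_left ac_simps)

lemma eval_mult: "eval_mpoly c g (p * q) = eval_mpoly c g p * eval_mpoly c g q"
  by (induction p rule: mpoly_induct)
     (simp_all add: eval_zero eval_add eval_single_mult distrib_right)

lemma eval_X: "eval_mpoly c g (X i) = g i"
  by (simp add: eval_single one lookup_single when_def if_distrib prod.delta cong: if_cong)

end

lemma X_power: "X i ^ k = monom_poly (Poly_Mapping.single i k)"
  by (induction k) (simp_all add: mult_single single_add[symmetric] plus_1_eq_Suc)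

lemma monom_poly_prod: "finite A \<Longrightarrow> (\<Prod>i\<in>A. monom_poly (f i)) = monom_poly (\<Sum>i\<in>A. f i)"
  by (induction A rule: finite_induct) (simp_all add: mult_single)

lemma mon_sum_single:
  "(m :: 'v::finite mon) = (\<Sum>i\<in>UNIV. Poly_Mapping.single i (Poly_Mapping.lookup m i))"
  by (rule poly_mapping_eqI) (simp add: lookup_sum lookup_single when_def)

lemma monom_poly_eq_prod:
  "(monom_poly m :: ('v::finite, 'a::comm_ring_1) mpoly) = (\<Prod>i\<in>UNIV. X i ^ Poly_Mapping.lookup m i)"
  by (simp add: X_power monom_poly_prod mon_sum_single[symmetric])

text \<open>A ring homomorphism is determined by its values on the constants and the variables.\<close>

lemma mpoly_hom_unique:
  fixes \<phi> :: "('v::finite, 'a::comm_ring_1) mpoly \<Rightarrow> 'b::comm_ring_1"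
  assumes add: "\<And>p q. \<phi> (p + q) = \<phi> p + \<phi> q" and mult: "\<And>p q. \<phi> (p * q) = \<phi> p * \<phi> q"
    and one: "\<phi> 1 = 1"
  shows "\<phi> p = eval_mpoly (\<lambda>a. \<phi> (Poly_Mapping.single 0 a)) (\<lambda>i. \<phi> (X i)) p"
proof -
  have phi_zero: "\<phi> 0 = 0" using add[of 0 0] by simp
  interpret c: coeff_hom "\<lambda>a. \<phi> (Poly_Mapping.single 0 a)"
    by unfold_locales (simp_all add: single_add add one flip: mult, simp add: mult_single)
  have power: "\<phi> (q ^ n) = \<phi> q ^ n" for q n by (induction n) (simp_all add: one mult)
  have prod: "\<phi> (\<Prod>i\<in>A. f i) = (\<Prod>i\<in>A. \<phi> (f i))" for A :: "'v set" and f
    by (induction A rule: infinite_finite_induct) (simp_all add: one mult)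
  show ?thesis
  proof (induction p rule: mpoly_induct)
    case zero
    then show ?case by (simp add: phi_zero c.eval_zero)
  next
    case (add m a p)
    have "\<phi> (Poly_Mapping.single m a) = \<phi> (Poly_Mapping.single 0 a * monom_poly m)"
      by (simp add: mult_single)
    also have "\<dots> = eval_mpoly (\<lambda>a. \<phi> (Poly_Mapping.single 0 a)) (\<lambda>i. \<phi> (X i)) (Poly_Mapping.single m a)"
      unfolding c.eval_single mult by (subst monom_poly_eq_prod) (simp only: prod power)
    finally show ?case by (simp add: assms(1) c.eval_add add)
  qed
qed

section \<open>Linear changes of coordinates\<close>

global_interpretation const: coeff_hom "Poly_Mapping.single 0 :: 'a::comm_ring_1 \<Rightarrow> ('v, 'a) mpoly"
  by unfold_locales (simp_all add: single_add mult_single)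

lemma lin_change_add: "lin_change A (f + g) = lin_change A f + lin_change A g"
  by (simp add: lin_change_def const.eval_add)

lemma lin_change_mult: "lin_change A (f * g) = lin_change A f * lin_change A g"
  by (simp add: lin_change_def const.eval_mult)

lemma lin_change_one [simp]: "lin_change A 1 = 1"
  by (simp add: lin_change_def const.eval_one)

lemma lin_change_zero [simp]: "lin_change A 0 = 0"
  by (simp add: lin_change_def const.eval_zero)

lemma lin_change_uminus: "lin_change A (- f) = - lin_change A f"
  using lin_change_add[of A f "- f"] by (simp add: eq_neg_iff_add_eq_0 add.commute)

lemma lin_change_power: "lin_change A (f ^ n) = lin_change A f ^ n"
  by (induction n) (simp_all add: lin_change_mult)

lemma lin_change_sum: "lin_change A (\<Sum>i\<in>S. f i) = (\<Sum>i\<in>S. lin_change A (f i))"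
  by (induction S rule: infinite_finite_induct) (simp_all add: lin_change_add)

lemma lin_change_const [simp]: "lin_change A (Poly_Mapping.single 0 a) = Poly_Mapping.single 0 a"
  by (simp add: lin_change_def const.eval_single)

lemma lin_change_X: "lin_change A (X j) = (\<Sum>i\<in>UNIV. Poly_Mapping.single 0 (A $ i $ j) * X i)"
  by (simp add: lin_change_def const.eval_X)

lemma const_sum:
  "(\<Sum>k\<in>S. Poly_Mapping.single 0 (f k)) = (Poly_Mapping.single 0 (\<Sum>k\<in>S. f k) :: ('v, 'a::comm_ring_1) mpoly)"
  by (induction S rule: infinite_finite_induct) (simp_all add: single_add)

lemma lin_change_comp: "lin_change A (lin_change B f) = lin_change (A ** B) f"
proof -
  have "lin_change A (lin_change B f) =
      eval_mpoly (Poly_Mapping.single 0) (\<lambda>j. lin_change A (lin_change B (X j))) f"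
    by (subst mpoly_hom_unique[where \<phi> = "\<lambda>f. lin_change A (lin_change B f)"])
       (simp_all add: lin_change_add lin_change_mult)
  also have "(\<lambda>j. lin_change A (lin_change B (X j))) =
      (\<lambda>j. \<Sum>i\<in>UNIV. Poly_Mapping.single 0 ((A ** B) $ i $ j) * X i)"
  proof
    fix j
    have "lin_change A (lin_change B (X j)) =
        (\<Sum>k\<in>UNIV. \<Sum>i\<in>UNIV. Poly_Mapping.single 0 (B $ k $ j) * (Poly_Mapping.single 0 (A $ i $ k) * X i))"
      by (simp only: lin_change_X lin_change_sum lin_change_mult lin_change_const sum_distrib_left)
    also have "\<dots> = (\<Sum>i\<in>UNIV. \<Sum>k\<in>UNIV. Poly_Mapping.single 0 (A $ i $ k * B $ k $ j) * X i)"
      by (subst sum.swap) (simp add: mult_single mult.commute)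
    also have "\<dots> = (\<Sum>i\<in>UNIV. (\<Sum>k\<in>UNIV. Poly_Mapping.single 0 (A $ i $ k * B $ k $ j)) * X i)"
      by (simp only: sum_distrib_right)
    also have "\<dots> = (\<Sum>i\<in>UNIV. Poly_Mapping.single 0 ((A ** B) $ i $ j) * X i)"
      by (simp only: matrix_matrix_mult_def vec_lambda_beta const_sum)
    finally show "lin_change A (lin_change B (X j)) =
      (\<Sum>i\<in>UNIV. Poly_Mapping.single 0 ((A ** B) $ i $ j) * X i)" .
  qed
  finally show ?thesis by (simp add: lin_change_def)
qed

lemma lin_change_id: "lin_change (mat 1) f = f"
proof -
  have "(\<Sum>i\<in>UNIV. Poly_Mapping.single 0 ((mat 1 :: 'a ^ 3 ^ 3) $ i $ j) * X i) = (X j :: (3, 'a) mpoly)" for j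
  proof -
    have "(\<Sum>i\<in>UNIV. Poly_Mapping.single 0 ((mat 1 :: 'a ^ 3 ^ 3) $ i $ j) * X i) =
       (\<Sum>i\<in>UNIV. if i = j then X i else (0 :: (3, 'a) mpoly))"
      by (intro sum.cong) (auto simp: mat_def)
    then show ?thesis by simp
  qed
  then have "lin_change (mat 1) f = eval_mpoly (Poly_Mapping.single 0) X f"
    by (simp add: lin_change_def)
  also have "\<dots> = f"
    by (subst mpoly_hom_unique[where \<phi> = "\<lambda>f. f"]) simp_all
  finally show ?thesis .
qed

lemma lin_change_invertible:
  fixes A :: "'a::field ^ 3 ^ 3"
  assumes "invertible A"
  obtains B where "invertible B" "\<And>f. lin_change B (lin_change A f) = f"
    "\<And>f. lin_change A (lin_change B f) = f"
proof -
  obtain B where "A ** B = mat 1" "B ** A = mat 1"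
    using assms unfolding invertible_def by blast
  then show ?thesis
    using that[of B] unfolding invertible_def by (auto simp: lin_change_comp lin_change_id)
qed

section \<open>Graded pieces\<close>

lemma mon_degree_add: "mon_degree (m + n) = mon_degree m + mon_degree n"
  by (simp add: mon_degree_def lookup_add sum.distrib)

lemma mon_degree_single [simp]: "mon_degree (Poly_Mapping.single i k) = k"
  by (simp add: mon_degree_def lookup_single when_def)

lemma mon_degree_zero [simp]: "mon_degree 0 = 0"
  by (simp add: mon_degree_def)

lemma homog_zero [simp]: "0 \<in> homog t"
  by (simp add: homog_def)

lemma homog_add: "f \<in> homog t \<Longrightarrow> g \<in> homog t \<Longrightarrow> f + g \<in> homog t"
  using keys_add[of f g] by (auto simp: homog_def)

lemma homog_sum: "(\<And>i. i \<in> S \<Longrightarrow> f i \<in> homog t) \<Longrightarrow> (\<Sum>i\<in>S. f i) \<in> homog t"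
  by (induction S rule: infinite_finite_induct) (simp_all add: homog_add)

lemma homog_mult: "f \<in> homog s \<Longrightarrow> g \<in> homog t \<Longrightarrow> f * g \<in> homog (s + t)"
  using keys_mult[of f g] by (fastforce simp: homog_def mon_degree_add)

lemma homog_single: "mon_degree m = t \<Longrightarrow> Poly_Mapping.single m a \<in> homog t"
  by (simp add: homog_def)

lemma homog_const_mult: "f \<in> homog t \<Longrightarrow> Poly_Mapping.single 0 a * f \<in> homog t"
  using homog_mult[of "Poly_Mapping.single 0 a" 0 f t] by (simp add: homog_single)

lemma homog_one: "1 \<in> homog 0"
  by (subst single_one[symmetric]) (rule homog_single, simp)

lemma homog_power: "f \<in> homog t \<Longrightarrow> f ^ n \<in> homog (n * t)"
  by (induction n) (auto simp: homog_one homog_mult)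

lemma homog_prod: "(\<And>i. i \<in> S \<Longrightarrow> f i \<in> homog (t i)) \<Longrightarrow> (\<Prod>i\<in>S. f i) \<in> homog (\<Sum>i\<in>S. t i)"
  by (induction S rule: infinite_finite_induct) (simp_all add: homog_mult homog_one)

lemma lin_change_homog:
  assumes "f \<in> homog t"
  shows "lin_change A f \<in> homog t"
  unfolding lin_change_def eval_mpoly_def
proof (intro homog_sum homog_const_mult)
  fix m assume "m \<in> Poly_Mapping.keys f"
  then have "mon_degree m = t" using assms by (simp add: homog_def)
  moreover have "(\<Sum>i\<in>UNIV. Poly_Mapping.single 0 (A $ i $ j) * X i) ^ k \<in> homog k" for j k
    using homog_power[of "\<Sum>i\<in>UNIV. Poly_Mapping.single 0 (A $ i $ j) * X i" 1 k]
    by (simp add: homog_sum homog_const_mult homog_single)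
  ultimately show "(\<Prod>j\<in>UNIV. (\<Sum>i\<in>UNIV. Poly_Mapping.single 0 (A $ i $ j) * X i) ^ Poly_Mapping.lookup m j)
      \<in> homog t"
    using homog_prod[of UNIV "\<lambda>j. (\<Sum>i\<in>UNIV. Poly_Mapping.single 0 (A $ i $ j) * X i) ^ Poly_Mapping.lookup m j"
      "Poly_Mapping.lookup m"]
    by (simp only: mon_degree_def)
qed

text \<open>The part of a polynomial supported on the monomials that satisfy \<open>P\<close>.\<close>

definition mon_part :: "('v mon \<Rightarrow> bool) \<Rightarrow> ('v, 'a::comm_ring_1) mpoly \<Rightarrow> ('v, 'a) mpoly" where
  "mon_part P p = (\<Sum>m | m \<in> Poly_Mapping.keys p \<and> P m. Poly_Mapping.single m (Poly_Mapping.lookup p m))"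

lemma lookup_mon_part:
  "Poly_Mapping.lookup (mon_part P p) m = (if P m then Poly_Mapping.lookup p m else 0)"
proof -
  have "Poly_Mapping.lookup (mon_part P p) m =
      (\<Sum>n | n \<in> Poly_Mapping.keys p \<and> P n. if n = m then Poly_Mapping.lookup p n else 0)"
    by (simp add: mon_part_def lookup_sum lookup_single when_def)
  also have "\<dots> = (if P m then Poly_Mapping.lookup p m else 0)"
    by (simp add: sum.delta in_keys_iff)
  finally show ?thesis .
qed

lemma keys_mon_part: "Poly_Mapping.keys (mon_part P p) = {m \<in> Poly_Mapping.keys p. P m}"
  by (auto simp: in_keys_iff lookup_mon_part split: if_splits)

text \<open>The homogeneous component of degree \<open>n\<close>.\<close>

abbreviation hcomp :: "nat \<Rightarrow> ('v::finite, 'a::comm_ring_1) mpoly \<Rightarrow> ('v, 'a) mpoly" where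
  "hcomp n \<equiv> mon_part (\<lambda>m. mon_degree m = n)"

lemma mon_part_add: "mon_part P (p + q) = mon_part P p + mon_part P q"
  by (rule poly_mapping_eqI) (simp add: lookup_mon_part lookup_add)

lemma mon_part_zero [simp]: "mon_part P 0 = 0"
  by (simp add: mon_part_def)

lemma mon_part_sum: "mon_part P (\<Sum>i\<in>S. f i) = (\<Sum>i\<in>S. mon_part P (f i))"
  by (induction S rule: infinite_finite_induct) (simp_all add: mon_part_add)

lemma hcomp_in_homog: "hcomp n p \<in> homog n"
  by (simp add: homog_def keys_mon_part)

lemma hcomp_homog:
  assumes "p \<in> homog s"
  shows "hcomp n p = (if s = n then p else 0)"
  using assms
  by (intro poly_mapping_eqI) (auto simp: lookup_mon_part homog_def in_keys_iff)

lemma sum_hcomp: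
  "p = (\<Sum>j\<in>mon_degree ` Poly_Mapping.keys p. hcomp j p)"
proof (rule poly_mapping_eqI)
  fix m
  have "(\<Sum>j\<in>mon_degree ` Poly_Mapping.keys p. if mon_degree m = j then Poly_Mapping.lookup p m else 0) =
      Poly_Mapping.lookup p m"
    by (cases "m \<in> Poly_Mapping.keys p") (simp_all add: sum.delta' not_in_keys_iff_lookup_eq_zero)
  then show "Poly_Mapping.lookup p m =
      Poly_Mapping.lookup (\<Sum>j\<in>mon_degree ` Poly_Mapping.keys p. hcomp j p) m"
    by (simp only: lookup_sum lookup_mon_part)
qed

lemma hcomp_mult_homog:
  assumes "f \<in> homog k"
  shows "hcomp n (a * f) = (if k \<le> n then hcomp (n - k) a * f else 0)"
proof -
  let ?J = "mon_degree ` Poly_Mapping.keys a"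
  have "hcomp n (a * f) = hcomp n (\<Sum>j\<in>?J. hcomp j a * f)"
    using arg_cong[OF sum_hcomp[of a], of "\<lambda>x. hcomp n (x * f)"] by (simp only: sum_distrib_right)
  also have "\<dots> = (\<Sum>j\<in>?J. if j + k = n then hcomp j a * f else 0)"
    unfolding mon_part_sum
    by (intro sum.cong refl) (simp add: hcomp_homog[OF homog_mult[OF hcomp_in_homog assms]])
  also have "\<dots> = (\<Sum>j\<in>?J. if j = n - k \<and> k \<le> n then hcomp j a * f else 0)"
    by (intro sum.cong) auto
  also have "\<dots> = (if k \<le> n then hcomp (n - k) a * f else 0)"
  proof -
    have "hcomp (n - k) a = 0" if "n - k \<notin> ?J"
    proof -
      have "Poly_Mapping.keys (hcomp (n - k) a) = {}"
        using that by (auto simp: keys_mon_part image_iff)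
      then show ?thesis by simp
    qed
    then show ?thesis by (cases "k \<le> n"; cases "n - k \<in> ?J") (simp_all only: simp_thms if_True if_False sum.delta finite_imageI finite_keys sum.neutral_const, simp)
  qed
  finally show ?thesis .
qed

section \<open>Polynomials as a vector space\<close>

text \<open>Multiplication of a polynomial by a scalar.\<close>

definition scal :: "'a::field \<Rightarrow> ('v, 'a) mpoly \<Rightarrow> ('v, 'a) mpoly" where
  "scal c p = Poly_Mapping.single 0 c * p"

lemma lookup_scal [simp]: "Poly_Mapping.lookup (scal c p) m = c * Poly_Mapping.lookup p m"
  by (simp add: scal_def mult_map_scale_conv_mult[symmetric] Poly_Mapping.map.rep_eq when_def)

global_interpretation mp: lin_space "scal :: 'a::field \<Rightarrow> ('v, 'a) mpoly \<Rightarrow> _"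
  by unfold_locales
     (auto intro!: poly_mapping_eqI simp: lookup_add distrib_left distrib_right mult.assoc)

global_interpretation mm: lin_space_pair "scal :: 'a::field \<Rightarrow> ('v, 'a) mpoly \<Rightarrow> _"
  "scal :: 'a \<Rightarrow> ('v, 'a) mpoly \<Rightarrow> _"
  by unfold_locales

global_interpretation mu: lin_space_pair "scal :: 'a::field \<Rightarrow> ('v, 'a) mpoly \<Rightarrow> _"
  "smult :: 'a \<Rightarrow> 'a poly \<Rightarrow> _"
  by unfold_locales

lemma scal_mult_right: "p * scal c q = scal c (p * q)"
  by (simp add: scal_def mult.left_commute)

lemma linear_mult: "Vector_Spaces.linear scal scal ((*) q)"
  by unfold_locales (simp_all add: distrib_left scal_mult_right)

lemma lin_change_scal: "lin_change A (scal c f) = scal c (lin_change A f)"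
  by (simp add: scal_def lin_change_mult)

lemma linear_lin_change: "Vector_Spaces.linear scal scal (lin_change A)"
  by unfold_locales (simp_all add: lin_change_add lin_change_scal)

lemma linear_id: "Vector_Spaces.linear scal scal (\<lambda>x. x)"
  by unfold_locales simp_all

lemma scal_monom: "scal c (monom_poly m) = Poly_Mapping.single m c"
  by (simp add: scal_def mult_single)

lemma inj_monom_poly: "inj (monom_poly :: 'v mon \<Rightarrow> ('v, 'a::field) mpoly)"
  by (rule injI) (metis keys_single one_neq_zero singleton_inject)

lemma subspace_supported: "mp.subspace {p :: ('v, 'a::field) mpoly. Poly_Mapping.keys p \<subseteq> M}"
proof (rule mp.subspaceI)
  fix x y :: "('v, 'a) mpoly" assume "x \<in> {p. Poly_Mapping.keys p \<subseteq> M}" "y \<in> {p. Poly_Mapping.keys p \<subseteq> M}"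
  then show "x + y \<in> {p. Poly_Mapping.keys p \<subseteq> M}"
    using keys_add[of x y] by blast
qed (auto simp: in_keys_iff subset_iff)

lemma span_monomials:
  "mp.span (monom_poly ` M) = {p :: ('v, 'a::field) mpoly. Poly_Mapping.keys p \<subseteq> M}"
proof (rule mp.span_subspace)
  show "{p :: ('v, 'a) mpoly. Poly_Mapping.keys p \<subseteq> M} \<subseteq> mp.span (monom_poly ` M)"
  proof
    fix p :: "('v, 'a) mpoly" assume "p \<in> {p. Poly_Mapping.keys p \<subseteq> M}"
    then have "(\<Sum>m\<in>Poly_Mapping.keys p. scal (Poly_Mapping.lookup p m) (monom_poly m))
        \<in> mp.span (monom_poly ` M)"
      by (intro mp.span_sum mp.span_scale mp.span_base) auto
    then show "p \<in> mp.span (monom_poly ` M)"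
      by (simp add: scal_monom poly_mapping_sum_single[symmetric])
  qed
qed (auto simp: subspace_supported)

lemma independent_monomials:
  assumes "finite M"
  shows "mp.independent (monom_poly ` M :: ('v, 'a::field) mpoly set)"
proof (rule mp.independent_if_scalars_zero)
  fix f :: "('v, 'a) mpoly \<Rightarrow> 'a" and x :: "('v, 'a) mpoly"
  assume *: "(\<Sum>x\<in>monom_poly ` M. scal (f x) x) = 0" and "x \<in> monom_poly ` M"
  then obtain m where m: "x = monom_poly m" "m \<in> M" by blast
  have "inj_on (monom_poly :: _ \<Rightarrow> ('v, 'a) mpoly) M"
    using inj_monom_poly by (rule inj_on_subset) simp
  then have "(\<Sum>x\<in>monom_poly ` M. scal (f x) x) = (\<Sum>n\<in>M. Poly_Mapping.single n (f (monom_poly n)))"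
    by (simp add: sum.reindex scal_monom)
  then have "(\<Sum>n\<in>M. Poly_Mapping.lookup (Poly_Mapping.single n (f (monom_poly n))) m) = 0"
    using * by (metis lookup_sum lookup_zero)
  then show "f x = 0"
    using m assms by (simp add: lookup_single when_def)
qed (use assms in simp)

lemma dim_supported:
  assumes "finite M"
  shows "mp.dim {p :: ('v, 'a::field) mpoly. Poly_Mapping.keys p \<subseteq> M} = card M"
    and "mp.fin_dim {p :: ('v, 'a::field) mpoly. Poly_Mapping.keys p \<subseteq> M}"
proof -
  have "card (monom_poly ` M :: ('v, 'a) mpoly set) = card M"
    by (rule card_image) (rule inj_on_subset[OF inj_monom_poly], simp)
  then show "mp.dim {p :: ('v, 'a) mpoly. Poly_Mapping.keys p \<subseteq> M} = card M"
    using mp.dim_span_eq_card_independent[OF independent_monomials[OF assms]]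
    by (metis span_monomials)
  show "mp.fin_dim {p :: ('v, 'a::field) mpoly. Poly_Mapping.keys p \<subseteq> M}"
    unfolding span_monomials[symmetric] using assms by (intro mp.fin_dim_span) simp
qed

section \<open>Monomials in three variables\<close>

text \<open>The exponent vector of \<open>x\<^sub>1\<^sup>a x\<^sub>2\<^sup>b x\<^sub>3\<^sup>c\<close>.\<close>

definition mon3 :: "nat \<Rightarrow> nat \<Rightarrow> nat \<Rightarrow> 3 mon" where
  "mon3 a b c = Poly_Mapping.single 1 a + Poly_Mapping.single 2 b + Poly_Mapping.single 3 c"

lemma three_distinct: "(1::3) \<noteq> 2" "(1::3) \<noteq> 3" "(2::3) \<noteq> 3" "(2::3) \<noteq> 1" "(3::3) \<noteq> 1" "(3::3) \<noteq> 2"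
  by simp_all

lemma lookup_mon3 [simp]:
  "Poly_Mapping.lookup (mon3 a b c) 1 = a" "Poly_Mapping.lookup (mon3 a b c) 2 = b"
  "Poly_Mapping.lookup (mon3 a b c) 3 = c"
  using three_distinct by (simp_all only: mon3_def lookup_add lookup_single when_def simp_thms if_True if_False add_0_left add_0_right)

lemma mon3_eqI:
  assumes "Poly_Mapping.lookup m 1 = Poly_Mapping.lookup n 1"
    "Poly_Mapping.lookup m 2 = Poly_Mapping.lookup n 2" "Poly_Mapping.lookup m 3 = Poly_Mapping.lookup n 3"
  shows "(m :: 3 mon) = n"
proof (rule poly_mapping_eqI)
  fix i :: 3
  show "Poly_Mapping.lookup m i = Poly_Mapping.lookup n i"
    using exhaust_3[of i] assms by metis
qed

lemma mon3_lookup: "mon3 (Poly_Mapping.lookup m 1) (Poly_Mapping.lookup m 2) (Poly_Mapping.lookup m 3) = m"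
  by (rule mon3_eqI) simp_all

lemma mon_degree_3:
  "mon_degree m = Poly_Mapping.lookup m 1 + Poly_Mapping.lookup m 2 + Poly_Mapping.lookup m (3::3)"
  by (simp only: mon_degree_def sum_3)

lemma mon_degree_mon3 [simp]: "mon_degree (mon3 a b c) = a + b + c"
  by (simp add: mon_degree_3 del: num1_eq1)

lemma mon3_add: "mon3 a b c + mon3 a' b' c' = mon3 (a + a') (b + b') (c + c')"
  by (rule mon3_eqI) (simp_all add: lookup_add)

text \<open>
  Monomials of degree \<open>n\<close> are enumerated by their degree \<open>t\<close> in the first two variables and the
  exponent \<open>b\<close> of the second variable.
\<close>

lemma card_monomials:
  assumes "T \<subseteq> {..n}" and "\<And>t. t \<in> T \<Longrightarrow> S t \<subseteq> {..t}"
  shows "card {mon3 (t - b) b (n - t) | t b. t \<in> T \<and> b \<in> S t} = (\<Sum>t\<in>T. card (S t))"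
proof -
  have finite: "finite T" "\<And>t. t \<in> T \<Longrightarrow> finite (S t)"
    using finite_subset[OF assms(1)] finite_subset[OF assms(2)] by auto
  have eq: "{mon3 (t - b) b (n - t) | t b. t \<in> T \<and> b \<in> S t} =
      (\<lambda>(t, b). mon3 (t - b) b (n - t)) ` (SIGMA t:T. S t)"
    by auto
  have "inj_on (\<lambda>(t, b). mon3 (t - b) b (n - t)) (SIGMA t:T. S t)"
  proof (rule inj_onI, clarify)
    fix t b t' b'
    assume *: "t \<in> T" "b \<in> S t" "t' \<in> T" "b' \<in> S t'" "mon3 (t - b) b (n - t) = mon3 (t' - b') b' (n - t')"
    have "b = b'" and "n - t = n - t'"
      using arg_cong[OF *(5), of "\<lambda>m. Poly_Mapping.lookup m 2"]
        arg_cong[OF *(5), of "\<lambda>m. Poly_Mapping.lookup m 3"] by simp_all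
    moreover have "t \<le> n" "t' \<le> n" using * assms(1) by auto
    ultimately show "t = t' \<and> b = b'" by simp
  qed
  then show ?thesis
    unfolding eq using finite by (simp add: card_image)
qed

lemma monomials_of_degree:
  "{m. mon_degree m = n} = {mon3 (t - b) b (n - t) | t b. t \<in> {..n} \<and> b \<in> {..t}}"
proof (intro equalityI subsetI)
  fix m :: "3 mon" assume "m \<in> {m. mon_degree m = n}"
  then have "m = mon3 (Poly_Mapping.lookup m 1 + Poly_Mapping.lookup m 2 - Poly_Mapping.lookup m 2)
      (Poly_Mapping.lookup m 2) (n - (Poly_Mapping.lookup m 1 + Poly_Mapping.lookup m 2))"
    "Poly_Mapping.lookup m 1 + Poly_Mapping.lookup m 2 \<in> {..n}"
    "Poly_Mapping.lookup m 2 \<in> {..Poly_Mapping.lookup m 1 + Poly_Mapping.lookup m 2}"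
    by (auto simp: mon_degree_3 mon3_lookup)
  then show "m \<in> {mon3 (t - b) b (n - t) | t b. t \<in> {..n} \<and> b \<in> {..t}}"
    by blast
qed auto

lemma finite_monomials: "finite {m :: 3 mon. mon_degree m = n}"
proof -
  have "{m :: 3 mon. mon_degree m = n} \<subseteq> (\<lambda>(t, b). mon3 (t - b) b (n - t)) ` ({..n} \<times> {..n})"
    unfolding monomials_of_degree by force
  then show ?thesis by (rule finite_subset) simp
qed

lemma homog_eq_supported: "homog n = {p. Poly_Mapping.keys p \<subseteq> {m. mon_degree m = n}}"
  by (auto simp: homog_def)

lemma fin_dim_homog: "mp.fin_dim (homog n :: (3, 'a::field) mpoly set)"
  unfolding homog_eq_supported by (rule dim_supported[OF finite_monomials])

lemma dim_homog: "2 * mp.dim (homog n :: (3, 'a::field) mpoly set) = (n + 1) * (n + 2)"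
proof -
  have "mp.dim (homog n :: (3, 'a) mpoly set) = (\<Sum>t\<le>n. card {..t})"
    unfolding homog_eq_supported dim_supported(1)[OF finite_monomials]
    unfolding monomials_of_degree by (subst card_monomials) auto
  also have "2 * \<dots> = (n + 1) * (n + 2)"
    by (induction n) simp_all
  finally show ?thesis .
qed

section \<open>Homogeneous ideals and their Hilbert functions\<close>

global_interpretation idl: module "(*) :: 'r::comm_ring_1 \<Rightarrow> 'r \<Rightarrow> 'r"
  by (rule module_times)

lemma ideal_zero: "0 \<in> ideal B" and ideal_add: "f \<in> ideal B \<Longrightarrow> g \<in> ideal B \<Longrightarrow> f + g \<in> ideal B"
  and ideal_diff: "f \<in> ideal B \<Longrightarrow> g \<in> ideal B \<Longrightarrow> f - g \<in> ideal B"
  and ideal_mult: "f \<in> ideal B \<Longrightarrow> h * f \<in> ideal B"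
  and ideal_base: "f \<in> B \<Longrightarrow> f \<in> ideal B"
  and ideal_sum: "(\<And>i. i \<in> S \<Longrightarrow> k i \<in> ideal B) \<Longrightarrow> (\<Sum>i\<in>S. k i) \<in> ideal B"
  unfolding ideal_def
  by (auto intro: idl.span_zero idl.span_add idl.span_diff idl.span_scale idl.span_base idl.span_sum)

lemma ideal_least: "B \<subseteq> ideal C \<Longrightarrow> ideal B \<subseteq> ideal C"
  unfolding ideal_def by (rule idl.span_minimal) (auto intro: idl.subspace_span)

lemma ideal_empty: "ideal {} = {0}"
  by (simp add: ideal_def)

lemma ideal_insert: "f \<in> ideal (insert a B) \<longleftrightarrow> (\<exists>k. f - k * a \<in> ideal B)"
  by (simp add: ideal_def idl.span_insert)

lemma subspace_ideal: "mp.subspace (ideal B)"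
  by (rule mp.subspaceI) (simp_all add: ideal_zero ideal_add ideal_mult scal_def)

text \<open>A set of polynomials that contains all homogeneous components of its elements.\<close>

definition homogeneous :: "('v::finite, 'a::comm_ring_1) mpoly set \<Rightarrow> bool" where
  "homogeneous I \<longleftrightarrow> (\<forall>f\<in>I. \<forall>n. hcomp n f \<in> I)"

lemma homogeneous_insert:
  assumes "homogeneous (ideal B)" and "a \<in> homog k"
  shows "homogeneous (ideal (insert a B))"
  unfolding homogeneous_def
proof (intro ballI allI)
  fix f n assume "f \<in> ideal (insert a B)"
  then obtain q where q: "f - q * a \<in> ideal B" by (auto simp: ideal_insert)
  have "hcomp n (f - q * a) + hcomp n (q * a) = hcomp n f"
    by (simp flip: mon_part_add)
  then have "hcomp n f - hcomp n (q * a) \<in> ideal B"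
    using assms(1) q by (metis add_diff_cancel_right' homogeneous_def)
  moreover have "\<exists>r. hcomp n (q * a) = r * a"
    using hcomp_mult_homog[OF assms(2)] by (metis mult_zero_left)
  ultimately show "hcomp n f \<in> ideal (insert a B)"
    by (auto simp: ideal_insert)
qed

lemma homogeneous_empty: "homogeneous (ideal {})"
  by (simp add: homogeneous_def ideal_empty)

lemma subspace_homog: "mp.subspace (homog n :: (3, 'a::field) mpoly set)"
  using fin_dim_homog by (rule mp.fin_dim_subspace)

lemma subspace_piece: "mp.subspace (ideal B \<inter> homog n :: (3, 'a::field) mpoly set)"
  by (intro mp.subspace_inter subspace_ideal subspace_homog)

lemma fin_dim_piece: "mp.fin_dim (ideal B \<inter> homog n :: (3, 'a::field) mpoly set)"
  by (rule mp.fin_dim_subset[OF fin_dim_homog subspace_piece Int_lower2])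

text \<open>
  The Hilbert function of the quotient by \<open>I\<close>, extended by zero to negative degrees so that
  shifts need no case distinction.
\<close>

definition hilb :: "(3, 'a::field) mpoly set \<Rightarrow> int \<Rightarrow> int" where
  "hilb I n = (if n < 0 then 0
    else int (mp.dim (homog (nat n) :: (3, 'a) mpoly set)) - int (mp.dim (I \<inter> homog (nat n))))"

lemma hilb_nat:
  fixes I :: "(3, 'a::field) mpoly set"
  shows "hilb I (int n) = int (mp.dim (homog n :: (3, 'a) mpoly set)) - int (mp.dim (I \<inter> homog n))"
  by (simp add: hilb_def)

text \<open>
  The exact sequence \<open>0 \<rightarrow> (S/I)\<^bsub>n - k\<^esub> \<rightarrow> (S/I)\<^sub>n \<rightarrow> (S/(I + (a)))\<^sub>n \<rightarrow> 0\<close> for a form \<open>a\<close> of degree \<open>k\<close>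
  that is a nonzerodivisor modulo \<open>I\<close>.
\<close>

lemma hilb_insert:
  fixes a :: "(3, 'a::field) mpoly"
  assumes hom: "homogeneous (ideal B)" and a: "a \<in> homog k"
    and reg: "\<And>g. a * g \<in> ideal B \<Longrightarrow> g \<in> ideal B"
  shows "hilb (ideal (insert a B)) n = hilb (ideal B) n - hilb (ideal B) (n - int k)"
proof -
  have piece: "f \<in> ideal (insert a B) \<longleftrightarrow>
      (if k \<le> n then \<exists>q\<in>homog (n - k). f - a * q \<in> ideal B else f \<in> ideal B)"
    if f: "f \<in> homog n" for f n
  proof
    assume "f \<in> ideal (insert a B)"
    then obtain q where q: "f - q * a \<in> ideal B" by (auto simp: ideal_insert)
    have "hcomp n (f - q * a) + hcomp n (q * a) = f"
      using hcomp_homog[OF f, of n] by (simp flip: mon_part_add)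
    then have "f - hcomp n (q * a) \<in> ideal B"
      using hom q by (metis add_diff_cancel_right' homogeneous_def)
    then show "if k \<le> n then \<exists>q\<in>homog (n - k). f - a * q \<in> ideal B else f \<in> ideal B"
      using hcomp_in_homog by (auto simp: hcomp_mult_homog[OF a] mult.commute[of a] split: if_splits)
  next
    assume "if k \<le> n then \<exists>q\<in>homog (n - k). f - a * q \<in> ideal B else f \<in> ideal B"
    then have "\<exists>q. f - q * a \<in> ideal B"
      by (metis diff_zero mult.commute mult_zero_left)
    then show "f \<in> ideal (insert a B)" by (simp add: ideal_insert)
  qed
  consider "n < 0" | m where "n = int m" "m < k" | m where "n = int m" "k \<le> m"
    by (metis int_nat_eq linorder_not_less nat_0_le)
  then show ?thesis
  proof cases
    case 1
    then show ?thesis by (simp add: hilb_def)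
  next
    case (2 m)
    then have "ideal (insert a B) \<inter> homog m = ideal B \<inter> homog m"
      using piece[of _ m] by auto
    then show ?thesis using 2 by (simp add: hilb_def)
  next
    case (3 m)
    let ?U = "ideal B \<inter> homog m" and ?V = "homog (m - k) :: (3, 'a) mpoly set"
    have "{u + a * v | u v. u \<in> ?U \<and> v \<in> ?V} = ideal (insert a B) \<inter> homog m"
    proof (intro equalityI subsetI)
      fix f assume "f \<in> {u + a * v | u v. u \<in> ?U \<and> v \<in> ?V}"
      then obtain u v where f: "f = u + a * v" "u \<in> ?U" "v \<in> ?V" by blast
      have "a * v \<in> homog m" using homog_mult[OF a, of v "m - k"] f 3 by simp
      then have "f \<in> homog m" using f by (simp add: homog_add)
      moreover have "f \<in> ideal (insert a B)"
        using piece[OF \<open>f \<in> homog m\<close>] 3 f by (auto intro!: bexI[of _ v])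
      ultimately show "f \<in> ideal (insert a B) \<inter> homog m" by simp
    next
      fix f assume f: "f \<in> ideal (insert a B) \<inter> homog m"
      then obtain q where q: "q \<in> ?V" "f - a * q \<in> ideal B"
        using piece[of f m] 3 by auto
      have "a * q \<in> homog m" using homog_mult[OF a, of q "m - k"] q 3 by simp
      then have "f - a * q \<in> ?U"
        using q f subspace_homog mp.subspace_diff by blast
      then show "f \<in> {u + a * v | u v. u \<in> ?U \<and> v \<in> ?V}"
        using q(1) by (intro CollectI exI[of _ "f - a * q"] exI[of _ q]) simp
    qed
    moreover have "{v \<in> ?V. a * v \<in> ?U} = ideal B \<inter> ?V"
    proof (intro equalityI subsetI)
      fix v assume v: "v \<in> ideal B \<inter> ?V"
      then have "a * v \<in> homog m" using homog_mult[OF a, of v "m - k"] 3 by simp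
      then show "v \<in> {v \<in> ?V. a * v \<in> ?U}" using v by (simp add: ideal_mult)
    qed (use reg in blast)
    ultimately have "mp.dim (ideal (insert a B) \<inter> homog m) + mp.dim (ideal B \<inter> ?V) =
        mp.dim ?U + mp.dim ?V"
      using mm.dim_sum_image(2)[OF linear_mult[of a] fin_dim_piece[of B m] fin_dim_homog[of "m - k"]] by simp
    then show ?thesis using 3 by (simp add: hilb_def nat_diff_distrib')
  qed
qed

text \<open>The dimension of the space of forms of degree \<open>n\<close> in three variables, zero for negative \<open>n\<close>.\<close>

definition trinum :: "int \<Rightarrow> int" where
  "trinum n = (if n < 0 then 0 else (n + 1) * (n + 2) div 2)"

lemma trinum_neg: "n < 0 \<Longrightarrow> trinum n = 0"
  by (simp add: trinum_def)

lemma trinum_double: "-2 \<le> n \<Longrightarrow> 2 * trinum n = (n + 1) * (n + 2)"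
proof (cases "n < 0")
  case True
  assume "-2 \<le> n"
  then have "n = -1 \<or> n = -2" using True by auto
  then show ?thesis by (auto simp: trinum_def)
next
  case False
  have "even ((n + 1) * (n + 2))" by auto
  then show ?thesis using False by (simp add: trinum_def)
qed

lemma trinum_step: "trinum n - trinum (n - 1) = max 0 (n + 1)"
proof (cases "n < 0")
  case False
  then show ?thesis
    using trinum_double[of n] trinum_double[of "n - 1"] by (simp add: algebra_simps)
qed (simp add: trinum_def)

text \<open>The source of the symmetry of the Hilbert function.\<close>

lemma trinum_reflect: "2 * trinum n + 2 * trinum (- 3 - n) = (n + 1) * (n + 2)"
proof (cases "-2 \<le> n")
  case True
  then show ?thesis
    using trinum_double[of n] by (cases "-2 \<le> - 3 - n") (auto simp: trinum_neg)
next
  case False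
  then show ?thesis
    using trinum_double[of "- 3 - n"] by (simp add: trinum_neg algebra_simps)
qed

lemma hilb_zero_ideal: "hilb (ideal {} :: (3, 'a::field) mpoly set) n = trinum n"
proof (cases "n < 0")
  case False
  have "{0} \<inter> homog (nat n) = ({0} :: (3, 'a) mpoly set)" by auto
  then have "mp.dim ({0} \<inter> homog (nat n) :: (3, 'a) mpoly set) = 0"
    using mp.dim_span_eq_card_independent[of "{}"] by (simp add: mp.dependent_def)
  then have "hilb (ideal {} :: (3, 'a) mpoly set) n = int (mp.dim (homog (nat n) :: (3, 'a) mpoly set))"
    using False by (simp add: hilb_def ideal_empty)
  moreover have "2 * int (mp.dim (homog (nat n) :: (3, 'a) mpoly set)) = (n + 1) * (n + 2)"
    using arg_cong[OF dim_homog[of "nat n", where 'a = 'a], of int] False by (simp add: algebra_simps)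
  ultimately show ?thesis using trinum_double[of n] False by simp
qed (simp add: hilb_def trinum_def)

text \<open>The Hilbert function of a complete intersection of type \<open>(d, d, e)\<close>.\<close>

definition ci_hilb :: "nat \<Rightarrow> nat \<Rightarrow> int \<Rightarrow> int" where
  "ci_hilb d e n = trinum n - 2 * trinum (n - d) - trinum (n - e) + trinum (n - 2 * int d)
    + 2 * trinum (n - d - e) - trinum (n - 2 * int d - e)"

lemma regular_sequence_3:
  assumes "regular_sequence [f1, f2, f3]"
  shows "\<And>g. f1 * g \<in> ideal {} \<Longrightarrow> g \<in> ideal {}" "\<And>g. f2 * g \<in> ideal {f1} \<Longrightarrow> g \<in> ideal {f1}"
    "\<And>g. f3 * g \<in> ideal {f1, f2} \<Longrightarrow> g \<in> ideal {f1, f2}" "ideal {f1, f2, f3} \<noteq> UNIV"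
proof -
  have *: "\<And>i g. i < 3 \<Longrightarrow> [f1, f2, f3] ! i * g \<in> ideal (set (take i [f1, f2, f3])) \<Longrightarrow>
      g \<in> ideal (set (take i [f1, f2, f3]))" and "ideal {f1, f2, f3} \<noteq> UNIV"
    using assms unfolding regular_sequence_def by (auto simp: numeral_3_eq_3)
  show "\<And>g. f1 * g \<in> ideal {} \<Longrightarrow> g \<in> ideal {}" using *[of 0] by simp
  show "\<And>g. f2 * g \<in> ideal {f1} \<Longrightarrow> g \<in> ideal {f1}" using *[of "Suc 0"] by simp
  show "\<And>g. f3 * g \<in> ideal {f1, f2} \<Longrightarrow> g \<in> ideal {f1, f2}"
    using *[of "Suc (Suc 0)"] by simp
  show "ideal {f1, f2, f3} \<noteq> UNIV" by fact
qed

lemma complete_intersection_3: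
  fixes f1 f2 f3 :: "(3, 'a::field) mpoly"
  assumes "f1 \<in> homog d" "f2 \<in> homog d" "f3 \<in> homog e" and reg: "regular_sequence [f1, f2, f3]"
  shows "homogeneous (ideal {f1, f2, f3})" and "hilb (ideal {f1, f2, f3}) n = ci_hilb d e n"
proof -
  have h1: "homogeneous (ideal {f1})"
    using homogeneous_insert[OF homogeneous_empty assms(1)] .
  have h2: "homogeneous (ideal {f2, f1})" using homogeneous_insert[OF h1 assms(2)] .
  have eq: "{f1, f2, f3} = {f3, f2, f1}" by auto
  show "homogeneous (ideal {f1, f2, f3})"
    unfolding eq using homogeneous_insert[OF h2 assms(3)] .
  note reg = regular_sequence_3[OF reg, unfolded insert_commute[of f1 f2]]
  have H1: "hilb (ideal {f1}) n = trinum n - trinum (n - d)" for n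
    using hilb_insert[OF homogeneous_empty assms(1) reg(1)] by (simp add: hilb_zero_ideal)
  have H2: "hilb (ideal {f2, f1}) n = trinum n - trinum (n - d) - (trinum (n - d) - trinum (n - d - d))" for n
    using hilb_insert[OF h1 assms(2) reg(2)] by (simp add: H1)
  have "hilb (ideal {f3, f2, f1}) n = hilb (ideal {f2, f1}) n - hilb (ideal {f2, f1}) (n - e)"
    using hilb_insert[OF h2 assms(3) reg(3)] .
  then show "hilb (ideal {f1, f2, f3}) n = ci_hilb d e n"
    unfolding eq by (simp add: H2 ci_hilb_def algebra_simps)
qed

text \<open>
  In the first half of the degrees, the \<open>n\<close>-th difference of the Hilbert function is
  \<open>n + 1 - gam d e n\<close>.  The subtractions of natural numbers are meant to truncate to zero.
\<close>

definition gam :: "nat \<Rightarrow> nat \<Rightarrow> nat \<Rightarrow> nat" where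
  "gam d e n = 2 * (n + 1 - d) + (n + 1 - e)"

context
  fixes d e :: nat
  assumes de: "d < e" "e + 1 < 2 * d"
begin

lemma gam_le: "2 * n + 3 \<le> 2 * d + e \<Longrightarrow> gam d e n \<le> n + 1"
  using de unfolding gam_def by linarith

lemma gam_mono: "m \<le> n \<Longrightarrow> gam d e m \<le> gam d e n"
  unfolding gam_def by linarith

lemma ci_hilb_neg: "n < 0 \<Longrightarrow> ci_hilb d e n = 0"
  by (simp add: ci_hilb_def trinum_neg)

lemma ci_hilb_step:
  assumes "2 * n + 3 \<le> 2 * d + e"
  shows "ci_hilb d e n - ci_hilb d e (int n - 1) = int (n + 1) - int (gam d e n)"
proof -
  have "ci_hilb d e k = trinum k - 2 * trinum (k - d) - trinum (k - e)" if "k \<le> int n" for k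
  proof -
    have "k - 2 * int d < 0" "k - int d - int e < 0" "k - 2 * int d - int e < 0"
      using that assms de by linarith+
    then show ?thesis by (simp add: ci_hilb_def trinum_neg)
  qed
  then have low: "ci_hilb d e n = trinum n - 2 * trinum (int n - d) - trinum (int n - e)"
    "ci_hilb d e (int n - 1) = trinum (int n - 1) - 2 * trinum (int n - 1 - d) - trinum (int n - 1 - e)"
    by simp_all
  have comm: "int n - int d - 1 = int n - 1 - int d" "int n - int e - 1 = int n - 1 - int e"
    by simp_all
  have "int (gam d e n) = 2 * max 0 (int n + 1 - int d) + max 0 (int n + 1 - int e)"
    by (cases "d \<le> n + 1"; cases "e \<le> n + 1") (simp_all add: gam_def of_nat_diff)
  moreover have "max 0 (int n + 1) = int n + 1" by simp
  ultimately show ?thesis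
    unfolding low
    using trinum_step[of n] trinum_step[of "int n - d"] trinum_step[of "int n - e"]
    unfolding comm diff_add_eq[symmetric] of_nat_add of_nat_1 by algebra
qed

text \<open>
  The reflection exchanges each of the eight shifts with the complementary one, and the quadratic
  terms that remain add up to a third difference, which vanishes.
\<close>

lemma ci_hilb_sym: "ci_hilb d e (2 * int d + int e - 3 - n) = ci_hilb d e n"
proof -
  have reflect: "2 * trinum (a - 3 - n) = (n - a + 1) * (n - a + 2) - 2 * trinum (n - a)" for a
  proof -
    have eq: "- 3 - (n - a) = a - 3 - n" by simp
    show ?thesis using trinum_reflect[of "n - a"] unfolding eq by linarith
  qed
  define D where "D = int d"
  define E where "E = int e"
  have shift: "2 * D + E - 3 - n - D = D + E - 3 - n" "2 * D + E - 3 - n - E = 2 * D - 3 - n"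
    "2 * D + E - 3 - n - 2 * D = E - 3 - n" "D + E - 3 - n - E = D - 3 - n"
    "E - 3 - n - E = 0 - 3 - n" "n - 2 * D - E = n - (2 * D + E)" "n - D - E = n - (D + E)"
    by simp_all
  have "2 * ci_hilb d e (2 * D + E - 3 - n) = 2 * ci_hilb d e n"
    using reflect[of "2 * D + E"] reflect[of "D + E"] reflect[of "2 * D"] reflect[of E]
      reflect[of D] reflect[of 0, unfolded diff_0_right]
    unfolding ci_hilb_def D_def[symmetric] E_def[symmetric] shift by algebra
  then show ?thesis by (simp add: D_def E_def)
qed

lemma ci_hilb_sum:
  assumes "2 * n + 3 \<le> 2 * d + e"
  shows "ci_hilb d e n = (\<Sum>t\<le>n. int (t + 1) - int (gam d e t))"
  using assms
proof (induction n)
  case 0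
  then show ?case using ci_hilb_step[of 0] ci_hilb_neg[of "-1"] by simp
next
  case (Suc n)
  then show ?case using ci_hilb_step[of "Suc n"] by simp
qed

lemma ci_hilb_mono:
  assumes "m \<le> n" and "2 * n + 3 \<le> 2 * d + e"
  shows "ci_hilb d e m \<le> ci_hilb d e n"
proof -
  have "(\<Sum>t\<le>m. int (t + 1) - int (gam d e t)) \<le> (\<Sum>t\<le>n. int (t + 1) - int (gam d e t))"
  proof (rule sum_mono2)
    fix t assume "t \<in> {..n} - {..m}"
    then have "gam d e t \<le> t + 1" using assms by (intro gam_le) auto
    then show "0 \<le> int (t + 1) - int (gam d e t)" by simp
  qed (use assms in auto)
  then show ?thesis using ci_hilb_sum assms by simp
qed

text \<open>The condition \<open>m + n + 3 \<le> 2 d + e\<close> says that \<open>m\<close> is at least as far from the middle as \<open>n\<close>.\<close>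

lemma ci_hilb_le:
  assumes "m \<le> n" and "m + n + 3 \<le> 2 * d + e"
  shows "ci_hilb d e m \<le> ci_hilb d e n"
proof (cases "2 * n + 3 \<le> 2 * d + e")
  case True
  then show ?thesis using assms ci_hilb_mono by blast
next
  case False
  define n' where "n' = 2 * d + e - 3 - n"
  have n': "int n' = 2 * int d + int e - 3 - int n" using assms unfolding n'_def by linarith
  have "ci_hilb d e m \<le> ci_hilb d e n'"
    by (rule ci_hilb_mono) (use assms False in \<open>auto simp: n'_def\<close>)
  then show ?thesis unfolding n' ci_hilb_sym .
qed

lemma ci_hilb_large:
  assumes "2 * d + e < n + 3"
  shows "ci_hilb d e n = 0"
proof -
  have "2 * int d + int e - 3 - int n < 0" using assms by linarith
  then show ?thesis using ci_hilb_sym[of n] ci_hilb_neg by simp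
qed

end

section \<open>Changes of coordinates and homogeneous ideals\<close>

lemma lin_change_image_ideal:
  assumes "invertible (A :: 'a::field ^ 3 ^ 3)"
  shows "lin_change A ` ideal B = ideal (lin_change A ` B)"
proof -
  obtain C where C: "\<And>f. lin_change C (lin_change A f) = f" "\<And>f. lin_change A (lin_change C f) = f"
    using lin_change_invertible[OF assms] by metis
  have sub: "lin_change A ` ideal B \<subseteq> ideal (lin_change A ` B)" for A :: "'a ^ 3 ^ 3" and B
  proof -
    have "ideal B \<subseteq> {f. lin_change A f \<in> ideal (lin_change A ` B)}"
      unfolding ideal_def[of B]
      by (rule idl.span_minimal)
         (auto intro!: idl.subspaceI simp: ideal_base ideal_zero ideal_add ideal_mult
           lin_change_add lin_change_mult)
    then show ?thesis by auto
  qed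
  have "lin_change C ` ideal (lin_change A ` B) \<subseteq> ideal B"
    using sub[of C "lin_change A ` B"] C(1) by (simp add: image_image)
  then have "ideal (lin_change A ` B) \<subseteq> lin_change A ` ideal B"
    using C(2) by (metis image_subset_iff image_eqI subsetI)
  then show ?thesis using sub by blast
qed

lemma hcomp_lin_change: "hcomp n (lin_change A f) = lin_change A (hcomp n f)"
proof -
  let ?J = "insert n (mon_degree ` Poly_Mapping.keys f)"
  have eq: "(\<Sum>j\<in>?J. hcomp j f) = f"
  proof (cases "n \<in> mon_degree ` Poly_Mapping.keys f")
    case True
    then show ?thesis by (simp add: insert_absorb sum_hcomp[symmetric])
  next
    case False
    then have "Poly_Mapping.keys (hcomp n f) = {}" by (auto simp: keys_mon_part image_iff)
    then show ?thesis using False by (simp add: sum_hcomp[symmetric])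
  qed
  have "hcomp n (lin_change A f) = hcomp n (lin_change A (\<Sum>j\<in>?J. hcomp j f))"
    by (simp only: eq)
  also have "\<dots> = (\<Sum>j\<in>?J. hcomp n (lin_change A (hcomp j f)))"
    by (simp only: lin_change_sum mon_part_sum)
  also have "\<dots> = (\<Sum>j\<in>?J. if j = n then lin_change A (hcomp j f) else 0)"
    by (intro sum.cong refl hcomp_homog lin_change_homog hcomp_in_homog)
  also have "\<dots> = lin_change A (hcomp n f)"
    by (subst sum.delta) simp_all
  finally show ?thesis .
qed

lemma homogeneous_lin_change: "homogeneous I \<Longrightarrow> homogeneous (lin_change A ` I)"
  by (auto simp: homogeneous_def hcomp_lin_change)

lemma lin_change_piece:
  assumes "invertible (A :: 'a::field ^ 3 ^ 3)"
  shows "lin_change A ` I \<inter> homog n = lin_change A ` (I \<inter> homog n)"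
proof -
  obtain C where C: "\<And>f. lin_change C (lin_change A f) = f"
    using lin_change_invertible[OF assms] by metis
  have "f \<in> homog n" if "lin_change A f \<in> homog n" for f
    using lin_change_homog[OF that, of C] C by simp
  then show ?thesis by (blast intro: lin_change_homog)
qed

lemma hilb_lin_change:
  assumes "invertible (A :: 'a::field ^ 3 ^ 3)"
  shows "hilb (lin_change A ` ideal B) n = hilb (ideal B) n"
proof -
  obtain C where C: "\<And>f. lin_change C (lin_change A f) = f"
    using lin_change_invertible[OF assms] by metis
  have "mp.dim (lin_change A ` (ideal B \<inter> homog m)) = mp.dim (ideal B \<inter> homog m)" for m
    by (rule mm.dim_image_inj[OF linear_lin_change fin_dim_piece]) (metis C lin_change_zero)
  then show ?thesis by (simp add: hilb_def lin_change_piece[OF assms])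
qed

lemma homog_1_eq:
  fixes l :: "(3, 'a::comm_ring_1) mpoly"
  assumes "l \<in> homog 1"
  shows "l = (\<Sum>i\<in>UNIV. Poly_Mapping.single 0 (Poly_Mapping.lookup l (Poly_Mapping.single i 1)) * X i)"
proof (rule poly_mapping_eqI)
  fix m :: "3 mon"
  show "Poly_Mapping.lookup l m = Poly_Mapping.lookup
      (\<Sum>i\<in>UNIV. Poly_Mapping.single 0 (Poly_Mapping.lookup l (Poly_Mapping.single i 1)) * X i) m"
  proof (cases "mon_degree m = 1")
    case False
    then have "m \<notin> Poly_Mapping.keys l" "\<And>i. Poly_Mapping.single i 1 \<noteq> m"
      using assms by (auto simp: homog_def)
    then show ?thesis
      by (simp add: lookup_sum mult_single lookup_single when_def not_in_keys_iff_lookup_eq_zero)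
  next
    case True
    obtain a b c where m: "m = mon3 a b c" using mon3_lookup[of m] by metis
    have "a + b + c = 1" using True by (simp add: m)
    then have "a = 1 \<and> b = 0 \<and> c = 0 \<or> a = 0 \<and> b = 1 \<and> c = 0 \<or> a = 0 \<and> b = 0 \<and> c = 1"
      by arith
    then have "\<exists>j. m = Poly_Mapping.single j 1"
      unfolding m mon3_def by auto
    then obtain j where j: "m = Poly_Mapping.single j 1" by blast
    have "Poly_Mapping.single i (1::nat) = Poly_Mapping.single j 1 \<longleftrightarrow> i = j" for i
      by (metis keys_single one_neq_zero singleton_inject)
    then show ?thesis
      unfolding j by (simp add: lookup_sum mult_single lookup_single when_def)
  qed
qed

lemma lin_change_linear_form:
  "lin_change A (\<Sum>j\<in>UNIV. Poly_Mapping.single 0 (v $ j) * X j) =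
    (\<Sum>i\<in>UNIV. Poly_Mapping.single 0 ((A *v v) $ i) * X i)"
proof -
  have "lin_change A (\<Sum>j\<in>UNIV. Poly_Mapping.single 0 (v $ j) * X j) =
      (\<Sum>j\<in>UNIV. \<Sum>i\<in>UNIV. Poly_Mapping.single 0 (v $ j) * (Poly_Mapping.single 0 (A $ i $ j) * X i))"
    by (simp only: lin_change_X lin_change_sum lin_change_mult lin_change_const sum_distrib_left)
  also have "\<dots> = (\<Sum>i\<in>UNIV. \<Sum>j\<in>UNIV. Poly_Mapping.single 0 (A $ i $ j * v $ j) * X i)"
    by (subst sum.swap) (simp add: mult_single mult.commute)
  also have "\<dots> = (\<Sum>i\<in>UNIV. Poly_Mapping.single 0 ((A *v v) $ i) * X i)"
    by (simp only: sum_distrib_right[symmetric] const_sum matrix_vector_mult_def vec_lambda_beta)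
  finally show ?thesis .
qed

lemma obtain_invertible_to_axis:
  fixes v :: "'a::field ^ 3"
  assumes "v \<noteq> 0"
  obtains G :: "'a ^ 3 ^ 3" where "invertible G" "G *v v = axis 3 1"
proof -
  obtain k where k: "v $ k \<noteq> 0" using assms by (auto simp: vec_eq_iff)
  define M :: "'a ^ 3 ^ 3" where
    "M = (\<chi> i j. if j = 3 then v $ i else if j = k then axis 3 1 $ i else axis j 1 $ i)"
  have "det M \<noteq> 0"
    using exhaust_3[of k] k
    by (auto simp: det_3 M_def axis_def)
  then have "invertible M" by (simp add: invertible_det_nz)
  then obtain G where G: "G ** M = mat 1" "M ** G = mat 1" unfolding invertible_def by blast
  have "M *v axis 3 1 = v"
    by (simp add: vec_eq_iff matrix_vector_mult_def M_def axis_def if_distrib cong: if_cong)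
  then have "G *v v = axis 3 1"
    using G(1) by (metis matrix_vector_mul_assoc matrix_vector_mul_lid)
  moreover have "invertible G" using G unfolding invertible_def by blast
  ultimately show ?thesis using that by blast
qed

lemma linear_form_to_X3:
  fixes l :: "(3, 'a::field) mpoly"
  assumes "l \<in> homog 1" and "l \<noteq> 0"
  obtains G :: "'a ^ 3 ^ 3" where "invertible G" "lin_change G l = X 3"
proof -
  define v :: "'a ^ 3" where "v = (\<chi> i. Poly_Mapping.lookup l (Poly_Mapping.single i 1))"
  have l: "l = (\<Sum>i\<in>UNIV. Poly_Mapping.single 0 (v $ i) * X i)"
    using homog_1_eq[OF assms(1)] by (simp only: v_def vec_lambda_beta)
  have "v \<noteq> 0"
  proof
    assume "v = 0"
    then show False using l assms(2) by simp
  qed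
  then obtain G :: "'a ^ 3 ^ 3" where G: "invertible G" "G *v v = axis 3 1"
    using obtain_invertible_to_axis by blast
  have "lin_change G l = (\<Sum>i\<in>UNIV. Poly_Mapping.single 0 (axis 3 1 $ i) * X i)"
    by (subst l) (simp only: lin_change_linear_form G(2))
  also have "\<dots> = (\<Sum>i\<in>UNIV. if i = 3 then X i else 0)"
    by (intro sum.cong) (auto simp: axis_def)
  finally show ?thesis using that G(1) by simp
qed

section \<open>The Lefschetz property\<close>

lemma ideal_cong_class_eq:
  "ideal_cong (ideal B) `` {f} = ideal_cong (ideal B) `` {g} \<longleftrightarrow> f - g \<in> ideal B"
proof
  assume "ideal_cong (ideal B) `` {f} = ideal_cong (ideal B) `` {g}"
  moreover have "g \<in> ideal_cong (ideal B) `` {g}" by (simp add: ideal_cong_def ideal_zero)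
  ultimately have "g \<in> ideal_cong (ideal B) `` {f}" by simp
  then show "f - g \<in> ideal B" by (simp add: ideal_cong_def)
next
  assume fg: "f - g \<in> ideal B"
  have "f - h \<in> ideal B \<longleftrightarrow> g - h \<in> ideal B" for h
  proof
    assume "f - h \<in> ideal B"
    from ideal_diff[OF this fg] show "g - h \<in> ideal B" by simp
  next
    assume "g - h \<in> ideal B"
    from ideal_add[OF fg this] show "f - h \<in> ideal B" by simp
  qed
  then show "ideal_cong (ideal B) `` {f} = ideal_cong (ideal B) `` {g}"
    unfolding ideal_cong_def by blast
qed

lemma strong_LefschetzE:
  assumes "strong_Lefschetz (ideal B)"
  obtains l where "l \<in> homog 1"
    "\<forall>b\<ge>1. \<forall>t. (\<forall>f\<in>homog t. l ^ b * f \<in> ideal B \<longrightarrow> f \<in> ideal B) \<or>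
      (\<forall>g\<in>homog (t + b). \<exists>f\<in>homog t. g - l ^ b * f \<in> ideal B)"
proof -
  let ?c = "\<lambda>f. ideal_cong (ideal B) `` {f}"
  obtain l where l: "l \<in> homog 1" and max_rank: "\<forall>b\<ge>1. \<forall>t.
      inj_on (quot_mult (ideal B) (l ^ b)) (quot_piece (ideal B) t) \<or>
      quot_mult (ideal B) (l ^ b) ` quot_piece (ideal B) t = quot_piece (ideal B) (t + b)"
    using assms[unfolded strong_Lefschetz_def] by (rule bexE)
  have piece: "quot_piece (ideal B) t = ?c ` homog t" for t
    by (auto simp: quot_piece_def quotient_def)
  have "(\<forall>f\<in>homog t. l ^ b * f \<in> ideal B \<longrightarrow> f \<in> ideal B) \<or>
      (\<forall>g\<in>homog (t + b). \<exists>f\<in>homog t. g - l ^ b * f \<in> ideal B)" if b: "1 \<le> b" for b t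
    using max_rank[rule_format, OF b, of t]
  proof
    assume inj: "inj_on (quot_mult (ideal B) (l ^ b)) (quot_piece (ideal B) t)"
    have "f \<in> ideal B" if f: "f \<in> homog t" "l ^ b * f \<in> ideal B" for f
    proof -
      have "quot_mult (ideal B) (l ^ b) (?c f) = quot_mult (ideal B) (l ^ b) (?c 0)"
        unfolding quot_mult_class using f(2) by (simp add: ideal_cong_class_eq)
      then have "?c f = ?c 0"
        using inj f(1) unfolding piece by (meson homog_zero image_eqI inj_onD)
      then show ?thesis by (simp add: ideal_cong_class_eq)
    qed
    then show ?thesis by blast
  next
    assume surj: "quot_mult (ideal B) (l ^ b) ` quot_piece (ideal B) t = quot_piece (ideal B) (t + b)"
    have "\<exists>f\<in>homog t. g - l ^ b * f \<in> ideal B" if "g \<in> homog (t + b)" for g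
    proof -
      have "?c g \<in> quot_mult (ideal B) (l ^ b) ` quot_piece (ideal B) t"
        unfolding surj unfolding piece using that by blast
      then obtain f where "f \<in> homog t" "?c g = quot_mult (ideal B) (l ^ b) (?c f)"
        unfolding piece by blast
      then show ?thesis unfolding quot_mult_class by (auto simp: ideal_cong_class_eq)
    qed
    then show ?thesis by blast
  qed
  with l show ?thesis using that by blast
qed

text \<open>
  Where the Hilbert function does not decrease, maximal rank means injectivity.
\<close>

lemma lefschetz_injective:
  fixes l :: "(3, 'a::field) mpoly"
  assumes l: "l \<in> homog 1"
    and max_rank: "(\<forall>f\<in>homog t. l ^ b * f \<in> ideal B \<longrightarrow> f \<in> ideal B) \<or>
      (\<forall>g\<in>homog (t + b). \<exists>f\<in>homog t. g - l ^ b * f \<in> ideal B)"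
    and le: "hilb (ideal B) (int t) \<le> hilb (ideal B) (int (t + b))"
    and f: "f \<in> homog t" "l ^ b * f \<in> ideal B"
  shows "f \<in> ideal B"
  using max_rank
proof
  assume surj: "\<forall>g\<in>homog (t + b). \<exists>f\<in>homog t. g - l ^ b * f \<in> ideal B"
  \<comment> \<open>\<open>?K\<close> is the kernel of the multiplication, lifted to \<open>S\<^sub>t\<close>; a dimension count gives \<open>?K = I\<^sub>t\<close>.\<close>
  let ?U = "ideal B \<inter> homog (t + b)" and ?V = "homog t :: (3, 'a) mpoly set"
  let ?K = "{v \<in> ?V. l ^ b * v \<in> ?U}"
  have mult: "l ^ b * v \<in> homog (t + b)" if "v \<in> ?V" for v
    using homog_mult[OF homog_power[OF l, of b] that] by (simp add: add.commute)
  have sum: "{u + l ^ b * v | u v. u \<in> ?U \<and> v \<in> ?V} = homog (t + b)"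
  proof (intro equalityI subsetI)
    fix g :: "(3, 'a) mpoly" assume g: "g \<in> homog (t + b)"
    then obtain v where v: "v \<in> ?V" "g - l ^ b * v \<in> ideal B" using surj by blast
    then have "g - l ^ b * v \<in> ?U"
      using mp.subspace_diff[OF subspace_homog g mult[OF v(1)]] by simp
    then show "g \<in> {u + l ^ b * v | u v. u \<in> ?U \<and> v \<in> ?V}"
      using v(1) by (intro CollectI exI[of _ "g - l ^ b * v"] exI[of _ v]) simp
  next
    fix g assume "g \<in> {u + l ^ b * v | u v. u \<in> ?U \<and> v \<in> ?V}"
    then show "g \<in> homog (t + b)" using mult by (auto intro: homog_add)
  qed
  have "mp.dim (homog (t + b) :: (3, 'a) mpoly set) + mp.dim ?K = mp.dim ?U + mp.dim ?V"
    using mm.dim_sum_image(2)[OF linear_mult[of "l ^ b"] fin_dim_piece[of B "t + b"] fin_dim_homog[of t]]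
    unfolding sum .
  then have dim: "mp.dim ?K \<le> mp.dim (ideal B \<inter> ?V)"
    using le unfolding hilb_nat by linarith
  have sub: "ideal B \<inter> ?V \<subseteq> ?K" using mult by (auto simp: ideal_mult)
  have "mp.subspace ?K"
    using mult
    by (intro mp.subspaceI)
       (auto simp: ideal_zero ideal_add distrib_left homog_add scal_mult_right
         mp.subspace_scale[OF subspace_ideal] mp.subspace_scale[OF subspace_homog])
  then have "mp.fin_dim ?K" by (rule mp.fin_dim_subset[OF fin_dim_homog]) auto
  then have "ideal B \<inter> ?V = ?K"
    using mp.fin_dim_dim_equal[OF _ subspace_piece sub dim] by blast
  then show ?thesis using f mult by blast
qed (use f in blast)

section \<open>Generic coordinates\<close>

text \<open>
  The standard monomials of the generic initial ideal of a complete intersection of type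
  \<open>(d, d, e)\<close> with the strong Lefschetz property.
\<close>

definition std_mon :: "nat \<Rightarrow> nat \<Rightarrow> 3 mon \<Rightarrow> bool" where
  "std_mon d e m \<longleftrightarrow>
    2 * (Poly_Mapping.lookup m 1 + Poly_Mapping.lookup m 2) + Poly_Mapping.lookup m 3 + 3 \<le> 2 * d + e \<and>
    gam d e (Poly_Mapping.lookup m 1 + Poly_Mapping.lookup m 2) \<le> Poly_Mapping.lookup m 2"

text \<open>Restriction to the line \<open>x\<^sub>3 = 0\<close>, \<open>x\<^sub>1 = 1\<close>, parametrized by \<open>x\<^sub>2 = T - z\<close>.\<close>

definition dehom :: "'a::field \<Rightarrow> (3, 'a) mpoly \<Rightarrow> 'a poly" where
  "dehom z = eval_mpoly (\<lambda>c. [:c:]) (\<lambda>i. if i = 1 then 1 else if i = 2 then [:-z, 1:] else 0)"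

global_interpretation pconst: coeff_hom "\<lambda>c :: 'a::field. [:c:]"
  by unfold_locales (simp_all add: one_pCons)

lemma dehom_add: "dehom z (p + q) = dehom z p + dehom z q"
  and dehom_mult: "dehom z (p * q) = dehom z p * dehom z q"
  and dehom_one: "dehom z 1 = 1"
  and dehom_const: "dehom z (Poly_Mapping.single 0 a) = [:a:]"
  by (simp_all add: dehom_def pconst.eval_add pconst.eval_mult pconst.eval_one pconst.eval_single)

lemma dehom_X: "dehom z (X 1) = 1" "dehom z (X 2) = [:-z, 1:]" "dehom z (X 3) = 0"
  by (simp_all add: dehom_def pconst.eval_X three_distinct)

lemma dehom_zero: "dehom z 0 = 0"
  by (simp add: dehom_def pconst.eval_zero)

lemma dehom_single:
  "dehom z (Poly_Mapping.single m a) =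
    [:a:] * ([:-z, 1:] ^ Poly_Mapping.lookup m 2 * 0 ^ Poly_Mapping.lookup m 3)"
  unfolding dehom_def pconst.eval_single UNIV_3 by (simp add: three_distinct)

lemma dehom_sum: "dehom z (\<Sum>i\<in>S. f i) = (\<Sum>i\<in>S. dehom z (f i))"
  by (induction S rule: infinite_finite_induct) (simp_all add: dehom_add dehom_zero)

lemma dehom_scal: "dehom z (scal c p) = smult c (dehom z p)"
  by (simp add: scal_def dehom_mult dehom_const)

lemma linear_dehom: "Vector_Spaces.linear scal smult (dehom z)"
  by unfold_locales (simp_all add: dehom_add dehom_scal)

text \<open>The matrix of \<open>x\<^sub>2 \<mapsto> x\<^sub>2 + z x\<^sub>1\<close>, with \<open>x\<^sub>1\<close> and \<open>x\<^sub>3\<close> fixed.\<close>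

definition shear :: "'a::field \<Rightarrow> 'a ^ 3 ^ 3" where
  "shear z = (\<chi> i j. if i = j then 1 else if i = 1 \<and> j = 2 then z else 0)"

lemma shear_mult: "shear z ** shear w = shear (z + w)"
  by (simp add: shear_def vec_eq_iff forall_3 matrix_matrix_mult_def sum_3 three_distinct)

lemma shear_zero: "shear 0 = mat 1"
  by (simp add: shear_def mat_def vec_eq_iff)

lemma invertible_shear: "invertible (shear z)"
  unfolding invertible_def by (rule exI[of _ "shear (- z)"]) (simp add: shear_mult shear_zero)

lemma lin_change_shear_cancel: "lin_change (shear (- z)) (lin_change (shear z) f) = f"
  by (simp add: lin_change_comp shear_mult shear_zero lin_change_id)

lemma lin_change_shear_X:
  "lin_change (shear z) (X 1) = X 1"
  "lin_change (shear z) (X 2) = X 2 + Poly_Mapping.single 0 z * X 1"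
  "lin_change (shear z) (X 3) = X 3"
  by (simp_all only: lin_change_X sum_3 shear_def vec_lambda_beta)
     (simp_all add: three_distinct)

lemma dehom_shear: "dehom 0 (lin_change (shear (- z)) p) = dehom z p"
proof -
  have "dehom 0 (lin_change (shear (- z)) p) = eval_mpoly (\<lambda>a. dehom 0 (lin_change (shear (- z)) (Poly_Mapping.single 0 a)))
      (\<lambda>i. dehom 0 (lin_change (shear (- z)) (X i))) p"
    by (rule mpoly_hom_unique)
       (simp_all only: lin_change_add lin_change_mult lin_change_one dehom_add dehom_mult dehom_one)
  also have "(\<lambda>a. dehom 0 (lin_change (shear (- z)) (Poly_Mapping.single 0 a))) = (\<lambda>c. [:c:])"
    by (simp add: dehom_const)
  also have "(\<lambda>i. dehom 0 (lin_change (shear (- z)) (X i))) =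
      (\<lambda>i. if i = 1 then 1 else if i = 2 then [:-z, 1:] else 0)"
  proof
    fix i :: 3
    show "dehom 0 (lin_change (shear (- z)) (X i)) = (if i = 1 then 1 else if i = 2 then [:-z, 1:] else 0)"
      using exhaust_3[of i]
    proof (elim disjE)
      assume "i = 2"
      then show ?thesis
        by (simp add: lin_change_shear_X dehom_X dehom_add dehom_mult dehom_const three_distinct)
    qed (simp_all add: lin_change_shear_X dehom_X three_distinct)
  qed
  finally show ?thesis by (simp add: dehom_def)
qed

text \<open>
  Restricted to \<open>x\<^sub>3 = 0\<close>, the forms of degree \<open>t\<close> in the ideal have dimension at most the
  difference of the dimensions of the ideal in degrees \<open>t\<close> and \<open>t - 1\<close>.
\<close>

lemma dim_dehom_le:
  fixes B :: "(3, 'a::field) mpoly set"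
  assumes de: "d < e" "e + 1 < 2 * d" and H: "\<And>n. hilb (ideal B) n = ci_hilb d e n"
    and t: "2 * t + 3 \<le> 2 * d + e"
  shows "upoly.fin_dim (dehom 0 ` (ideal B \<inter> homog t))"
    and "upoly.dim (dehom 0 ` (ideal B \<inter> homog t)) \<le> gam d e t"
proof -
  let ?V = "ideal B \<inter> homog t"
  let ?K = "{v \<in> ?V. dehom 0 v = 0}"
  note rank = mu.dim_image[OF linear_dehom[of 0] fin_dim_piece[of B t]]
  show "upoly.fin_dim (dehom 0 ` ?V)" by (rule rank(1))
  have Ht: "int (mp.dim (homog t :: (3, 'a) mpoly set)) - int (mp.dim ?V) = ci_hilb d e (int t)"
    using H[of "int t"] by (simp add: hilb_nat)
  note step = ci_hilb_step[OF de t]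
  have St: "2 * int (mp.dim (homog n :: (3, 'a) mpoly set)) = (int n + 1) * (int n + 2)" for n
    using arg_cong[OF dim_homog[of n, where 'a = 'a], of int] by (simp add: algebra_simps)
  show "upoly.dim (dehom 0 ` ?V) \<le> gam d e t"
  proof (cases t)
    case 0
    then show ?thesis
      using rank(2) Ht step St[of t] ci_hilb_neg[OF de, of "-1"] by simp
  next
    case (Suc s)
    let ?W = "ideal B \<inter> homog s"
    have inj: "v = 0" if "X 3 * v = 0" for v :: "(3, 'a) mpoly"
    proof (rule poly_mapping_eqI)
      fix m
      have "X 3 * v = (\<Sum>n\<in>Poly_Mapping.keys v. Poly_Mapping.single (Poly_Mapping.single 3 1 + n) (Poly_Mapping.lookup v n))"
        by (subst (1) poly_mapping_sum_single[of v]) (simp add: sum_distrib_left mult_single)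
      then have "Poly_Mapping.lookup (X 3 * v) (Poly_Mapping.single 3 1 + m) = Poly_Mapping.lookup v m"
        by (simp add: lookup_sum lookup_single when_def not_in_keys_iff_lookup_eq_zero)
      then show "Poly_Mapping.lookup v m = Poly_Mapping.lookup 0 m" using that by simp
    qed
    \<comment> \<open>The kernel contains \<open>x\<^sub>3 I\<^bsub>t - 1\<^esub>\<close>.\<close>
    have "mp.dim ((*) (X 3) ` ?W) = mp.dim ?W"
      by (rule mm.dim_image_inj[OF linear_mult fin_dim_piece inj])
    moreover have "mp.dim ((*) (X 3) ` ?W) \<le> mp.dim ?K"
    proof (rule mp.fin_dim_dim_mono)
      have "?K \<subseteq> ?V" by auto
      moreover have "mp.subspace ?K"
        using mp.fin_dim_subspace[OF fin_dim_piece[of B t]]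
        by (auto intro!: mp.subspaceI simp: dehom_zero dehom_add dehom_scal mp.subspace_0 mp.subspace_add
            mp.subspace_scale ideal_zero ideal_add homog_add mp.subspace_scale[OF subspace_ideal]
            mp.subspace_scale[OF subspace_homog])
      ultimately show "mp.fin_dim ?K"
        using mp.fin_dim_subset[OF fin_dim_piece[of B t]] by blast
      show "mp.subspace ((*) (X 3) ` ?W)"
        using mm.dim_image(1)[OF linear_mult[of "X 3"] fin_dim_piece[of B s]]
        by (rule mp.fin_dim_subspace)
      show "(*) (X 3) ` ?W \<subseteq> ?K"
        using homog_mult[OF homog_single[OF mon_degree_single], of _ s 3 1 1]
        by (auto simp: Suc ideal_mult dehom_mult dehom_X plus_1_eq_Suc)
    qed
    moreover have "int (mp.dim (homog s :: (3, 'a) mpoly set)) - int (mp.dim ?W) = ci_hilb d e (int t - 1)"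
      using H[of "int s"] Suc by (simp add: hilb_nat)
    moreover have "int (mp.dim (homog t :: (3, 'a) mpoly set)) = int (mp.dim (homog s :: (3, 'a) mpoly set)) + int t + 1"
      using St[of t] St[of s] Suc by (simp add: algebra_simps)
    ultimately show ?thesis using rank(2) Ht step by linarith
  qed
qed

text \<open>
  One \<open>z\<close> avoids the finitely many exceptions in all of the finitely many relevant degrees.
\<close>

lemma generic_transversality:
  fixes B :: "(3, 'a::field_char_0) mpoly set"
  assumes de: "d < e" "e + 1 < 2 * d" and H: "\<And>n. hilb (ideal B) n = ci_hilb d e n"
  shows "\<exists>z. \<forall>t f. 2 * t + 3 \<le> 2 * d + e \<longrightarrow> f \<in> ideal B \<longrightarrow> f \<in> homog t \<longrightarrow>
    [:-z, 1:] ^ gam d e t dvd dehom 0 f \<longrightarrow> dehom 0 f = 0"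
proof -
  define bad where "bad t = {z. \<exists>g\<in>dehom 0 ` (ideal B \<inter> homog t). g \<noteq> 0 \<and> [:-z, 1:] ^ gam d e t dvd g}" for t
  have "finite (bad t)" if t: "2 * t + 3 \<le> 2 * d + e" for t
  proof -
    obtain C where C: "finite C" "upoly.span C = dehom 0 ` (ideal B \<inter> homog t)"
      "card C = upoly.dim (dehom 0 ` (ideal B \<inter> homog t))"
      using upoly.fin_dim_basis[OF dim_dehom_le(1)[OF de H t]] by metis
    show ?thesis
      using finite_high_order_vanishing[OF C(1), of "gam d e t"] dim_dehom_le(2)[OF de H t]
      unfolding C(2,3) bad_def .
  qed
  moreover have "finite {t. 2 * t + 3 \<le> 2 * d + e}"
    by (rule finite_subset[of _ "{..2 * d + e}"]) auto
  ultimately have "finite (\<Union>t\<in>{t. 2 * t + 3 \<le> 2 * d + e}. bad t)" by blast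
  then obtain z where "z \<notin> (\<Union>t\<in>{t. 2 * t + 3 \<le> 2 * d + e}. bad t)"
    using ex_new_if_finite infinite_UNIV_char_0 by blast
  then show ?thesis unfolding bad_def by (intro exI[of _ z]) blast
qed

text \<open>
  If \<open>c\<close> is the least exponent of \<open>x\<^sub>3\<close> in a combination \<open>p\<close> of standard monomials, then
  \<open>p = x\<^sub>3\<^sup>c p'\<close>, and dividing by \<open>x\<^sub>3\<^sup>c\<close> preserves membership in the ideal.  Restricted to
  \<open>x\<^sub>3 = 0\<close>, the quotient \<open>p'\<close> consists of the monomials with exponents \<open>\<ge> gam d e t\<close> of \<open>x\<^sub>2\<close>.
\<close>

lemma standard_independent_shear:
  fixes B :: "(3, 'a::field_char_0) mpoly set"
  assumes inj: "\<And>t b f. f \<in> homog t \<Longrightarrow> 2 * t + b + 3 \<le> 2 * d + e \<Longrightarrow> X 3 ^ b * f \<in> ideal B \<Longrightarrow> f \<in> ideal B"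
    and z: "\<And>t f. 2 * t + 3 \<le> 2 * d + e \<Longrightarrow> f \<in> ideal B \<Longrightarrow> f \<in> homog t \<Longrightarrow>
      [:-z, 1:] ^ gam d e t dvd dehom 0 f \<Longrightarrow> dehom 0 f = 0"
    and p: "p \<in> lin_change (shear z) ` ideal B" "p \<in> homog n" "\<And>m. m \<in> Poly_Mapping.keys p \<Longrightarrow> std_mon d e m"
  shows "p = 0"
proof (rule ccontr)
  assume "p \<noteq> 0"
  then have ne: "(\<lambda>m. Poly_Mapping.lookup m 3) ` Poly_Mapping.keys p \<noteq> {}" by simp
  define c where "c = Min ((\<lambda>m. Poly_Mapping.lookup m 3) ` Poly_Mapping.keys p)"
  have "c \<in> (\<lambda>m. Poly_Mapping.lookup m 3) ` Poly_Mapping.keys p"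
    unfolding c_def using ne by (intro Min_in) simp_all
  then obtain m0 where m0: "m0 \<in> Poly_Mapping.keys p" "Poly_Mapping.lookup m0 3 = c" by blast
  have c_le: "c \<le> Poly_Mapping.lookup m 3" if "m \<in> Poly_Mapping.keys p" for m
    unfolding c_def using that by (intro Min_le) simp_all
  define t where "t = n - c"
  have deg: "mon_degree m = n" if "m \<in> Poly_Mapping.keys p" for m
    using p(2) that by (simp add: homog_def)
  have t12: "Poly_Mapping.lookup m 1 + Poly_Mapping.lookup m 2 = t"
    if "m \<in> Poly_Mapping.keys p" "Poly_Mapping.lookup m 3 = c" for m
    using deg[OF that(1)] that(2) by (simp add: mon_degree_3 t_def)
  have tc: "2 * t + c + 3 \<le> 2 * d + e"
    using p(3)[OF m0(1)] unfolding std_mon_def t12[OF m0] m0(2) by simp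
  let ?q = "\<lambda>m. m - Poly_Mapping.single 3 c"
  have split: "Poly_Mapping.single 3 c + ?q m = m" if "m \<in> Poly_Mapping.keys p" for m
    using c_le[OF that] by (intro poly_mapping_eqI) (auto simp: lookup_add lookup_minus lookup_single when_def)
  define p' where "p' = (\<Sum>m\<in>Poly_Mapping.keys p. Poly_Mapping.single (?q m) (Poly_Mapping.lookup p m))"
  have p_eq: "X 3 ^ c * p' = p"
  proof -
    have "X 3 ^ c * p' = (\<Sum>m\<in>Poly_Mapping.keys p. Poly_Mapping.single m (Poly_Mapping.lookup p m))"
      unfolding p'_def X_power sum_distrib_left mult_single by (intro sum.cong) (simp_all add: split)
    then show ?thesis by (simp add: poly_mapping_sum_single[symmetric])
  qed
  have p'_homog: "p' \<in> homog t"
    unfolding p'_def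
  proof (intro homog_sum homog_single)
    fix m assume m: "m \<in> Poly_Mapping.keys p"
    have "mon_degree (Poly_Mapping.single 3 c + ?q m) = n" using deg[OF m] split[OF m] by simp
    then show "mon_degree (?q m) = t" by (simp add: mon_degree_add t_def)
  qed
  define u where "u = lin_change (shear (- z)) p'"
  have "X 3 ^ c * u = lin_change (shear (- z)) p"
    unfolding u_def p_eq[symmetric] by (simp add: lin_change_mult lin_change_power lin_change_shear_X)
  also have "\<dots> \<in> ideal B"
    using p(1) by (auto simp: lin_change_shear_cancel)
  finally have "X 3 ^ c * u \<in> ideal B" .
  moreover have u_homog: "u \<in> homog t" unfolding u_def by (rule lin_change_homog[OF p'_homog])
  ultimately have u: "u \<in> ideal B" using inj tc by blast
  define S where "S = {m \<in> Poly_Mapping.keys p. Poly_Mapping.lookup m 3 = c}"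
  have "finite S" by (simp add: S_def)
  have dehom_u: "dehom 0 u = (\<Sum>m\<in>S. [:Poly_Mapping.lookup p m:] * [:-z, 1:] ^ Poly_Mapping.lookup m 2)"
  proof -
    have "dehom 0 u = (\<Sum>m\<in>Poly_Mapping.keys p. [:Poly_Mapping.lookup p m:] *
        ([:-z, 1:] ^ Poly_Mapping.lookup (?q m) 2 * 0 ^ Poly_Mapping.lookup (?q m) 3))"
      unfolding u_def dehom_shear p'_def dehom_sum dehom_single ..
    also have "\<dots> = (\<Sum>m\<in>Poly_Mapping.keys p. if Poly_Mapping.lookup m 3 = c
        then [:Poly_Mapping.lookup p m:] * [:-z, 1:] ^ Poly_Mapping.lookup m 2 else 0)"
    proof (rule sum.cong)
      fix m assume "m \<in> Poly_Mapping.keys p"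
      then have "c \<le> Poly_Mapping.lookup m 3" by (rule c_le)
      moreover have "Poly_Mapping.lookup (?q m) 2 = Poly_Mapping.lookup m 2"
        "Poly_Mapping.lookup (?q m) 3 = Poly_Mapping.lookup m 3 - c"
        by (simp_all add: lookup_minus lookup_single three_distinct)
      ultimately show "[:Poly_Mapping.lookup p m:] *
        ([:-z, 1:] ^ Poly_Mapping.lookup (?q m) 2 * 0 ^ Poly_Mapping.lookup (?q m) 3) =
        (if Poly_Mapping.lookup m 3 = c
        then [:Poly_Mapping.lookup p m:] * [:-z, 1:] ^ Poly_Mapping.lookup m 2 else 0)"
        by (simp add: zero_power_eq)
    qed simp
    finally show ?thesis by (simp only: S_def sum.inter_filter finite_keys)
  qed
  have "[:-z, 1:] ^ gam d e t dvd dehom 0 u"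
    unfolding dehom_u
  proof (intro dvd_sum dvd_mult le_imp_power_dvd)
    fix m assume "m \<in> S"
    then show "gam d e t \<le> Poly_Mapping.lookup m 2"
      using p(3)[of m] t12[of m] by (simp add: S_def std_mon_def)
  qed
  then have zero: "dehom 0 u = 0"
    using z[OF _ u u_homog] tc by simp
  \<comment> \<open>The coefficients are recovered after the substitution \<open>T \<mapsto> T + z\<close>.\<close>
  have "(\<Sum>m\<in>S. monom (Poly_Mapping.lookup p m) (Poly_Mapping.lookup m 2)) = 0"
  proof -
    have "poly (\<Sum>m\<in>S. monom (Poly_Mapping.lookup p m) (Poly_Mapping.lookup m 2)) y = poly (dehom 0 u) (y + z)" for y
      unfolding dehom_u by (simp add: poly_sum poly_monom)
    then have "\<forall>y. poly (\<Sum>m\<in>S. monom (Poly_Mapping.lookup p m) (Poly_Mapping.lookup m 2)) y = 0"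
      by (simp add: zero)
    then show ?thesis by (simp only: poly_all_0_iff_0)
  qed
  from arg_cong[OF this, of "\<lambda>q. coeff q (Poly_Mapping.lookup m0 2)"]
  have "(\<Sum>m\<in>S. coeff (monom (Poly_Mapping.lookup p m) (Poly_Mapping.lookup m 2)) (Poly_Mapping.lookup m0 2)) = 0"
    by (simp only: coeff_sum coeff_0)
  moreover have "(\<Sum>m\<in>S. coeff (monom (Poly_Mapping.lookup p m) (Poly_Mapping.lookup m 2)) (Poly_Mapping.lookup m0 2)) =
      (\<Sum>m\<in>S. if m = m0 then Poly_Mapping.lookup p m else 0)"
  proof (rule sum.cong)
    fix m assume m: "m \<in> S"
    then have "m = m0" if "Poly_Mapping.lookup m 2 = Poly_Mapping.lookup m0 2"
      using that t12[of m] t12[OF m0] m0(2) by (intro mon3_eqI) (auto simp: S_def)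
    then show "coeff (monom (Poly_Mapping.lookup p m) (Poly_Mapping.lookup m 2)) (Poly_Mapping.lookup m0 2) =
        (if m = m0 then Poly_Mapping.lookup p m else 0)"
      by auto
  qed simp
  ultimately have "Poly_Mapping.lookup p m0 = 0"
    using \<open>finite S\<close> m0 by (simp add: S_def)
  then show False using m0(1) by (simp add: in_keys_iff)
qed

text \<open>
  In suitable coordinates, the standard monomials are linearly independent modulo the ideal.
\<close>

lemma standard_independent:
  fixes B :: "(3, 'a::field_char_0) mpoly set"
  assumes de: "d < e" "e + 1 < 2 * d" and H: "\<And>n. hilb (ideal B) n = ci_hilb d e n"
    and slp: "strong_Lefschetz (ideal B)" and proper: "ideal B \<noteq> UNIV"
  shows "\<exists>A :: 'a ^ 3 ^ 3. invertible A \<and> (\<forall>n. \<forall>p\<in>lin_change A ` ideal B \<inter> homog n.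
    (\<forall>m\<in>Poly_Mapping.keys p. std_mon d e m) \<longrightarrow> p = 0)"
proof -
  obtain l where l: "l \<in> homog 1" and max_rank:
    "\<forall>b\<ge>1. \<forall>t. (\<forall>f\<in>homog t. l ^ b * f \<in> ideal B \<longrightarrow> f \<in> ideal B) \<or>
      (\<forall>g\<in>homog (t + b). \<exists>f\<in>homog t. g - l ^ b * f \<in> ideal B)"
    using strong_LefschetzE[OF slp] .
  have inj: "f \<in> ideal B" if f: "f \<in> homog t" "2 * t + b + 3 \<le> 2 * d + e" "l ^ b * f \<in> ideal B" for t b f
  proof (cases "b = 0")
    case False
    have "hilb (ideal B) (int t) \<le> hilb (ideal B) (int (t + b))"
      unfolding H using f(2) by (intro ci_hilb_le[OF de]) auto
    then show ?thesis
      using lefschetz_injective[OF l max_rank[rule_format] _ f(1,3)] False by simp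
  qed (use f in simp)
  have "l \<noteq> 0"
  proof
    assume "l = 0"
    then have "1 \<in> ideal B"
      using inj[of 1 0 1] de by (simp add: homog_one ideal_zero)
    then have "f \<in> ideal B" for f using ideal_mult[of 1 B f] by simp
    then show False using proper by blast
  qed
  then obtain G :: "'a ^ 3 ^ 3" where G: "invertible G" "lin_change G l = X 3"
    using linear_form_to_X3[OF l] by blast
  obtain G' where G': "\<And>f. lin_change G' (lin_change G f) = f" "\<And>f. lin_change G (lin_change G' f) = f"
    using lin_change_invertible[OF G(1)] by metis
  let ?B = "lin_change G ` B"
  have I1: "lin_change G ` ideal B = ideal ?B" by (rule lin_change_image_ideal[OF G(1)])
  have H1: "hilb (ideal ?B) n = ci_hilb d e n" for n
    using hilb_lin_change[OF G(1), of B n] by (simp add: I1 H)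
  have inj1: "f \<in> ideal ?B" if f: "f \<in> homog t" "2 * t + b + 3 \<le> 2 * d + e" "X 3 ^ b * f \<in> ideal ?B" for t b f
  proof -
    obtain g where g: "g \<in> ideal B" "X 3 ^ b * f = lin_change G g" using f(3) I1 by blast
    have "lin_change G (l ^ b * lin_change G' f) = lin_change G g"
      by (simp add: lin_change_mult lin_change_power G(2) G'(2) g(2))
    then have "l ^ b * lin_change G' f = g" using G'(1) by metis
    then have "lin_change G' f \<in> ideal B"
      using inj[OF lin_change_homog[OF f(1)] f(2)] g(1) by blast
    then have "lin_change G (lin_change G' f) \<in> lin_change G ` ideal B" by (rule imageI)
    then show ?thesis by (simp only: G'(2) I1)
  qed
  obtain z where z: "\<forall>t f. 2 * t + 3 \<le> 2 * d + e \<longrightarrow> f \<in> ideal ?B \<longrightarrow> f \<in> homog t \<longrightarrow>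
    [:-z, 1:] ^ gam d e t dvd dehom 0 f \<longrightarrow> dehom 0 f = 0"
    using generic_transversality[OF de H1] by (rule exE)
  have image: "lin_change (shear z ** G) ` ideal B = lin_change (shear z) ` ideal ?B"
    unfolding I1[symmetric] by (simp add: image_image lin_change_comp)
  show ?thesis
  proof (intro exI[of _ "shear z ** G"] conjI allI ballI impI)
    show "invertible (shear z ** G)" using invertible_shear G(1) by (rule invertible_mult)
  next
    fix n p
    assume p: "p \<in> lin_change (shear z ** G) ` ideal B \<inter> homog n"
      "\<forall>m\<in>Poly_Mapping.keys p. std_mon d e m"
    show "p = 0"
    proof (rule standard_independent_shear[of d e ?B z p n])
      show "p \<in> lin_change (shear z) ` ideal ?B" using p(1) unfolding image by (rule IntD1)
      show "p \<in> homog n" using p(1) by (rule IntD2)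
    qed (fact inj1 z[rule_format] p(2)[rule_format])+
  qed
qed

section \<open>Polynomial functions of the matrix entries\<close>

text \<open>The functions on matrices that are given by a polynomial in the nine entries.\<close>

definition poly_fun :: "('a::field ^ 3 ^ 3 \<Rightarrow> 'a) set" where
  "poly_fun = {F. \<exists>p. \<forall>A. F A = eval_mpoly (\<lambda>c. c) (\<lambda>(i, j). A $ i $ j) p}"

global_interpretation idc: coeff_hom "\<lambda>c :: 'a::comm_ring_1. c"
  by unfold_locales simp_all

lemma poly_fun_const: "(\<lambda>A. c) \<in> poly_fun"
  unfolding poly_fun_def
  by (intro CollectI exI[of _ "Poly_Mapping.single 0 c"]) (simp add: idc.eval_single)

lemma poly_fun_entry: "(\<lambda>A. A $ i $ j) \<in> poly_fun"
  unfolding poly_fun_def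
  by (intro CollectI exI[of _ "X (i, j)"]) (simp add: idc.eval_X)

lemma poly_fun_add:
  assumes "F \<in> poly_fun" and "G \<in> poly_fun"
  shows "(\<lambda>A. F A + G A) \<in> poly_fun"
proof -
  obtain p q where "\<forall>A. F A = eval_mpoly (\<lambda>c. c) (\<lambda>(i, j). A $ i $ j) p"
    "\<forall>A. G A = eval_mpoly (\<lambda>c. c) (\<lambda>(i, j). A $ i $ j) q"
    using assms unfolding poly_fun_def by blast
  then show ?thesis
    unfolding poly_fun_def by (intro CollectI exI[of _ "p + q"]) (simp add: idc.eval_add)
qed

lemma poly_fun_mult:
  assumes "F \<in> poly_fun" and "G \<in> poly_fun"
  shows "(\<lambda>A. F A * G A) \<in> poly_fun"
proof -
  obtain p q where "\<forall>A. F A = eval_mpoly (\<lambda>c. c) (\<lambda>(i, j). A $ i $ j) p"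
    "\<forall>A. G A = eval_mpoly (\<lambda>c. c) (\<lambda>(i, j). A $ i $ j) q"
    using assms unfolding poly_fun_def by blast
  then show ?thesis
    unfolding poly_fun_def by (intro CollectI exI[of _ "p * q"]) (simp add: idc.eval_mult)
qed

lemma poly_fun_diff:
  assumes "F \<in> poly_fun" and "G \<in> poly_fun"
  shows "(\<lambda>A. F A - G A) \<in> poly_fun"
  using poly_fun_add[OF assms(1) poly_fun_mult[OF poly_fun_const[of "-1"] assms(2)]] by simp

lemma poly_fun_prod:
  "(\<And>i. i \<in> S \<Longrightarrow> F i \<in> poly_fun) \<Longrightarrow> (\<lambda>A. \<Prod>i\<in>S. F i A) \<in> poly_fun"
  by (induction S rule: infinite_finite_induct) (simp_all add: poly_fun_const poly_fun_mult)

lemma poly_fun_det: "det \<in> poly_fun"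
proof -
  have "(\<lambda>A. det A) = (\<lambda>A :: 'a ^ 3 ^ 3.
      A $ 1 $ 1 * A $ 2 $ 2 * A $ 3 $ 3 + A $ 1 $ 2 * A $ 2 $ 3 * A $ 3 $ 1 +
      A $ 1 $ 3 * A $ 2 $ 1 * A $ 3 $ 2 - A $ 1 $ 1 * A $ 2 $ 3 * A $ 3 $ 2 -
      A $ 1 $ 2 * A $ 2 $ 1 * A $ 3 $ 3 - A $ 1 $ 3 * A $ 2 $ 2 * A $ 3 $ 1)"
    by (rule ext) (rule det_3)
  also have "\<dots> \<in> poly_fun"
    by (intro poly_fun_add poly_fun_diff poly_fun_mult poly_fun_entry)
  finally show ?thesis .
qed

lemma poly_fun_line:
  fixes A B :: "'a::field ^ 3 ^ 3"
  assumes "F \<in> poly_fun"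
  shows "\<exists>r. \<forall>s. poly r s = F (\<chi> i j. A $ i $ j + s * (B $ i $ j - A $ i $ j))"
proof -
  obtain p where p: "\<forall>A. F A = eval_mpoly (\<lambda>c. c) (\<lambda>(i, j). A $ i $ j) p"
    using assms unfolding poly_fun_def by blast
  define r where "r = eval_mpoly (\<lambda>c. [:c:]) (\<lambda>(i, j). [:A $ i $ j, B $ i $ j - A $ i $ j:]) p"
  have "poly r s = F (\<chi> i j. A $ i $ j + s * (B $ i $ j - A $ i $ j))" for s
    unfolding p[rule_format] r_def eval_mpoly_def
    by (simp add: poly_sum poly_prod split_def)
  then show ?thesis by blast
qed

lemma zariski_open_nonvanishing:
  assumes "F \<in> poly_fun"
  shows "zariski_open_GL3 {A. invertible A \<and> F A \<noteq> 0}"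
proof -
  obtain p where p: "\<forall>A. F A = eval_mpoly (\<lambda>c. c) (\<lambda>(i, j). A $ i $ j) p"
    using assms unfolding poly_fun_def by blast
  then show ?thesis
    unfolding zariski_open_GL3_def by (intro exI[of _ "{p}"]) simp
qed

text \<open>
  Two nonempty open sets meet on the line that joins a point of the first to a point of the second.
\<close>

lemma zariski_open_GL3_inter:
  fixes U V :: "('a::field_char_0 ^ 3 ^ 3) set"
  assumes "zariski_open_GL3 U" "U \<noteq> {}" "zariski_open_GL3 V" "V \<noteq> {}"
  shows "U \<inter> V \<noteq> {}"
proof -
  have nbhd: "\<exists>F\<in>poly_fun. F A \<noteq> 0 \<and> (\<forall>M. invertible M \<and> F M \<noteq> 0 \<longrightarrow> M \<in> W)"
    if zar: "zariski_open_GL3 W" "A \<in> W" for A and W :: "('a ^ 3 ^ 3) set"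
  proof -
    obtain P where W: "W = {A. invertible A \<and> (\<exists>p\<in>P. eval_mpoly (\<lambda>c. c) (\<lambda>(i, j). A $ i $ j) p \<noteq> 0)}"
      using zar(1)[unfolded zariski_open_GL3_def] by (rule exE)
    then obtain p where p: "p \<in> P" "eval_mpoly (\<lambda>c. c) (\<lambda>(i, j). A $ i $ j) p \<noteq> 0"
      using zar(2) by blast
    have "(\<lambda>A. eval_mpoly (\<lambda>c. c) (\<lambda>(i, j). A $ i $ j) p) \<in> poly_fun"
      unfolding poly_fun_def by blast
    then show ?thesis
      using p unfolding W by (intro bexI[of _ "\<lambda>A. eval_mpoly (\<lambda>c. c) (\<lambda>(i, j). A $ i $ j) p"]) auto
  qed
  obtain A B where AB: "A \<in> U" "B \<in> V" using assms(2,4) by blast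
  obtain F where F: "F \<in> poly_fun" "F A \<noteq> 0" "\<forall>M. invertible M \<and> F M \<noteq> 0 \<longrightarrow> M \<in> U"
    using nbhd[OF assms(1) AB(1)] by blast
  obtain G where G: "G \<in> poly_fun" "G B \<noteq> 0" "\<forall>M. invertible M \<and> G M \<noteq> 0 \<longrightarrow> M \<in> V"
    using nbhd[OF assms(3) AB(2)] by blast
  define L where "L s = (\<chi> i j. A $ i $ j + s * (B $ i $ j - A $ i $ j))" for s
  have L: "L 0 = A" "L 1 = B" by (simp_all add: L_def vec_eq_iff)
  obtain r1 where r1: "\<forall>s. poly r1 s = F (L s)"
    using poly_fun_line[OF F(1)] unfolding L_def by (rule exE)
  obtain r2 where r2: "\<forall>s. poly r2 s = G (L s)"
    using poly_fun_line[OF G(1)] unfolding L_def by (rule exE)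
  obtain r3 where r3: "\<forall>s. poly r3 s = det (L s)"
    using poly_fun_line[OF poly_fun_det] unfolding L_def by (rule exE)
  have "invertible A" using assms(1) AB(1) unfolding zariski_open_GL3_def by blast
  then have "poly r3 0 \<noteq> 0" by (simp add: r3 L invertible_det_nz)
  moreover have "poly r1 0 \<noteq> 0" "poly r2 1 \<noteq> 0" using F(2) G(2) by (simp_all add: r1 r2 L)
  ultimately have "r1 * r2 * r3 \<noteq> 0" by auto
  then have "finite {s. poly (r1 * r2 * r3) s = 0}" by (rule poly_roots_finite)
  then obtain s where "s \<notin> {s. poly (r1 * r2 * r3) s = 0}"
    using ex_new_if_finite infinite_UNIV_char_0 by blast
  then have "F (L s) \<noteq> 0" "G (L s) \<noteq> 0" "invertible (L s)"
    by (simp_all add: r1 r2 r3 invertible_det_nz)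
  then have "L s \<in> U \<inter> V" using F(3) G(3) by blast
  then show ?thesis by blast
qed

text \<open>
  Linear independence of finitely many vectors with polynomial entries is an open condition.
  The induction is one step of Gaussian elimination with a pivot that is nonzero at \<open>A\<^sub>0\<close>.
\<close>

lemma independent_open:
  fixes v :: "'i \<Rightarrow> 'a::field ^ 3 ^ 3 \<Rightarrow> 'k \<Rightarrow> 'a"
  assumes "finite S" and "\<And>i k. (\<lambda>A. v i A k) \<in> poly_fun"
    and "\<And>c. (\<And>k. (\<Sum>i\<in>S. c i * v i A0 k) = 0) \<Longrightarrow> (\<forall>i\<in>S. c i = 0)"
  shows "\<exists>P\<in>poly_fun. P A0 \<noteq> 0 \<and>
    (\<forall>A. P A \<noteq> 0 \<longrightarrow> (\<forall>c. (\<forall>k. (\<Sum>i\<in>S. c i * v i A k) = 0) \<longrightarrow> (\<forall>i\<in>S. c i = 0)))"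
  using assms
proof (induction S arbitrary: v rule: finite_induct)
  case empty
  show ?case by (intro bexI[of _ "\<lambda>A. 1"]) (simp_all add: poly_fun_const)
next
  case (insert x S)
  have neq: "i \<noteq> x" if "i \<in> S" for i using that insert.hyps(2) by auto
  have "\<exists>k0. v x A0 k0 \<noteq> 0"
  proof (rule ccontr)
    assume *: "\<not> (\<exists>k0. v x A0 k0 \<noteq> 0)"
    have "(\<Sum>i\<in>insert x S. (if i = x then 1 else 0) * v i A0 k) = 0" for k
      using * by (intro sum.neutral) auto
    from insert.prems(2)[OF this] show False by simp
  qed
  then obtain k0 where k0: "v x A0 k0 \<noteq> 0" by blast
  define w where "w i A k = v x A k0 * v i A k - v i A k0 * v x A k" for i A k
  have sum_w: "(\<Sum>i\<in>S. c i * w i A k) =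
      v x A k0 * (\<Sum>i\<in>S. c i * v i A k) - (\<Sum>i\<in>S. c i * v i A k0) * v x A k" for c A k
  proof -
    have "(\<Sum>i\<in>S. c i * w i A k) =
        (\<Sum>i\<in>S. v x A k0 * (c i * v i A k) - (c i * v i A k0) * v x A k)"
      by (rule sum.cong[OF refl]) (simp only: w_def right_diff_distrib mult.assoc mult.left_commute)
    then show ?thesis by (simp only: sum_subtractf sum_distrib_left sum_distrib_right)
  qed
  have "(\<lambda>A. w i A k) \<in> poly_fun" for i k
    unfolding w_def by (intro poly_fun_diff poly_fun_mult insert.prems(1))
  moreover have "\<forall>i\<in>S. c i = 0" if c: "\<And>k. (\<Sum>i\<in>S. c i * w i A0 k) = 0" for c
  proof -
    define c' where "c' i = (if i = x then - (\<Sum>i\<in>S. c i * v i A0 k0) else c i * v x A0 k0)" for i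
    have "(\<Sum>i\<in>insert x S. c' i * v i A0 k) = 0" for k
    proof -
      have "(\<Sum>i\<in>S. c' i * v i A0 k) = (\<Sum>i\<in>S. v x A0 k0 * (c i * v i A0 k))"
        by (rule sum.cong[OF refl]) (simp only: c'_def neq if_False mult_ac)
      also have "\<dots> = v x A0 k0 * (\<Sum>i\<in>S. c i * v i A0 k)"
        by (simp only: sum_distrib_left)
      finally show ?thesis
        using c[of k] insert.hyps unfolding sum_w by (simp add: c'_def)
    qed
    from insert.prems(2)[OF this] have "\<forall>i\<in>S. c' i = 0" by blast
    then show ?thesis using k0 neq by (auto simp: c'_def)
  qed
  ultimately obtain P where P: "P \<in> poly_fun" "P A0 \<noteq> 0"
    "\<forall>A. P A \<noteq> 0 \<longrightarrow> (\<forall>c. (\<forall>k. (\<Sum>i\<in>S. c i * w i A k) = 0) \<longrightarrow> (\<forall>i\<in>S. c i = 0))"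
    using insert.IH[of w] by blast
  show ?case
  proof (intro bexI[of _ "\<lambda>A. P A * v x A k0"] conjI allI impI)
    show "(\<lambda>A. P A * v x A k0) \<in> poly_fun"
      by (intro poly_fun_mult P(1) insert.prems(1))
    show "P A0 * v x A0 k0 \<noteq> 0" using P(2) k0 by simp
  next
    fix A c assume A: "P A * v x A k0 \<noteq> 0" and c: "\<forall>k. (\<Sum>i\<in>insert x S. c i * v i A k) = 0"
    have cx: "(\<Sum>i\<in>S. c i * v i A k) = - (c x * v x A k)" for k
      using c insert.hyps by (simp add: eq_neg_iff_add_eq_0 add.commute)
    have "(\<Sum>i\<in>S. c i * w i A k) = 0" for k
      unfolding sum_w cx by simp
    moreover have "P A \<noteq> 0" using A by auto
    ultimately have S: "\<forall>i\<in>S. c i = 0" using P(3) by blast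
    then have "c x * v x A k0 = 0" using cx[of k0] by simp
    then show "\<forall>i\<in>insert x S. c i = 0" using S A by simp
  qed
qed

text \<open>Families of polynomials whose coefficients are polynomial functions of the matrix entries.\<close>

inductive poly_family :: "('a::field ^ 3 ^ 3 \<Rightarrow> ('v, 'a) mpoly) \<Rightarrow> bool" where
  poly_family_single: "F \<in> poly_fun \<Longrightarrow> poly_family (\<lambda>A. Poly_Mapping.single m (F A))"
| poly_family_add: "poly_family G \<Longrightarrow> poly_family H \<Longrightarrow> poly_family (\<lambda>A. G A + H A)"

lemma poly_family_zero: "poly_family (\<lambda>A. 0)"
  using poly_family_single[OF poly_fun_const[of 0]] by simp

lemma poly_family_mult:
  assumes "poly_family G" and "poly_family H"
  shows "poly_family (\<lambda>A. G A * H A)"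
  using assms(1)
proof induction
  case (poly_family_single F m)
  show ?case using assms(2)
  proof induction
    case (poly_family_single F' m')
    then show ?case
      using poly_family.poly_family_single[OF poly_fun_mult[OF \<open>F \<in> poly_fun\<close>]] by (simp add: mult_single)
  next
    case (poly_family_add G H)
    then show ?case by (simp add: distrib_left poly_family.poly_family_add)
  qed
next
  case (poly_family_add G H)
  then show ?case by (simp add: distrib_right poly_family.poly_family_add)
qed

lemma poly_family_const: "poly_family (\<lambda>A. p)"
  by (induction p rule: mpoly_induct)
     (simp_all add: poly_family_zero poly_family_add poly_family_single poly_fun_const)

lemma poly_family_sum: "(\<And>i. i \<in> S \<Longrightarrow> poly_family (G i)) \<Longrightarrow> poly_family (\<lambda>A. \<Sum>i\<in>S. G i A)"
  by (induction S rule: infinite_finite_induct) (simp_all add: poly_family_zero poly_family_add)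

lemma poly_family_prod: "(\<And>i. i \<in> S \<Longrightarrow> poly_family (G i)) \<Longrightarrow> poly_family (\<lambda>A. \<Prod>i\<in>S. G i A)"
  by (induction S rule: infinite_finite_induct) (simp_all add: poly_family_const poly_family_mult)

lemma poly_family_power: "poly_family G \<Longrightarrow> poly_family (\<lambda>A. G A ^ n)"
  by (induction n) (simp_all add: poly_family_const poly_family_mult)

lemma poly_family_lookup: "poly_family G \<Longrightarrow> (\<lambda>A. Poly_Mapping.lookup (G A) m) \<in> poly_fun"
proof (induction rule: poly_family.induct)
  case (poly_family_single F n)
  then show ?case by (cases "n = m") (simp_all add: lookup_single poly_fun_const)
next
  case (poly_family_add G H)
  then show ?case by (simp add: lookup_add poly_fun_add)
qed

lemma poly_family_lin_change: "poly_family (\<lambda>A. lin_change A f)"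
  unfolding lin_change_def eval_mpoly_def
  by (intro poly_family_sum poly_family_mult poly_family_const poly_family_prod poly_family_power
      poly_family_single poly_fun_entry)

text \<open>Independence of the standard monomials modulo the transformed ideal is an open condition.\<close>

lemma independent_mod_ideal_open:
  fixes B :: "(3, 'a::field) mpoly set"
  assumes inv: "invertible A0"
    and indep: "\<And>p. p \<in> lin_change A0 ` ideal B \<Longrightarrow> p \<in> homog n \<Longrightarrow> (\<And>m. m \<in> Poly_Mapping.keys p \<Longrightarrow> Q m) \<Longrightarrow> p = 0"
  shows "\<exists>P\<in>poly_fun. P A0 \<noteq> 0 \<and> (\<forall>A. invertible A \<and> P A \<noteq> 0 \<longrightarrow>
    (\<forall>p\<in>lin_change A ` ideal B \<inter> homog n. (\<forall>m\<in>Poly_Mapping.keys p. Q m) \<longrightarrow> p = 0))"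
proof -
  \<comment> \<open>The vectors are the monomials in \<open>M\<close> and the images of a basis \<open>C\<close> of \<open>I\<^sub>n\<close>.\<close>
  define M where "M = {m :: 3 mon. mon_degree m = n \<and> Q m}"
  have finM: "finite M" unfolding M_def by (rule finite_subset[OF _ finite_monomials[of n]]) auto
  obtain C where C: "finite C" "mp.independent C" "C \<subseteq> ideal B \<inter> homog n" "mp.span C = ideal B \<inter> homog n"
    using mp.fin_dim_basis[OF fin_dim_piece[of B n]] by metis
  obtain A0' where inv': "\<And>f. lin_change A0' (lin_change A0 f) = f"
    using lin_change_invertible[OF inv] by metis
  define v :: "3 mon + (3, 'a) mpoly \<Rightarrow> 'a ^ 3 ^ 3 \<Rightarrow> 3 mon \<Rightarrow> 'a" where
    "v i A k = Poly_Mapping.lookup (case i of Inl m \<Rightarrow> monom_poly m | Inr f \<Rightarrow> lin_change A f) k" for i A k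
  have comb: "(\<Sum>i\<in>M <+> C. c i * v i A k) =
      Poly_Mapping.lookup ((\<Sum>m\<in>M. Poly_Mapping.single m (c (Inl m))) + lin_change A (\<Sum>f\<in>C. scal (c (Inr f)) f)) k"
    for c A k
  proof -
    have "c (Inl m) * Poly_Mapping.lookup (monom_poly m) k = Poly_Mapping.lookup (Poly_Mapping.single m (c (Inl m))) k" for m
      by (simp add: lookup_single when_def)
    then show ?thesis
      using finM C(1)
      by (simp add: sum.Plus v_def lookup_add lookup_sum lin_change_sum lin_change_scal)
  qed
  have poly: "(\<lambda>A. v i A k) \<in> poly_fun" for i k
    unfolding v_def
    by (cases i) (simp_all add: poly_family_lookup poly_family_const poly_family_lin_change)
  have indep0: "\<forall>i\<in>M <+> C. c i = 0" if c: "\<And>k. (\<Sum>i\<in>M <+> C. c i * v i A0 k) = 0" for c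
  proof -
    let ?p = "\<Sum>m\<in>M. Poly_Mapping.single m (c (Inl m))" and ?g = "\<Sum>f\<in>C. scal (c (Inr f)) f"
    have lookup_p: "Poly_Mapping.lookup ?p m = (if m \<in> M then c (Inl m) else 0)" for m
      using finM by (simp add: lookup_sum lookup_single when_def)
    have eq: "?p + lin_change A0 ?g = 0"
      using c unfolding comb by (intro poly_mapping_eqI) simp
    then have "?p = lin_change A0 (- ?g)"
      by (simp add: lin_change_uminus eq_neg_iff_add_eq_0)
    moreover have "- ?g \<in> ideal B"
      using C(3) by (intro mp.subspace_neg mp.subspace_sum mp.subspace_scale subspace_ideal) auto
    ultimately have "?p \<in> lin_change A0 ` ideal B" by blast
    moreover have "?p \<in> homog n" by (intro homog_sum homog_single) (simp add: M_def)
    moreover have "Q m" if "m \<in> Poly_Mapping.keys ?p" for m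
      using that lookup_p[of m] by (auto simp: in_keys_iff M_def split: if_splits)
    ultimately have p0: "?p = 0" by (rule indep)
    then have "lin_change A0 ?g = 0" using eq by simp
    then have "?g = 0"
      using inv' [of ?g] by simp
    then have "\<forall>f\<in>C. c (Inr f) = 0"
      using mp.independentD[OF C(2,1) order_refl, of "\<lambda>f. c (Inr f)"] by blast
    moreover have "c (Inl m) = 0" if "m \<in> M" for m
      using lookup_p[of m] that unfolding p0 by simp
    ultimately show ?thesis by auto
  qed
  obtain P where P: "P \<in> poly_fun" "P A0 \<noteq> 0"
    "\<forall>A. P A \<noteq> 0 \<longrightarrow> (\<forall>c. (\<forall>k. (\<Sum>i\<in>M <+> C. c i * v i A k) = 0) \<longrightarrow> (\<forall>i\<in>M <+> C. c i = 0))"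
    using independent_open[of "M <+> C" v A0, OF _ poly indep0] finM C(1) by (auto simp: finite_Plus)
  have "p = 0" if A: "invertible A" "P A \<noteq> 0" and p: "p \<in> lin_change A ` ideal B" "p \<in> homog n"
    "\<forall>m\<in>Poly_Mapping.keys p. Q m" for A p
  proof -
    have "p \<in> lin_change A ` (ideal B \<inter> homog n)"
      using p(1,2) lin_change_piece[OF A(1), of "ideal B" n] by blast
    then obtain g where g: "g \<in> mp.span C" "p = lin_change A g" using C(4) by blast
    then obtain u where u: "g = (\<Sum>f\<in>C. scal (u f) f)"
      unfolding mp.span_finite[OF C(1)] by blast
    define c where "c i = (case i of Inl m \<Rightarrow> Poly_Mapping.lookup p m | Inr f \<Rightarrow> - u f)" for i
    have keys: "Poly_Mapping.keys p \<subseteq> M" using p(2,3) by (auto simp: M_def homog_def)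
    have "(\<Sum>m\<in>M. Poly_Mapping.single m (c (Inl m))) = p"
      using keys finM unfolding c_def
      by (intro poly_mapping_eqI) (auto simp: lookup_sum lookup_single when_def in_keys_iff)
    moreover have "(\<Sum>f\<in>C. scal (c (Inr f)) f) = - g"
      unfolding u by (simp add: c_def sum_negf)
    ultimately have "(\<Sum>i\<in>M <+> C. c i * v i A k) = 0" for k
      unfolding comb by (simp add: g(2) lin_change_uminus)
    then have "\<forall>i\<in>M <+> C. c i = 0" using P(3) A(2) by blast
    then have "Poly_Mapping.lookup p m = 0" if "m \<in> M" for m
      using that by (force simp: c_def)
    then show "p = 0" using keys by (metis in_keys_iff poly_mapping_eqI lookup_zero subsetD)
  qed
  then show ?thesis using P(1,2) by blast
qed

section \<open>The initial ideal in generic coordinates\<close>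

text \<open>
  Summing the \<open>s + 1 - gam d e s\<close> standard monomials over all \<open>s \<le> r\<close> gives the Hilbert function
  at \<open>r\<close>.
\<close>

lemma card_std_mon_ge:
  assumes de: "d < e" "e + 1 < 2 * d" and r: "r \<le> t" "t \<le> n" "r + n + 3 \<le> 2 * d + e"
  shows "ci_hilb d e (int r) \<le>
    int (card {k. std_mon d e k \<and> mon_degree k = n \<and> n - t \<le> Poly_Mapping.lookup k 3})"
proof -
  let ?E = "{k. std_mon d e k \<and> mon_degree k = n \<and> n - t \<le> Poly_Mapping.lookup k 3}"
  let ?F = "{mon3 (s - b) b (n - s) | s b. s \<in> {..r} \<and> b \<in> {gam d e s..s}}"
  have gam: "gam d e s \<le> s + 1" if "s \<le> r" for s
    using that r by (intro gam_le[OF de]) linarith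
  have "ci_hilb d e (int r) = (\<Sum>s\<le>r. int (s + 1) - int (gam d e s))"
    using r by (intro ci_hilb_sum[OF de]) linarith
  also have "\<dots> = int (\<Sum>s\<le>r. card {gam d e s..s})"
    unfolding of_nat_sum
  proof (rule sum.cong[OF refl])
    fix s assume "s \<in> {..r}"
    then have "gam d e s \<le> s + 1" using gam by simp
    then show "int (s + 1) - int (gam d e s) = int (card {gam d e s..s})" by simp
  qed
  also have "(\<Sum>s\<le>r. card {gam d e s..s}) = card ?F"
    using r by (intro card_monomials[symmetric]) auto
  also have "card ?F \<le> card ?E"
  proof (rule card_mono)
    show "finite ?E" by (rule finite_subset[OF _ finite_monomials[of n]]) auto
    show "?F \<subseteq> ?E"
      using r by (auto simp: std_mon_def)
  qed
  finally show ?thesis by simp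
qed

lemma grevlex_less_asym: "grevlex_less m k \<Longrightarrow> \<not> grevlex_less k m"
  by (auto simp: grevlex_less_def)

text \<open>
  The standard monomials divisible by \<open>x\<^sub>3\<^sup>c\<close> are independent modulo the ideal, and there are
  as many of them in degree \<open>n\<close> as the dimension of \<open>x\<^sub>3\<^sup>c S\<^bsub>n - c\<^esub>\<close> modulo the ideal permits.
  Hence they span it, which writes every other monomial as a combination of smaller ones.
\<close>

lemma nonstandard_reduces:
  fixes B :: "(3, 'a::field) mpoly set"
  assumes de: "d < e" "e + 1 < 2 * d" and H: "\<And>n. hilb (ideal B) n = ci_hilb d e n"
    and indep: "\<And>n p. p \<in> ideal B \<Longrightarrow> p \<in> homog n \<Longrightarrow>
      (\<And>m. m \<in> Poly_Mapping.keys p \<Longrightarrow> std_mon d e m) \<Longrightarrow> p = 0"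
    and m: "\<not> std_mon d e m"
  shows "\<exists>r. monom_poly m - r \<in> ideal B \<and>
    (\<forall>k\<in>Poly_Mapping.keys r. std_mon d e k \<and> mon_degree k = mon_degree m \<and> grevlex_less k m)"
proof -
  define n where "n = mon_degree m"
  define c where "c = Poly_Mapping.lookup m 3"
  define t where "t = Poly_Mapping.lookup m 1 + Poly_Mapping.lookup m 2"
  have n: "n = t + c" by (simp add: n_def c_def t_def mon_degree_3)
  define E where "E = {k. std_mon d e k \<and> mon_degree k = n \<and> c \<le> Poly_Mapping.lookup k 3}"
  have E_eq: "E = {k. std_mon d e k \<and> mon_degree k = n \<and> n - t \<le> Poly_Mapping.lookup k 3}"
    by (simp add: E_def n)
  have finE: "finite E" unfolding E_def by (rule finite_subset[OF _ finite_monomials[of n]]) auto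
  let ?U = "ideal B \<inter> homog n" and ?V = "homog t :: (3, 'a) mpoly set"
  let ?W = "{p :: (3, 'a) mpoly. Poly_Mapping.keys p \<subseteq> E}"
  let ?S1 = "{u + X 3 ^ c * v | u v. u \<in> ?U \<and> v \<in> ?V}" and ?S2 = "{u + w | u w. u \<in> ?U \<and> w \<in> ?W}"
  have mult: "X 3 ^ c * v \<in> homog n" if "v \<in> ?V" for v
    using homog_mult[OF homog_single[of "Poly_Mapping.single 3 c" c 1] that]
    by (simp add: X_power n add.commute)
  \<comment> \<open>The spaces \<open>I\<^sub>n + x\<^sub>3\<^sup>c S\<^sub>t\<close> and \<open>I\<^sub>n + span E\<close> are compared by their dimensions.\<close>
  note S1 = mm.dim_sum_image[OF linear_mult[of "X 3 ^ c"] fin_dim_piece[of B n] fin_dim_homog[of t]]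
  note S2 = mm.dim_sum_image[OF linear_id fin_dim_piece[of B n] dim_supported(2)[OF finE]]
  have "ideal B \<inter> ?V \<subseteq> {v \<in> ?V. X 3 ^ c * v \<in> ?U}"
    using mult by (auto simp: ideal_mult)
  moreover have "mp.fin_dim {v \<in> ?V. X 3 ^ c * v \<in> ?U}"
  proof (rule mp.fin_dim_subset[OF fin_dim_homog[of t]])
    show "mp.subspace {v \<in> ?V. X 3 ^ c * v \<in> ?U}"
      by (rule mp.subspaceI)
         (auto simp: ideal_zero ideal_add distrib_left homog_add scal_mult_right
           mp.subspace_scale[OF subspace_ideal] mp.subspace_scale[OF subspace_homog])
  qed auto
  ultimately have "mp.dim (ideal B \<inter> ?V) \<le> mp.dim {v \<in> ?V. X 3 ^ c * v \<in> ?U}"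
    using mp.fin_dim_dim_mono[OF _ subspace_piece] by blast
  then have dim1: "int (mp.dim ?S1) \<le> int (mp.dim ?U) + ci_hilb d e (int t)"
    using S1(2) H[of "int t"] unfolding hilb_nat by linarith
  have S1_sub: "?S1 \<subseteq> homog n" using mult by (auto intro: homog_add)
  have "mp.dim ?S1 \<le> mp.dim (homog n :: (3, 'a) mpoly set)"
    by (rule mp.fin_dim_dim_mono[OF fin_dim_homog mp.fin_dim_subspace[OF S1(1)] S1_sub])
  then have dim1': "int (mp.dim ?S1) \<le> int (mp.dim ?U) + ci_hilb d e (int n)"
    using H[of "int n"] unfolding hilb_nat by linarith
  have "{w \<in> ?W. w \<in> ?U} = {0}"
  proof (intro equalityI subsetI)
    fix w assume w: "w \<in> {w \<in> ?W. w \<in> ?U}"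
    then have "w = 0" by (intro indep[of w n]) (auto simp: E_def)
    then show "w \<in> {0}" by simp
  qed (simp add: ideal_zero)
  moreover have "mp.dim ({0} :: (3, 'a) mpoly set) = 0"
    using mp.dim_span_eq_card_independent[of "{}"] by (simp add: mp.dependent_def)
  ultimately have dim2: "mp.dim ?S2 = mp.dim ?U + card E"
    using S2(2) by (simp add: dim_supported(1)[OF finE])
  have monom: "monom_poly k \<in> (*) (X 3 ^ c) ` ?V" if "mon_degree k = n" "c \<le> Poly_Mapping.lookup k 3" for k
  proof
    let ?k = "mon3 (Poly_Mapping.lookup k 1) (Poly_Mapping.lookup k 2) (Poly_Mapping.lookup k 3 - c)"
    have "Poly_Mapping.single 3 c + ?k = k"
      using that(2) by (intro mon3_eqI) (simp_all add: lookup_add lookup_single three_distinct)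
    then show "monom_poly k = X 3 ^ c * monom_poly ?k"
      by (simp add: X_power mult_single)
    show "monom_poly ?k \<in> ?V"
      using that by (intro homog_single) (simp add: n mon_degree_3)
  qed
  have "?W \<subseteq> (*) (X 3 ^ c) ` ?V"
    unfolding span_monomials[symmetric]
  proof (rule mp.span_minimal)
    show "monom_poly ` E \<subseteq> (*) (X 3 ^ c) ` ?V" using monom by (auto simp: E_def)
    show "mp.subspace ((*) (X 3 ^ c) ` ?V)"
      by (rule mp.fin_dim_subspace[OF mm.dim_image(1)[OF linear_mult fin_dim_homog]])
  qed
  then have S2_sub: "?S2 \<subseteq> ?S1" by blast
  have "mp.dim ?S1 \<le> mp.dim ?S2"
  proof -
    consider "t + n + 3 \<le> 2 * d + e" | "n + 3 \<le> 2 * d + e" "2 * d + e < t + n + 3" | "2 * d + e < n + 3"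
      by linarith
    then have "ci_hilb d e (int t) \<le> int (card E) \<or> ci_hilb d e (int n) \<le> int (card E)"
    proof cases
      case 1
      then show ?thesis
        using card_std_mon_ge[OF de, of t t n] unfolding E_eq by (simp add: n)
    next
      case 2
      \<comment> \<open>The degree symmetric to \<open>n\<close>.\<close>
      define r where "r = 2 * d + e - 3 - n"
      have r: "int r = 2 * int d + int e - 3 - int n" "r \<le> t" "r + n + 3 \<le> 2 * d + e"
        using 2 unfolding r_def by linarith+
      have "ci_hilb d e (int r) = ci_hilb d e (int n)"
        unfolding r(1) by (rule ci_hilb_sym[OF de])
      then show ?thesis
        using card_std_mon_ge[OF de r(2) _ r(3)] unfolding E_eq by (simp add: n)
    next
      case 3
      then show ?thesis using ci_hilb_large[OF de] by simp
    qed
    then show ?thesis using dim1 dim1' dim2 by linarith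
  qed
  then have "?S2 = ?S1"
    by (rule mp.fin_dim_dim_equal[OF S1(1) mp.fin_dim_subspace[OF S2(1)] S2_sub])
  moreover have "monom_poly m \<in> ?S1"
  proof -
    obtain v where v: "v \<in> ?V" "monom_poly m = X 3 ^ c * v"
      using monom[of m] by (auto simp: n_def c_def)
    then have "monom_poly m = 0 + X 3 ^ c * v" "0 \<in> ?U" by (simp_all add: ideal_zero)
    then show ?thesis using v(1) by blast
  qed
  ultimately have "monom_poly m \<in> ?S2" by simp
  then obtain u r where ur: "monom_poly m = u + r" "u \<in> ?U" "r \<in> ?W" by blast
  have "std_mon d e k \<and> mon_degree k = mon_degree m \<and> grevlex_less k m" if "k \<in> Poly_Mapping.keys r" for k
  proof -
    have k: "std_mon d e k" "mon_degree k = n" "c \<le> Poly_Mapping.lookup k 3"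
      using that ur(3) by (auto simp: E_def)
    have "Poly_Mapping.lookup m 2 < Poly_Mapping.lookup k 2" if "Poly_Mapping.lookup k 3 = c"
    proof -
      have "Poly_Mapping.lookup k 1 + Poly_Mapping.lookup k 2 = t"
        using k(2) that by (simp add: mon_degree_3 n)
      then have "2 * t + c + 3 \<le> 2 * d + e" "gam d e t \<le> Poly_Mapping.lookup k 2"
        using k(1) that by (simp_all add: std_mon_def)
      moreover have "\<not> gam d e t \<le> Poly_Mapping.lookup m 2"
        using m calculation(1) by (simp add: std_mon_def t_def c_def)
      ultimately show ?thesis by simp
    qed
    then have "grevlex_less k m"
      using k(2,3) by (auto simp: grevlex_less_def n_def c_def)
    then show ?thesis using k by (simp add: n_def)
  qed
  moreover have "monom_poly m - r \<in> ideal B" using ur(1,2) by simp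
  ultimately show ?thesis by blast
qed

text \<open>
  Conversely, a standard leading monomial would survive the replacement of all nonstandard
  monomials by standard ones, and contradict independence.
\<close>

lemma lead_monomials:
  fixes B :: "(3, 'a::field) mpoly set"
  assumes de: "d < e" "e + 1 < 2 * d" and hom: "homogeneous (ideal B)"
    and H: "\<And>n. hilb (ideal B) n = ci_hilb d e n"
    and indep: "\<And>n p. p \<in> ideal B \<Longrightarrow> p \<in> homog n \<Longrightarrow>
      (\<And>m. m \<in> Poly_Mapping.keys p \<Longrightarrow> std_mon d e m) \<Longrightarrow> p = 0"
  shows "(\<exists>f\<in>ideal B. is_lead_mon m f) \<longleftrightarrow> \<not> std_mon d e m"
proof
  have "\<exists>r. monom_poly k - r \<in> ideal B \<and>
      (\<forall>j\<in>Poly_Mapping.keys r. std_mon d e j \<and> mon_degree j = mon_degree k \<and> grevlex_less j k)"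
    if k: "\<not> std_mon d e k" for k
    by (rule nonstandard_reduces[OF de H _ k]) (rule indep)
  then have "\<forall>k. \<exists>r. \<not> std_mon d e k \<longrightarrow> monom_poly k - r \<in> ideal B \<and>
      (\<forall>j\<in>Poly_Mapping.keys r. std_mon d e j \<and> mon_degree j = mon_degree k \<and> grevlex_less j k)"
    by blast
  then obtain R where R: "\<forall>k. \<not> std_mon d e k \<longrightarrow> monom_poly k - R k \<in> ideal B \<and>
      (\<forall>j\<in>Poly_Mapping.keys (R k). std_mon d e j \<and> mon_degree j = mon_degree k \<and> grevlex_less j k)"
    by (rule choice[THEN exE])
  {
    assume m: "\<not> std_mon d e m"
    let ?f = "monom_poly m - R m"
    have lookup_f: "Poly_Mapping.lookup ?f k = (if k = m then 1 else 0) - Poly_Mapping.lookup (R m) k" for k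
      by (simp add: lookup_minus lookup_single when_def eq_commute)
    have "m \<notin> Poly_Mapping.keys (R m)" using R m by blast
    then have "is_lead_mon m ?f"
      using R m unfolding is_lead_mon_def by (auto simp: in_keys_iff lookup_f)
    then show "\<exists>f\<in>ideal B. is_lead_mon m f" using R m by blast
  }
  show "\<not> std_mon d e m" if "\<exists>f\<in>ideal B. is_lead_mon m f"
  proof
    assume m: "std_mon d e m"
    obtain f where f: "f \<in> ideal B" "is_lead_mon m f" using \<open>\<exists>f\<in>ideal B. is_lead_mon m f\<close> by blast
    define n where "n = mon_degree m"
    define g where "g = hcomp n f"
    have g: "g \<in> ideal B" "g \<in> homog n"
      using hom f(1) by (auto simp: homogeneous_def g_def hcomp_in_homog)
    have gm: "m \<in> Poly_Mapping.keys g" "\<And>k. k \<in> Poly_Mapping.keys g \<Longrightarrow> k \<noteq> m \<Longrightarrow> grevlex_less k m"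
      using f(2) by (auto simp: g_def keys_mon_part is_lead_mon_def n_def)
    define N where "N = {k \<in> Poly_Mapping.keys g. \<not> std_mon d e k}"
    have finN: "finite N" by (simp add: N_def)
    define p where "p = g - (\<Sum>k\<in>N. scal (Poly_Mapping.lookup g k) (monom_poly k - R k))"
    have lookup_p: "Poly_Mapping.lookup p j =
        Poly_Mapping.lookup g j - (\<Sum>k\<in>N. Poly_Mapping.lookup g k * ((if k = j then 1 else 0) - Poly_Mapping.lookup (R k) j))" for j
      by (simp add: p_def lookup_minus lookup_sum lookup_single when_def)
    have "scal (Poly_Mapping.lookup g k) (monom_poly k - R k) \<in> ideal B" if "k \<in> N" for k
      using R that by (intro mp.subspace_scale[OF subspace_ideal]) (simp add: N_def)
    then have "p \<in> ideal B"
      unfolding p_def using g(1) by (intro ideal_diff ideal_sum)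
    moreover have "p \<in> homog n"
      unfolding homog_def
    proof (intro CollectI ballI)
      fix j assume "j \<in> Poly_Mapping.keys p"
      moreover have "Poly_Mapping.lookup p j = 0" if "mon_degree j \<noteq> n"
      proof -
        have "Poly_Mapping.lookup g j = 0" using g(2) that by (auto simp: homog_def in_keys_iff)
        moreover have "(if k = j then 1 else 0) - Poly_Mapping.lookup (R k) j = 0" if "k \<in> N" for k
        proof -
          have "mon_degree k = n" using \<open>k \<in> N\<close> g(2) by (auto simp: N_def homog_def)
          moreover have "j \<notin> Poly_Mapping.keys (R k)"
            using R \<open>k \<in> N\<close> \<open>mon_degree j \<noteq> n\<close> calculation by (auto simp: N_def)
          ultimately show ?thesis using \<open>mon_degree j \<noteq> n\<close> by (auto simp: in_keys_iff)
        qed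
        ultimately show ?thesis by (simp add: lookup_p)
      qed
      ultimately show "mon_degree j = n" by (auto simp: in_keys_iff)
    qed
    moreover have "std_mon d e j" if "j \<in> Poly_Mapping.keys p" for j
    proof (rule ccontr)
      assume j: "\<not> std_mon d e j"
      have "Poly_Mapping.lookup (R k) j = 0" if "k \<in> N" for k
      proof -
        have "j \<notin> Poly_Mapping.keys (R k)" using R that j by (auto simp: N_def)
        then show ?thesis by (simp add: in_keys_iff)
      qed
      then have "Poly_Mapping.lookup p j =
          Poly_Mapping.lookup g j - (\<Sum>k\<in>N. if k = j then Poly_Mapping.lookup g k else 0)"
        unfolding lookup_p by (intro arg_cong2[where f = "(-)"] refl sum.cong) auto
      also have "\<dots> = 0"
        using finN j by (auto simp: N_def in_keys_iff)
      finally show False using that by (simp add: in_keys_iff)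
    qed
    ultimately have "p = 0" by (rule indep)
    moreover have "Poly_Mapping.lookup p m = Poly_Mapping.lookup g m"
    proof -
      have "(if k = m then 1 else 0) - Poly_Mapping.lookup (R k) m = 0" if "k \<in> N" for k
      proof -
        have k: "k \<noteq> m" "grevlex_less k m" "\<not> std_mon d e k"
          using that m gm(2) by (auto simp: N_def)
        then have "m \<notin> Poly_Mapping.keys (R k)" using R grevlex_less_asym by blast
        then show ?thesis using k by (simp add: in_keys_iff)
      qed
      then show ?thesis by (simp add: lookup_p)
    qed
    ultimately show False using gm(1) by (simp add: in_keys_iff)
  qed
qed

text \<open>The ideal generated by the nonstandard monomials.\<close>

definition gin_ideal :: "nat \<Rightarrow> nat \<Rightarrow> (3, 'a::comm_ring_1) mpoly set" where
  "gin_ideal d e = ideal {monom_poly m | m. \<not> std_mon d e m}"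

lemma Gin_eq:
  fixes f1 f2 f3 :: "(3, 'a::field_char_0) mpoly"
  assumes de: "d < e" "e + 1 < 2 * d"
    and f: "f1 \<in> homog d" "f2 \<in> homog d" "f3 \<in> homog e" and reg: "regular_sequence [f1, f2, f3]"
    and slp: "strong_Lefschetz (ideal {f1, f2, f3})"
  shows "Gin (ideal {f1, f2, f3}) = gin_ideal d e"
proof -
  let ?B = "{f1, f2, f3}"
  have hom: "homogeneous (ideal ?B)" and H: "\<And>n. hilb (ideal ?B) n = ci_hilb d e n"
    using complete_intersection_3[OF f reg] by blast+
  obtain A0 :: "'a ^ 3 ^ 3" where A0: "invertible A0" and indep0:
    "\<forall>n. \<forall>p\<in>lin_change A0 ` ideal ?B \<inter> homog n. (\<forall>m\<in>Poly_Mapping.keys p. std_mon d e m) \<longrightarrow> p = 0"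
    using standard_independent[OF de H slp regular_sequence_3(4)[OF reg]] by blast
  have "\<forall>n. \<exists>P. P \<in> poly_fun \<and> P A0 \<noteq> 0 \<and> (\<forall>A. invertible A \<and> P A \<noteq> 0 \<longrightarrow>
    (\<forall>p\<in>lin_change A ` ideal ?B \<inter> homog n. (\<forall>m\<in>Poly_Mapping.keys p. std_mon d e m) \<longrightarrow> p = 0))"
    by (rule allI, rule independent_mod_ideal_open[OF A0, unfolded Bex_def]) (rule indep0[rule_format], simp_all)
  then obtain P where P: "\<forall>n. P n \<in> poly_fun \<and> P n A0 \<noteq> 0 \<and> (\<forall>A. invertible A \<and> P n A \<noteq> 0 \<longrightarrow>
    (\<forall>p\<in>lin_change A ` ideal ?B \<inter> homog n. (\<forall>m\<in>Poly_Mapping.keys p. std_mon d e m) \<longrightarrow> p = 0))"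
    by (rule choice[THEN exE])
  \<comment> \<open>Finitely many conditions suffice, as there are no standard monomials in degrees above \<open>2 d + e\<close>.\<close>
  define Q where "Q A = (\<Prod>n\<le>2 * d + e. P n A)" for A
  define U where "U = {A. invertible A \<and> Q A \<noteq> 0}"
  have "Q \<in> poly_fun" unfolding Q_def using P by (intro poly_fun_prod) blast
  then have U_open: "zariski_open_GL3 U" unfolding U_def by (rule zariski_open_nonvanishing)
  have "A0 \<in> U" using A0 P by (simp add: U_def Q_def)
  have initial: "initial_ideal (lin_change A ` ideal ?B) = gin_ideal d e" if "A \<in> U" for A
  proof -
    have A: "invertible A" and PA: "\<And>n. n \<le> 2 * d + e \<Longrightarrow> P n A \<noteq> 0"
      using that by (auto simp: U_def Q_def)
    let ?C = "lin_change A ` ?B"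
    have image: "lin_change A ` ideal ?B = ideal ?C" by (rule lin_change_image_ideal[OF A])
    have homC: "homogeneous (ideal ?C)"
      using homogeneous_lin_change[OF hom, of A] by (simp only: image)
    have HC: "hilb (ideal ?C) n = ci_hilb d e n" for n
      using hilb_lin_change[OF A, of ?B n] by (simp only: image H)
    have indepC: "p = 0" if p: "p \<in> ideal ?C" "p \<in> homog n" "\<And>m. m \<in> Poly_Mapping.keys p \<Longrightarrow> std_mon d e m" for p n
    proof (cases "n \<le> 2 * d + e")
      case True
      then show ?thesis using P A PA p unfolding image[symmetric] by blast
    next
      case False
      have "Poly_Mapping.keys p = {}"
      proof (rule ccontr)
        assume "Poly_Mapping.keys p \<noteq> {}"
        then obtain m where m: "m \<in> Poly_Mapping.keys p" by blast
        then have "mon_degree m = n" using p(2) by (simp add: homog_def)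
        then show False using p(3)[OF m] False by (simp add: std_mon_def mon_degree_3)
      qed
      then show ?thesis by simp
    qed
    have "(\<exists>f\<in>ideal ?C. is_lead_mon m f) \<longleftrightarrow> \<not> std_mon d e m" for m
      by (rule lead_monomials[OF de homC HC]) (rule indepC)
    then show ?thesis unfolding initial_ideal_def gin_ideal_def image by simp
  qed
  show ?thesis
    unfolding Gin_def
  proof (rule the_equality)
    show "\<exists>U. zariski_open_GL3 U \<and> U \<noteq> {} \<and>
        (\<forall>A\<in>U. initial_ideal (lin_change A ` ideal ?B) = gin_ideal d e)"
      using U_open \<open>A0 \<in> U\<close> initial by blast
  next
    fix J assume "\<exists>U. zariski_open_GL3 U \<and> U \<noteq> {} \<and>
        (\<forall>A\<in>U. initial_ideal (lin_change A ` ideal ?B) = J)"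
    then obtain V where V: "zariski_open_GL3 V" "V \<noteq> {}"
      "\<forall>A\<in>V. initial_ideal (lin_change A ` ideal ?B) = J" by blast
    have "V \<inter> U \<noteq> {}"
      using zariski_open_GL3_inter[OF V(1,2) U_open] \<open>A0 \<in> U\<close> by blast
    then obtain A where "A \<in> V" "A \<in> U" by blast
    then show "J = gin_ideal d e" using V(3) initial by metis
  qed
qed

section \<open>The generators\<close>

text \<open>The monomial \<open>x\<^sub>1\<^sup>a x\<^sub>2\<^sup>b x\<^sub>3\<^sup>c\<close>.\<close>

abbreviation xmon :: "nat \<Rightarrow> nat \<Rightarrow> nat \<Rightarrow> (3, 'a::comm_ring_1) mpoly" where
  "xmon a b c \<equiv> monom_poly (mon3 a b c)"

lemma X_power_xmon: "X 1 ^ a = xmon a 0 0" "X 2 ^ b = xmon 0 b 0" "X 3 ^ c = xmon 0 0 c"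
  by (simp_all add: X_power mon3_def)

lemma X_xmon: "X 2 = xmon 0 1 0" "X 3 = xmon 0 0 1"
  by (simp_all add: mon3_def)

lemma xmon_mult: "xmon a b c * xmon a' b' c' = xmon (a + a') (b + b') (c + c')"
  by (simp add: mult_single mon3_add)

lemma mons12_xmon: "(*) (xmon 0 b0 c) ` mons12 k = {xmon a (b0 + b) c | a b. a + b = k}"
proof -
  have "(*) (xmon 0 b0 c) ` mons12 k = {xmon 0 b0 c * (X 1 ^ a * X 2 ^ b) | a b. a + b = k}"
    unfolding mons12_def by blast
  then show ?thesis by (simp only: X_power_xmon xmon_mult add_0_left add_0_right)
qed

lemma std_mon_xmon: "std_mon d e (mon3 a b c) \<longleftrightarrow> 2 * (a + b) + c + 3 \<le> 2 * d + e \<and> gam d e (a + b) \<le> b"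
  by (simp add: std_mon_def)

lemma xmon_in_ideal:
  fixes G :: "(3, 'a::comm_ring_1) mpoly set"
  assumes "xmon a' b' c' \<in> G" "a' \<le> a" "b' \<le> b" "c' \<le> c"
  shows "xmon a b c \<in> ideal G"
proof -
  have "(xmon a b c :: (3, 'a) mpoly) = xmon (a - a') (b - b') (c - c') * xmon a' b' c'"
    using assms(2-4) by (simp add: xmon_mult)
  also have "\<dots> \<in> ideal G" by (rule ideal_mult[OF ideal_base[OF assms(1)]])
  finally show ?thesis .
qed

lemma gin_ideal_eqI:
  fixes G :: "(3, 'a::comm_ring_1) mpoly set"
  assumes "\<And>g. g \<in> G \<Longrightarrow> \<exists>a b c. g = xmon a b c \<and> \<not> std_mon d e (mon3 a b c)"
    and "\<And>a b c. \<not> std_mon d e (mon3 a b c) \<Longrightarrow>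
      \<exists>a' b' c'. xmon a' b' c' \<in> G \<and> a' \<le> a \<and> b' \<le> b \<and> c' \<le> c"
  shows "gin_ideal d e = ideal G"
proof (rule equalityI)
  show "gin_ideal d e \<subseteq> ideal G"
    unfolding gin_ideal_def
  proof (rule ideal_least, rule subsetI)
    fix f :: "(3, 'a) mpoly" assume "f \<in> {monom_poly m | m. \<not> std_mon d e m}"
    then obtain m where m: "f = monom_poly m" "\<not> std_mon d e m" by blast
    obtain a b c where abc: "m = mon3 a b c" using mon3_lookup[of m] by metis
    show "f \<in> ideal G"
      using assms(2)[of a b c] m xmon_in_ideal unfolding abc by blast
  qed
  show "ideal G \<subseteq> gin_ideal d e"
    unfolding gin_ideal_def
  proof (rule ideal_least, rule subsetI)
    fix g assume "g \<in> G"
    then show "g \<in> ideal {monom_poly m | m. \<not> std_mon d e m}"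
      using assms(1) by (intro ideal_base) blast
  qed
qed

text \<open>
  A monomial \<open>x\<^sub>1\<^sup>a x\<^sub>2\<^sup>b\<close> of degree at least \<open>t\<close> with \<open>b \<ge> g\<close> is divisible by a monomial
  \<open>x\<^sub>1\<^bsup>t - s\<^esup> x\<^sub>2\<^sup>s\<close> with \<open>g \<le> s \<le> t\<close>.
\<close>

lemma segment_divisor:
  fixes a b t g :: nat
  assumes "t \<le> a + b" "g \<le> b" "g \<le> t"
  shows "\<exists>s. g \<le> s \<and> s \<le> t \<and> t - s \<le> a \<and> s \<le> b"
  using assms by (intro exI[of _ "max g (t - a)"]) auto

text \<open>
  The generators as explicit monomials, with the parity of the third degree resolved: it is
  \<open>2 h\<close> in the even case and \<open>2 h + 1\<close> in the odd case.
\<close>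

lemma gens_even_eq:
  assumes de: "d < 2 * h" "2 * h + 1 < 2 * d"
  shows "gens_even d (2 * h) =
    ({xmon d 0 0, xmon (d - 1) 1 0}
    \<union> {xmon (d - j - 1) (2 * j + 1) 0 | j. 1 \<le> j \<and> j \<le> 2 * h - d - 1}
    \<union> (\<Union>j\<in>{1..d - h}.
         {xmon (2 * d - 2 * h - 2 * j + 1) (4 * h - 2 * d + 3 * j - 2) 0,
          xmon (2 * d - 2 * h - 2 * j) (4 * h - 2 * d + 3 * j - 1) 0})
    \<union> {xmon (2 * j - 1 - i) (d + h - 3 * j + i) (2 * j) | i j.
         1 \<le> j \<and> j \<le> d - h - 1 \<and> i \<le> 2 * j - 1}
    \<union> (\<Union>j\<in>{1..2 * h - d}. {xmon a (4 * h - 2 * d + 2 - 2 * j + b) (2 * d - 2 * h - 2 + 2 * j) | a b.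
         a + b = 2 * d - 2 * h + j - 2})
    \<union> (\<Union>j\<in>{1..d}. {xmon a b (2 * h - 2 + 2 * j) | a b. a + b = d - j})
    :: (3, 'a::comm_ring_1) mpoly set)"
proof -
  have div: "(2 * d - 2 * h) div 2 = d - h" "(2 * d + 2 * h) div 2 = d + h"
    "(2 * d - 2 * h - 2) div 2 = d - h - 1" "2 * (2 * h) = 4 * h"
    using de by auto
  show ?thesis
    unfolding gens_even_def div X_power_xmon
    unfolding X_xmon xmon_mult mons12_xmon add_0_left add_0_right ..
qed

lemma gens_odd_eq:
  assumes de: "d < 2 * h + 1" "2 * h + 2 < 2 * d"
  shows "gens_odd d (2 * h + 1) =
    ({xmon d 0 0, xmon (d - 1) 1 0}
    \<union> {xmon (d - j - 1) (2 * j + 1) 0 | j. 1 \<le> j \<and> j \<le> 2 * h + 1 - d - 1}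
    \<union> (\<Union>j\<in>{1..d - h - 1}.
         {xmon (2 * d - (2 * h + 1) - 2 * j + 1) (4 * h + 2 - 2 * d + 3 * j - 2) 0,
          xmon (2 * d - (2 * h + 1) - 2 * j) (4 * h + 2 - 2 * d + 3 * j - 1) 0})
    \<union> {xmon 0 (d + h) 0, xmon 0 (d + h - 1) 1}
    \<union> {xmon (2 * j - i) (d + h - 1 - 3 * j + i) (2 * j + 1) | i j.
         1 \<le> j \<and> j \<le> d - h - 2 \<and> i \<le> 2 * j}
    \<union> (\<Union>j\<in>{1..2 * h + 1 - d}. {xmon a (4 * h + 2 - 2 * d + 2 - 2 * j + b) (2 * d - (2 * h + 1) - 2 + 2 * j) | a b.
         a + b = 2 * d - (2 * h + 1) + j - 2})
    \<union> (\<Union>j\<in>{1..d}. {xmon a b (2 * h + 1 - 2 + 2 * j) | a b. a + b = d - j})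
    :: (3, 'a::comm_ring_1) mpoly set)"
proof -
  have div: "(2 * d - (2 * h + 1) - 1) div 2 = d - h - 1" "(2 * d + (2 * h + 1) - 1) div 2 = d + h"
    "(2 * d + (2 * h + 1) - 3) div 2 = d + h - 1"
    "(2 * d - (2 * h + 1) - 3) div 2 = d - h - 2" "2 * (2 * h + 1) = 4 * h + 2"
    using de by auto
  show ?thesis
    unfolding gens_odd_def div X_power_xmon
    unfolding X_xmon xmon_mult mons12_xmon add_0_left add_0_right ..
qed

text \<open>
  The generators divisible by \<open>x\<^sub>3\<close> are the monomials \<open>x\<^sub>1\<^bsup>t - s\<^esup> x\<^sub>2\<^sup>s x\<^sub>3\<^sup>c\<close> on the line
  \<open>2 t + c = 2 d + e - 2\<close>, with \<open>gam d e t \<le> s \<le> t\<close>.  The families in the list correspond to the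
  ranges \<open>e \<le> t\<close>, \<open>d \<le> t < e\<close> and \<open>t < d\<close>, on which \<open>gam\<close> is linear.
\<close>

lemma even_x3_generator:
  assumes de: "d < 2 * h" "2 * h + 1 < 2 * d" and q: "1 \<le> q" "q \<le> d + h - 1"
    and t: "t = d + h - 1 - q" and s: "gam d (2 * h) t \<le> s" "s \<le> t"
  shows "(xmon (t - s) s (2 * q) :: (3, 'a::comm_ring_1) mpoly) \<in> gens_even d (2 * h)"
proof -
  have hd: "h + 1 \<le> d" "q + 1 \<le> d + h" using de q by linarith+
  then have t': "t + q + 1 = d + h" using t by linarith
  consider "q + h + 1 \<le> d" | "d \<le> q + h" "q + 1 \<le> h" | "h \<le> q" by linarith
  then show ?thesis
  proof cases
    case 1
    then have "2 * h \<le> t" using t' by linarith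
    then have gam: "gam d (2 * h) t + 3 * q = d + h"
      using t' de hd unfolding gam_def by linarith
    define i where "i = s + 3 * q - (d + h)"
    have i: "s + 3 * q = d + h + i" using s(1) gam unfolding i_def by linarith
    have eq: "t - s = 2 * q - 1 - i" "s = d + h - 3 * q + i" "i \<le> 2 * q - 1" "q \<le> d - h - 1"
      using i gam t' s q(1) 1 by linarith+
    have "xmon (2 * q - 1 - i) (d + h - 3 * q + i) (2 * q) \<in> (gens_even d (2 * h) :: (3, 'a) mpoly set)"
      unfolding gens_even_eq[OF de]
      by (rule UnI1, rule UnI1, intro UnI2 CollectI exI[of _ i] exI[of _ q] conjI refl eq(3,4) q(1))
    then show ?thesis unfolding eq(1) by (subst eq(2))
  next
    case 2
    define j where "j = q + 1 + h - d"
    have j: "j + d = q + 1 + h" using 2 unfolding j_def by linarith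
    then have "t + 1 \<le> 2 * h" "d \<le> t + 1" using t' 2 by linarith+
    then have gam: "gam d (2 * h) t + 2 * d = 2 * t + 2" unfolding gam_def by linarith
    define b where "b = s + 2 * d - (2 * t + 2)"
    have b: "s + 2 * d = b + 2 * t + 2" using s(1) gam unfolding b_def by linarith
    have "4 * h + 2 = 2 * d + 2 * j + gam d (2 * h) t" using gam j t' by linarith
    then have "4 * h - 2 * d + 2 - 2 * j = gam d (2 * h) t" using de j 2 by linarith
    then have eq: "s = 4 * h - 2 * d + 2 - 2 * j + b"
      using gam b by linarith
    have eq': "2 * q = 2 * d - 2 * h - 2 + 2 * j"
      using hd j by linarith
    have "t - s + b + 2 * h + 2 = 2 * d + j" using b j t' s(2) by linarith
    then have eq'': "t - s + b = 2 * d - 2 * h + j - 2" using hd by linarith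
    have mem: "j \<in> {1..2 * h - d}" using j 2 by simp
    have "xmon (t - s) (4 * h - 2 * d + 2 - 2 * j + b) (2 * d - 2 * h - 2 + 2 * j) \<in>
        (gens_even d (2 * h) :: (3, 'a) mpoly set)"
      unfolding gens_even_eq[OF de]
      by (rule UnI1, intro UnI2 UN_I[OF mem] CollectI exI[of _ "t - s"] exI[of _ b] conjI refl eq'')
    then show ?thesis unfolding eq[symmetric] eq'[symmetric] .
  next
    case 3
    define j where "j = q + 1 - h"
    have j: "j + h = q + 1" using 3 unfolding j_def by linarith
    have eq: "2 * q = 2 * h - 2 + 2 * j" "t - s + s = d - j" using de j t' s(2) by linarith+
    have mem: "j \<in> {1..d}" using j 3 hd(2) by simp
    show ?thesis
      unfolding gens_even_eq[OF de] eq(1)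
      by (intro UnI2 UN_I[OF mem] CollectI exI[of _ "t - s"] exI[of _ s] conjI refl eq(2))
  qed
qed

lemma gin_ideal_even:
  assumes de: "d < 2 * h" "2 * h + 1 < 2 * d"
  shows "gin_ideal d (2 * h) = (ideal (gens_even d (2 * h)) :: (3, 'a::comm_ring_1) mpoly set)"
proof (rule gin_ideal_eqI)
  fix g :: "(3, 'a) mpoly" assume "g \<in> gens_even d (2 * h)"
  then show "\<exists>a b c. g = xmon a b c \<and> \<not> std_mon d (2 * h) (mon3 a b c)"
    unfolding gens_even_eq[OF de]
  proof (elim UnE UN_E)
    assume "g \<in> {xmon d 0 0, xmon (d - 1) 1 0}"
    moreover have "\<not> std_mon d (2 * h) (mon3 d 0 0)" "\<not> std_mon d (2 * h) (mon3 (d - 1) 1 0)"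
      using de unfolding std_mon_xmon gam_def by linarith+
    ultimately show ?thesis by blast
  next
    assume "g \<in> {xmon (d - j - 1) (2 * j + 1) 0 | j. 1 \<le> j \<and> j \<le> 2 * h - d - 1}"
    then obtain j where j: "g = xmon (d - j - 1) (2 * j + 1) 0" "1 \<le> j" "j \<le> 2 * h - d - 1" by blast
    have "\<not> std_mon d (2 * h) (mon3 (d - j - 1) (2 * j + 1) 0)"
      using de j unfolding std_mon_xmon gam_def by linarith
    then show ?thesis using j(1) by blast
  next
    fix j assume j: "j \<in> {1..d - h}"
      and g: "g \<in> {xmon (2 * d - 2 * h - 2 * j + 1) (4 * h - 2 * d + 3 * j - 2) 0,
          xmon (2 * d - 2 * h - 2 * j) (4 * h - 2 * d + 3 * j - 1) 0}"
    have "\<not> std_mon d (2 * h) (mon3 (2 * d - 2 * h - 2 * j + 1) (4 * h - 2 * d + 3 * j - 2) 0)"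
      "\<not> std_mon d (2 * h) (mon3 (2 * d - 2 * h - 2 * j) (4 * h - 2 * d + 3 * j - 1) 0)"
      using de j unfolding std_mon_xmon gam_def atLeastAtMost_iff by linarith+
    then show ?thesis using g by blast
  next
    assume "g \<in> {xmon (2 * j - 1 - i) (d + h - 3 * j + i) (2 * j) | i j.
         1 \<le> j \<and> j \<le> d - h - 1 \<and> i \<le> 2 * j - 1}"
    then obtain i j where j: "g = xmon (2 * j - 1 - i) (d + h - 3 * j + i) (2 * j)"
      "1 \<le> j" "j \<le> d - h - 1" "i \<le> 2 * j - 1" by blast
    define a where "a = 2 * j - 1 - i"
    define b where "b = d + h - 3 * j + i"
    have "d + h \<le> a + b + 1 + j" using j unfolding a_def b_def by linarith
    then have "\<not> std_mon d (2 * h) (mon3 a b (2 * j))"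
      unfolding std_mon_xmon by auto
    then show ?thesis using j(1) unfolding a_def b_def by blast
  next
    fix j assume j: "j \<in> {1..2 * h - d}"
      and g: "g \<in> {xmon a (4 * h - 2 * d + 2 - 2 * j + b) (2 * d - 2 * h - 2 + 2 * j) | a b.
         a + b = 2 * d - 2 * h + j - 2}"
    then obtain a b where ab: "g = xmon a (4 * h - 2 * d + 2 - 2 * j + b) (2 * d - 2 * h - 2 + 2 * j)"
      "a + b = 2 * d - 2 * h + j - 2" by blast
    have "\<not> std_mon d (2 * h) (mon3 a (4 * h - 2 * d + 2 - 2 * j + b) (2 * d - 2 * h - 2 + 2 * j))"
    proof -
      define x where "x = 4 * h - 2 * d + 2 - 2 * j"
      define y where "y = 2 * d - 2 * h - 2 + 2 * j"
      have "x + 2 * d + 2 * j = 4 * h + 2" "y + 2 * h + 2 = 2 * d + 2 * j" "a + b + 2 * h + 2 = 2 * d + j"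
        using de j ab(2) unfolding x_def y_def atLeastAtMost_iff by linarith+
      then have "2 * d + 2 * h < 2 * (a + (x + b)) + y + 3" by simp
      then show ?thesis unfolding std_mon_xmon x_def y_def by simp
    qed
    then show ?thesis using ab(1) by blast
  next
    fix j assume j: "j \<in> {1..d}" and g: "g \<in> {xmon a b (2 * h - 2 + 2 * j) | a b. a + b = d - j}"
    then obtain a b where ab: "g = xmon a b (2 * h - 2 + 2 * j)" "a + b = d - j" by blast
    have "\<not> std_mon d (2 * h) (mon3 a b (2 * h - 2 + 2 * j))"
    proof -
      have "a + b + j = d" "2 * h - 2 + 2 = 2 * h" using de j ab(2) by auto
      then have "2 * d + 2 * h < 2 * (a + b) + (2 * h - 2 + 2 * j) + 3" by simp
      then show ?thesis unfolding std_mon_xmon by simp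
    qed
    then show ?thesis using ab(1) by blast
  qed
next
  fix a b c assume ns: "\<not> std_mon d (2 * h) (mon3 a b c)"
  let ?G = "gens_even d (2 * h) :: (3, 'a) mpoly set"
  show "\<exists>a' b' c'. xmon a' b' c' \<in> ?G \<and> a' \<le> a \<and> b' \<le> b \<and> c' \<le> c"
  proof (cases "b < gam d (2 * h) (a + b)")
    case True
    then have lt: "b < 2 * (a + b + 1 - d) + (a + b + 1 - 2 * h)" by (simp only: gam_def)
    consider "d \<le> a" | "a = d - 1" | j where "a = d - j - 1" "1 \<le> j" "j \<le> 2 * h - d - 1"
      | i where "a = 2 * d - 2 * h - 2 * i + 1" "1 \<le> i" "i \<le> d - h"
      | i where "a = 2 * d - 2 * h - 2 * i" "1 \<le> i" "i \<le> d - h"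
    proof -
      consider "d \<le> a" | "a + 1 = d" | "a + 1 < d" "2 * d \<le> a + 2 * h" | "a + 2 * h < 2 * d"
        using de by linarith
      then show thesis
      proof cases
        case 1
        then show thesis by (rule that(1))
      next
        case 2
        then have "a = d - 1" by simp
        then show thesis by (rule that(2))
      next
        case 3
        define j where "j = d - 1 - a"
        have "a = d - j - 1" "1 \<le> j" "j \<le> 2 * h - d - 1"
          using 3 unfolding j_def by linarith+
        then show thesis by (rule that(3))
      next
        case 4
        define k where "k = 2 * d - 2 * h - a"
        have k: "a + 2 * h + k = 2 * d" "1 \<le> k" using 4 unfolding k_def by linarith+
        show thesis
        proof (cases "even k")
          case True
          then obtain i where i: "k = 2 * i" by blast
          have "a = 2 * d - 2 * h - 2 * i" "1 \<le> i" "i \<le> d - h" using k unfolding i by linarith+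
          then show thesis by (rule that(5))
        next
          case False
          then obtain i where i: "k = 2 * i + 1" by (rule oddE)
          have "a = 2 * d - 2 * h - 2 * (i + 1) + 1" "1 \<le> i + 1" "i + 1 \<le> d - h"
            using k unfolding i by presburger+
          then show thesis by (rule that(4))
        qed
      qed
    qed
    then show ?thesis
    proof cases
      case 1
      have "xmon d 0 0 \<in> ?G" unfolding gens_even_eq[OF de] by blast
      then show ?thesis using 1 by (intro exI conjI) auto
    next
      case 2
      have "1 \<le> b" using 2 lt de by linarith
      moreover have "xmon (d - 1) 1 0 \<in> ?G" unfolding gens_even_eq[OF de] by blast
      ultimately show ?thesis using 2 by (intro exI conjI) auto
    next
      case (3 j)
      have "2 * j + 1 \<le> b" using 3 lt de by linarith
      moreover have "xmon (d - j - 1) (2 * j + 1) 0 \<in> ?G"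
        unfolding gens_even_eq[OF de] using 3 by blast
      ultimately show ?thesis using 3 by (intro exI conjI) auto
    next
      case (4 i)
      have "4 * h - 2 * d + 3 * i - 2 \<le> b" using 4 lt de by linarith
      moreover have "xmon (2 * d - 2 * h - 2 * i + 1) (4 * h - 2 * d + 3 * i - 2) 0 \<in> ?G"
        unfolding gens_even_eq[OF de]
        by (rule UnI1, rule UnI1, rule UnI1, rule UnI2, rule UN_I[of i]) (use 4(2,3) in auto)
      ultimately show ?thesis using 4 by (intro exI conjI) auto
    next
      case (5 i)
      have "4 * h - 2 * d + 3 * i - 1 \<le> b" using 5 lt de by linarith
      moreover have "xmon (2 * d - 2 * h - 2 * i) (4 * h - 2 * d + 3 * i - 1) 0 \<in> ?G"
        unfolding gens_even_eq[OF de]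
        by (rule UnI1, rule UnI1, rule UnI1, rule UnI2, rule UN_I[of i]) (use 5(2,3) in auto)
      ultimately show ?thesis using 5 by (intro exI conjI) auto
    qed
  next
    case False
    then have c: "2 * d + 2 * h < 2 * (a + b) + c + 3" using ns unfolding std_mon_xmon by linarith
    \<comment> \<open>The exponent \<open>2 q\<close> of \<open>x\<^sub>3\<close> is the largest one among the generators that is at most \<open>c\<close>.\<close>
    define q where "q = min (c div 2) (d + h - 1)"
    define t where "t = d + h - 1 - q"
    have ge: "2 * (a + b + 1 - d) + (a + b + 1 - 2 * h) \<le> b" using False by (simp only: gam_def)
    have "a + b + 2 \<le> d + h" using ge de by linarith
    then have "2 \<le> c" using c by simp
    then have "1 \<le> c div 2" by simp
    then have q: "1 \<le> q" "q \<le> d + h - 1" "2 * q \<le> c" and "q = d + h - 1 \<or> c \<le> 2 * q + 1"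
      using de unfolding q_def by linarith+
    moreover have "t + q + 1 = d + h" using q(1,2) unfolding t_def by linarith
    ultimately have t: "t \<le> a + b" using c by auto
    have "gam d (2 * h) t \<le> b" using gam_mono[of d "2 * h" t "a + b"] de t False by linarith
    moreover have "gam d (2 * h) t \<le> t" using de q(1,2) unfolding gam_def t_def by linarith
    ultimately obtain s where s: "gam d (2 * h) t \<le> s" "s \<le> t" "t - s \<le> a" "s \<le> b"
      using segment_divisor[OF t] by blast
    have "xmon (t - s) s (2 * q) \<in> ?G"
      by (rule even_x3_generator[OF de q(1,2) t_def s(1,2)])
    then show ?thesis using s q(3) by blast
  qed
qed

lemma odd_x3_generator:
  assumes de: "d < 2 * h + 1" "2 * h + 2 < 2 * d" and q: "q \<le> d + h - 1"
    and t: "t = d + h - 1 - q" and s: "gam d (2 * h + 1) t \<le> s" "s \<le> t"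
  shows "(xmon (t - s) s (2 * q + 1) :: (3, 'a::comm_ring_1) mpoly) \<in> gens_odd d (2 * h + 1)"
proof -
  have hd: "h + 2 \<le> d" "q + 1 \<le> d + h" using de q by linarith+
  then have t': "t + q + 1 = d + h" using t by linarith
  consider "q = 0" | "1 \<le> q" "q + h + 2 \<le> d" | "d \<le> q + h + 1" "q + 1 \<le> h" | "h \<le> q"
    using hd by linarith
  then show ?thesis
  proof cases
    case 1
    then have "gam d (2 * h + 1) t = t" using t' de hd unfolding gam_def by linarith
    then have eq: "t - s = 0" "s = d + h - 1" "2 * q + 1 = 1" using s t' 1 by linarith+
    have "xmon 0 (d + h - 1) 1 \<in> (gens_odd d (2 * h + 1) :: (3, 'a) mpoly set)"
      unfolding gens_odd_eq[OF de] by (rule UnI1, rule UnI1, rule UnI1, rule UnI2) blast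
    then show ?thesis unfolding eq(1,3) by (subst eq(2))
  next
    case 2
    then have "2 * h + 1 \<le> t" using t' by linarith
    then have gam: "gam d (2 * h + 1) t + 3 * q + 1 = d + h"
      using t' de hd unfolding gam_def by linarith
    define i where "i = s + 3 * q + 1 - (d + h)"
    have i: "s + 3 * q + 1 = d + h + i" using s(1) gam unfolding i_def by linarith
    have eq: "t - s = 2 * q - i" "s = d + h - 1 - 3 * q + i" "i \<le> 2 * q" "q \<le> d - h - 2"
      using i gam t' s 2 by linarith+
    have "xmon (2 * q - i) (d + h - 1 - 3 * q + i) (2 * q + 1) \<in> (gens_odd d (2 * h + 1) :: (3, 'a) mpoly set)"
      unfolding gens_odd_eq[OF de]
      by (rule UnI1, rule UnI1, intro UnI2 CollectI exI[of _ i] exI[of _ q] conjI refl eq(3,4) 2(1))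
    then show ?thesis unfolding eq(1) by (subst eq(2))
  next
    case 3
    define j where "j = q + 2 + h - d"
    have j: "j + d = q + 2 + h" using 3 unfolding j_def by linarith
    then have "t \<le> 2 * h" "d \<le> t + 1" using t' 3 by linarith+
    then have gam: "gam d (2 * h + 1) t + 2 * d = 2 * t + 2" unfolding gam_def by linarith
    define b where "b = s + 2 * d - (2 * t + 2)"
    have b: "s + 2 * d = b + 2 * t + 2" using s(1) gam unfolding b_def by linarith
    have "4 * h + 4 = 2 * d + 2 * j + gam d (2 * h + 1) t" using gam j t' by linarith
    then have "4 * h + 2 - 2 * d + 2 - 2 * j = gam d (2 * h + 1) t" using de j 3 by linarith
    then have eq: "s = 4 * h + 2 - 2 * d + 2 - 2 * j + b"
      using gam b by linarith
    have eq': "2 * q + 1 = 2 * d - (2 * h + 1) - 2 + 2 * j"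
      using hd j by linarith
    have "t - s + b + 2 * h + 3 = 2 * d + j" using b j t' s(2) by linarith
    then have eq'': "t - s + b = 2 * d - (2 * h + 1) + j - 2" using hd by linarith
    have mem: "j \<in> {1..2 * h + 1 - d}" using j 3 by simp
    have "xmon (t - s) (4 * h + 2 - 2 * d + 2 - 2 * j + b) (2 * d - (2 * h + 1) - 2 + 2 * j) \<in>
        (gens_odd d (2 * h + 1) :: (3, 'a) mpoly set)"
      unfolding gens_odd_eq[OF de]
      by (rule UnI1, intro UnI2 UN_I[OF mem] CollectI exI[of _ "t - s"] exI[of _ b] conjI refl eq'')
    then show ?thesis unfolding eq[symmetric] eq'[symmetric] .
  next
    case 4
    define j where "j = q + 1 - h"
    have j: "j + h = q + 1" using 4 unfolding j_def by linarith
    have "1 \<le> h" using de by linarith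
    then have eq: "2 * q + 1 = 2 * h + 1 - 2 + 2 * j" "t - s + s = d - j"
      using j t' s(2) by linarith+
    have mem: "j \<in> {1..d}" using j 4 hd(2) by simp
    show ?thesis
      unfolding gens_odd_eq[OF de] eq(1)
      by (intro UnI2 UN_I[OF mem] CollectI exI[of _ "t - s"] exI[of _ s] conjI refl eq(2))
  qed
qed

lemma gin_ideal_odd:
  assumes de: "d < 2 * h + 1" "2 * h + 2 < 2 * d"
  shows "gin_ideal d (2 * h + 1) = (ideal (gens_odd d (2 * h + 1)) :: (3, 'a::comm_ring_1) mpoly set)"
proof (rule gin_ideal_eqI)
  fix g :: "(3, 'a) mpoly" assume "g \<in> gens_odd d (2 * h + 1)"
  then show "\<exists>a b c. g = xmon a b c \<and> \<not> std_mon d (2 * h + 1) (mon3 a b c)"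
    unfolding gens_odd_eq[OF de]
  proof (elim UnE UN_E)
    assume "g \<in> {xmon d 0 0, xmon (d - 1) 1 0}"
    moreover have "\<not> std_mon d (2 * h + 1) (mon3 d 0 0)" "\<not> std_mon d (2 * h + 1) (mon3 (d - 1) 1 0)"
      using de unfolding std_mon_xmon gam_def by linarith+
    ultimately show ?thesis by blast
  next
    assume "g \<in> {xmon (d - j - 1) (2 * j + 1) 0 | j. 1 \<le> j \<and> j \<le> 2 * h + 1 - d - 1}"
    then obtain j where j: "g = xmon (d - j - 1) (2 * j + 1) 0" "1 \<le> j" "j \<le> 2 * h + 1 - d - 1" by blast
    have "\<not> std_mon d (2 * h + 1) (mon3 (d - j - 1) (2 * j + 1) 0)"
      using de j unfolding std_mon_xmon gam_def by linarith
    then show ?thesis using j(1) by blast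
  next
    fix j assume j: "j \<in> {1..d - h - 1}"
      and g: "g \<in> {xmon (2 * d - (2 * h + 1) - 2 * j + 1) (4 * h + 2 - 2 * d + 3 * j - 2) 0,
          xmon (2 * d - (2 * h + 1) - 2 * j) (4 * h + 2 - 2 * d + 3 * j - 1) 0}"
    define a b a' b' where "a = 2 * d - (2 * h + 1) - 2 * j + 1" and "b = 4 * h + 2 - 2 * d + 3 * j - 2"
      and "a' = 2 * d - (2 * h + 1) - 2 * j" and "b' = 4 * h + 2 - 2 * d + 3 * j - 1"
    note ab = this
    have j': "1 \<le> j" "j + h + 1 \<le> d" "d \<le> 2 * h" using j de by auto
    have b: "b + 2 * d = 4 * h + 3 * j" "b' + 2 * d = 4 * h + 3 * j + 1" using j' unfolding ab by linarith+
    have "a + 2 * h + 2 * j = 2 * d" "a' + 2 * h + 1 + 2 * j = 2 * d" using j' unfolding ab by linarith+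
    then have sum: "a + b = 2 * h + j" "a' + b' = 2 * h + j" using b by linarith+
    have "b < gam d (2 * h + 1) (a + b)" "b' < gam d (2 * h + 1) (a' + b')"
      using b j' unfolding gam_def sum by linarith+
    then have "\<not> std_mon d (2 * h + 1) (mon3 a b 0)" "\<not> std_mon d (2 * h + 1) (mon3 a' b' 0)"
      unfolding std_mon_xmon by simp_all
    then show ?thesis using g unfolding ab by blast
  next
    assume "g \<in> {xmon 0 (d + h) 0, xmon 0 (d + h - 1) 1}"
    moreover have "\<not> std_mon d (2 * h + 1) (mon3 0 (d + h) 0)"
      "\<not> std_mon d (2 * h + 1) (mon3 0 (d + h - 1) 1)"
      using de unfolding std_mon_xmon by auto
    ultimately show ?thesis by blast
  next
    assume "g \<in> {xmon (2 * j - i) (d + h - 1 - 3 * j + i) (2 * j + 1) | i j.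
         1 \<le> j \<and> j \<le> d - h - 2 \<and> i \<le> 2 * j}"
    then obtain i j where j: "g = xmon (2 * j - i) (d + h - 1 - 3 * j + i) (2 * j + 1)"
      "1 \<le> j" "j \<le> d - h - 2" "i \<le> 2 * j" by blast
    define a where "a = 2 * j - i"
    define b where "b = d + h - 1 - 3 * j + i"
    have "d + h \<le> a + b + 1 + j" using j unfolding a_def b_def by linarith
    then have "\<not> std_mon d (2 * h + 1) (mon3 a b (2 * j + 1))"
      unfolding std_mon_xmon by auto
    then show ?thesis using j(1) unfolding a_def b_def by blast
  next
    fix j assume j: "j \<in> {1..2 * h + 1 - d}"
      and g: "g \<in> {xmon a (4 * h + 2 - 2 * d + 2 - 2 * j + b) (2 * d - (2 * h + 1) - 2 + 2 * j) | a b.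
         a + b = 2 * d - (2 * h + 1) + j - 2}"
    then obtain a b where ab: "g = xmon a (4 * h + 2 - 2 * d + 2 - 2 * j + b) (2 * d - (2 * h + 1) - 2 + 2 * j)"
      "a + b = 2 * d - (2 * h + 1) + j - 2" by blast
    have "\<not> std_mon d (2 * h + 1) (mon3 a (4 * h + 2 - 2 * d + 2 - 2 * j + b) (2 * d - (2 * h + 1) - 2 + 2 * j))"
    proof -
      define x where "x = 4 * h + 2 - 2 * d + 2 - 2 * j"
      define y where "y = 2 * d - (2 * h + 1) - 2 + 2 * j"
      have "x + 2 * d + 2 * j = 4 * h + 4" "y + 2 * h + 3 = 2 * d + 2 * j" "a + b + 2 * h + 3 = 2 * d + j"
        using de j ab(2) unfolding x_def y_def atLeastAtMost_iff by linarith+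
      then have "2 * d + (2 * h + 1) < 2 * (a + (x + b)) + y + 3" by simp
      then show ?thesis unfolding std_mon_xmon x_def y_def by simp
    qed
    then show ?thesis using ab(1) by blast
  next
    fix j assume j: "j \<in> {1..d}" and g: "g \<in> {xmon a b (2 * h + 1 - 2 + 2 * j) | a b. a + b = d - j}"
    then obtain a b where ab: "g = xmon a b (2 * h + 1 - 2 + 2 * j)" "a + b = d - j" by blast
    have "\<not> std_mon d (2 * h + 1) (mon3 a b (2 * h + 1 - 2 + 2 * j))"
    proof -
      have "a + b + j = d" "2 * h + 1 - 2 + 2 = 2 * h + 1" using de j ab(2) by auto
      then have "2 * d + (2 * h + 1) < 2 * (a + b) + (2 * h + 1 - 2 + 2 * j) + 3" by simp
      then show ?thesis unfolding std_mon_xmon by simp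
    qed
    then show ?thesis using ab(1) by blast
  qed
next
  fix a b c assume ns: "\<not> std_mon d (2 * h + 1) (mon3 a b c)"
  let ?G = "gens_odd d (2 * h + 1) :: (3, 'a) mpoly set"
  show "\<exists>a' b' c'. xmon a' b' c' \<in> ?G \<and> a' \<le> a \<and> b' \<le> b \<and> c' \<le> c"
  proof (cases "b < gam d (2 * h + 1) (a + b)")
    case True
    then have lt: "b < 2 * (a + b + 1 - d) + (a + b + 1 - (2 * h + 1))" by (simp only: gam_def)
    consider "d \<le> a" | "a = d - 1" | j where "a = d - j - 1" "1 \<le> j" "j \<le> 2 * h + 1 - d - 1"
      | i where "a = 2 * d - (2 * h + 1) - 2 * i + 1" "1 \<le> i" "i \<le> d - h - 1"
      | i where "a = 2 * d - (2 * h + 1) - 2 * i" "1 \<le> i" "i \<le> d - h - 1" | "a = 0"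
    proof -
      consider "d \<le> a" | "a + 1 = d" | "a + 1 < d" "2 * d \<le> a + 2 * h + 1" | "a + 2 * h + 1 < 2 * d"
        using de by linarith
      then show thesis
      proof cases
        case 1
        then show thesis by (rule that(1))
      next
        case 2
        then have "a = d - 1" by simp
        then show thesis by (rule that(2))
      next
        case 3
        define j where "j = d - 1 - a"
        have "a = d - j - 1" "1 \<le> j" "j \<le> 2 * h + 1 - d - 1"
          using 3 unfolding j_def by linarith+
        then show thesis by (rule that(3))
      next
        case 4
        define k where "k = 2 * d - (2 * h + 1) - a"
        have k: "a + 2 * h + 1 + k = 2 * d" "1 \<le> k" using 4 unfolding k_def by linarith+
        show thesis
        proof (cases "even k")
          case True
          then obtain i where i: "k = 2 * i" by blast
          have "a = 2 * d - (2 * h + 1) - 2 * i" "1 \<le> i" "i \<le> d - h - 1" using k unfolding i by linarith+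
          then show thesis by (rule that(5))
        next
          case False
          then obtain i where i: "k = 2 * i + 1" by (rule oddE)
          show thesis
          proof (cases "a = 0")
            case False
            then have "a = 2 * d - (2 * h + 1) - 2 * (i + 1) + 1" "1 \<le> i + 1" "i + 1 \<le> d - h - 1"
              using k unfolding i by presburger+
            then show thesis by (rule that(4))
          qed (rule that(6))
        qed
      qed
    qed
    then show ?thesis
    proof cases
      case 1
      have "xmon d 0 0 \<in> ?G" unfolding gens_odd_eq[OF de] by blast
      then show ?thesis using 1 by (intro exI conjI) auto
    next
      case 2
      have "1 \<le> b" using 2 lt de by linarith
      moreover have "xmon (d - 1) 1 0 \<in> ?G" unfolding gens_odd_eq[OF de] by blast
      ultimately show ?thesis using 2 by (intro exI conjI) auto
    next
      case (3 j)
      have "2 * j + 1 \<le> b" using 3 lt de by linarith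
      moreover have "xmon (d - j - 1) (2 * j + 1) 0 \<in> ?G"
        unfolding gens_odd_eq[OF de] using 3 by blast
      ultimately show ?thesis using 3 by (intro exI conjI) auto
    next
      case (4 i)
      have "4 * h + 2 - 2 * d + 3 * i - 2 \<le> b" using 4 lt de by linarith
      moreover have "xmon (2 * d - (2 * h + 1) - 2 * i + 1) (4 * h + 2 - 2 * d + 3 * i - 2) 0 \<in> ?G"
        unfolding gens_odd_eq[OF de]
        by (rule UnI1, rule UnI1, rule UnI1, rule UnI1, rule UnI2, rule UN_I[of i]) (use 4(2,3) in auto)
      ultimately show ?thesis using 4 by (intro exI conjI) auto
    next
      case (5 i)
      have "4 * h + 2 - 2 * d + 3 * i - 1 \<le> b" using 5 lt de by linarith
      moreover have "xmon (2 * d - (2 * h + 1) - 2 * i) (4 * h + 2 - 2 * d + 3 * i - 1) 0 \<in> ?G"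
        unfolding gens_odd_eq[OF de]
        by (rule UnI1, rule UnI1, rule UnI1, rule UnI1, rule UnI2, rule UN_I[of i]) (use 5(2,3) in auto)
      ultimately show ?thesis using 5 by (intro exI conjI) auto
    next
      case 6
      have "d + h \<le> b" using 6 lt de by linarith
      moreover have "xmon 0 (d + h) 0 \<in> ?G"
        unfolding gens_odd_eq[OF de] by (rule UnI1, rule UnI1, rule UnI1, rule UnI2) blast
      ultimately show ?thesis using 6 by (intro exI conjI) auto
    qed
  next
    case False
    then have c: "2 * d + (2 * h + 1) < 2 * (a + b) + c + 3" using ns unfolding std_mon_xmon by linarith
    \<comment> \<open>The exponent \<open>2 q + 1\<close> of \<open>x\<^sub>3\<close> is the largest one among the generators that is at most \<open>c\<close>.\<close>
    define q where "q = min ((c - 1) div 2) (d + h - 1)"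
    define t where "t = d + h - 1 - q"
    have ge: "2 * (a + b + 1 - d) + (a + b + 1 - (2 * h + 1)) \<le> b" using False by (simp only: gam_def)
    have "a + b + 1 \<le> d + h" using ge de by linarith
    then have "1 \<le> c" using c by simp
    then have q: "q \<le> d + h - 1" "2 * q + 1 \<le> c" and "q = d + h - 1 \<or> c \<le> 2 * q + 2"
      using de unfolding q_def by linarith+
    moreover have "t + q + 1 = d + h" using q(1) de unfolding t_def by linarith
    ultimately have t: "t \<le> a + b" using c by auto
    have "gam d (2 * h + 1) t \<le> b" using gam_mono[of d "2 * h + 1" t "a + b"] de t False by linarith
    moreover have "gam d (2 * h + 1) t \<le> t" using de q(1) unfolding gam_def t_def by linarith
    ultimately obtain s where s: "gam d (2 * h + 1) t \<le> s" "s \<le> t" "t - s \<le> a" "s \<le> b"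
      using segment_divisor[OF t] by blast
    have "xmon (t - s) s (2 * q + 1) \<in> ?G"
      by (rule odd_x3_generator[OF de q(1) t_def s(1,2)])
    then show ?thesis using s q(2) by blast
  qed
qed

theorem proposition2p3p8:
  fixes f1 f2 f3 :: "(3, 'a::field_char_0) mpoly"
    and d d3 :: nat
    and I J :: "(3, 'a) mpoly set"
  assumes "2 \<le> d" and "d < d3" and "2 * d > d3 + 1"
    and "f1 \<in> homog d" and "f2 \<in> homog d" and "f3 \<in> homog d3"
    and "regular_sequence [f1, f2, f3]"
    and "I = ideal {f1, f2, f3}"
    and "J = Gin I"
    and "strong_Lefschetz I"
  shows "(even d3 \<longrightarrow> J = ideal (gens_even d d3)) \<and>
         (odd d3 \<longrightarrow> J = ideal (gens_odd d d3))"
proof -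
  have "J = gin_ideal d d3"
    using Gin_eq[of d d3 f1 f2 f3] assms by simp
  moreover have "gin_ideal d d3 = (ideal (gens_even d d3) :: (3, 'a) mpoly set)" if "even d3"
  proof -
    obtain h where "d3 = 2 * h" using \<open>even d3\<close> by blast
    then show ?thesis using gin_ideal_even[of d h] assms(2,3) by simp
  qed
  moreover have "gin_ideal d d3 = (ideal (gens_odd d d3) :: (3, 'a) mpoly set)" if "odd d3"
  proof -
    obtain h where "d3 = 2 * h + 1" using \<open>odd d3\<close> by (rule oddE)
    then show ?thesis using gin_ideal_odd[of d h] assms(2,3) by simp
  qed
  ultimately show ?thesis by simp
qed

end
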